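(* Let $(|X|,S,\{F_j\}_{j\in S})$ be a cellular self-similar structure in $\mathbb{R}^2$ with $\#S\ge 2$, let $K_{|X|}$ be the cellular self-similar set with respect to $(|X|,S,\{F_j\}_{j\in S})$, and let $C^{\alpha}(K_{|X|})$ be the algebra of complex-valued $\alpha$-Hölder continuous functions on $K_{|X|}$, where $\alpha>0$. If $2\alpha>\dim_H(K_{|X|})$ (Hausdorff dimension), then for any $f,g\in C^{\alpha}(K_{|X|})$ the cyclic quasi-$1$-cocycle $\{\phi_n(f,g)\}_{n\in\mathbb{N}}$ is a Cauchy sequence in $\mathbb{C}$.
   Context: All spaces lie in $\mathbb{R}^2$ with the Euclidean metric; $\partial$ and $\operatorname{int}$ denote boundary and interior in $\mathbb{R}^2$. Cellular self-similar structure. A finite convex linear cell complex $X$ in $\mathbb{R}^2$ is a finite collection of convex cells (points, closed segments, closed convex polygons) closed under taking faces and such that any two cells meet in a common face or not at all; $|X|$ is its union and $sk_k(|X|)$ the union of its cells of dimension $\le k$. A similitude $F:|X|\to|X|$ is a map with $|F(x)-F(y)|=r|x-y|$ for all $x,y$, for some constant $0<r\le 1$. Let $|X|$ be a 2-dimensional finite convex linear cell complex, $S$ a finite set, $\{F_j\}_{j\in S}$ similitudes $F_j:|X|\to|X|$, and $|X_1|=\bigcup_{j\in S}F_j(|X|)$. The triple $(|X|,S,\{F_j\}_{j\in S})$ is a cellular self-similar structure if (a) $\partial|X|\subset\partial|X_1|$ and (b) $\operatorname{int}F_i(|X|)\cap\operatorname{int}F_j(|X|)=\emptyset$ for all $i\ne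 j\in S$. The cellular self-similar set $K_{|X|}$ is the unique non-empty compact set $K\subset |X|$ with $K=\bigcup_{j\in S}F_j(K)$. The complexes $|X_n|$. For $\omega=(j_1,\dots,j_n)\in S^{\times n}$ put $F_\omega=F_{j_1}\circ\cdots\circ F_{j_n}$. The cell complex $|X_n|$ has skeleta $sk_k(|X_n|)=\bigcup_{\omega\in S^{\times n}}F_\omega(sk_k(|X|))$, $k=0,1,2$ (so $|X_n|=\bigcup_\omega F_\omega(|X|)$ and $|X_0|=|X|$); its 1-cells are the closures of the connected components of $sk_1(|X_n|)-sk_0(|X_n|)$. Subdivide $|X_n|$ into a simplicial complex $X_n^s$ without introducing new vertices. Chains. $S_p(X_n^s)$ is the set of ordered $(p+1)$-tuples of vertices of $X_n^s$ contained in a common simplex; a tuple with a repeated vertex is called degenerate. $\tilde S_p(X_n^s;\mathbb{C})$ is the free $\mathbb{C}$-module on $S_p(X_n^s)$, with $\tilde\partial_p(x_0,\dots,x_p)=\sum_j(-1)^j(x_0,\dots,\hat x_j,\dots,x_p)$, and $\pi$ is the quotient map onto the (oriented) simplicial chain complex $C_*(X_n^s;\mathbb{C})$. Let $c_n\in C_2(X_n^s;\mathbb{C})$ be the sum of all 2-simplices, each oriented counterclockwise. Choose $s_n\in\pi^{-1}(c_n)$ containing no degenerate simplices and such that each simplex occurring in $\tilde\partial_2(s_n)$ lies on $\partial|X_n|$. Put $b_n=\tilde\partial_2(s_n)$, let $\epsilon(b_n)$ be the set of $1$-simplices occurring in $b_n$, let $\operatorname{sgn}(\sigma)$ be the sign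 (coefficient) with which $\sigma$ occurs in $b_n$, and let $\epsilon(o_n)=\{\sigma\in\epsilon(b_n): |\sigma|\subset\partial|X|\}$, where $|\sigma|$ is the segment spanned by $\sigma$. Put $o_n=\sum_{\sigma\in\epsilon(o_n)}\operatorname{sgn}(\sigma)\,\sigma$ and $I_n=b_n-o_n\in\tilde S_1(X_n^s;\mathbb{C})$. Cyclic quasi-1-cocycle. $C^\alpha(K_{|X|})$ consists of the functions $f:K_{|X|}\to\mathbb{C}$ for which there is a constant $c_f$ with $|f(x)-f(y)|\le c_f|x-y|^\alpha$ for all $x,y$. The vertices occurring in $I_n$ lie in $K_{|X|}$. For $f,g\in C^\alpha(K_{|X|})$ let $\omega_n(f,g)=f\smile\delta g-g\smile\delta f$, i.e. the linear functional on 1-chains determined by $\omega_n(f,g)(x,y)=f(x)(g(y)-g(x))-g(x)(f(y)-f(x))$, and set $\phi_n(f,g)=\omega_n(f,g)(I_n)\in\mathbb{C}$. The sequence $\{\phi_n(f,g)\}_{n\in\mathbb{N}}$ is called the cyclic quasi-$1$-cocycle of $f$ and $g$. *)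

theory Defs
  imports
    "HOL-Analysis.Analysis"
    "HOL-Library.Poly_Mapping"
    "HOL-Combinatorics.Permutations"
begin

type_synonym plane = "real ^ 2"

section \<open>Hausdorff dimension\<close>

text \<open>The gauge \<open>diam(U)\<^sup>s\<close>. The case \<open>s = 0\<close> is separate because \<open>0 powr 0 = 0\<close> here,
  whereas the counting measure needs the value 1 on one-point sets.\<close>

definition hausdorff_gauge :: "real \<Rightarrow> 'a::metric_space set \<Rightarrow> ennreal" where
  "hausdorff_gauge s U =
     (if U = {} then 0 else if s = 0 then 1 else ennreal (diameter U powr s))"

text \<open>Boundedness is required explicitly because \<^const>\<open>diameter\<close> has no meaningful value on
  unbounded sets.\<close>

definition hausdorff_premeasure :: "real \<Rightarrow> real \<Rightarrow> 'a::metric_space set \<Rightarrow> ennreal" where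
  "hausdorff_premeasure \<delta> s A =
     (INF U \<in> {U :: nat \<Rightarrow> 'a set. A \<subseteq> (\<Union>i. U i) \<and> (\<forall>i. bounded (U i) \<and> diameter (U i) \<le> \<delta>)}.
        suminf (\<lambda>i. hausdorff_gauge s (U i)))"

definition hausdorff_measure :: "real \<Rightarrow> 'a::metric_space set \<Rightarrow> ennreal" where
  "hausdorff_measure s A = (SUP \<delta> \<in> {0<..}. hausdorff_premeasure \<delta> s A)"

definition hausdorff_dim :: "'a::metric_space set \<Rightarrow> ereal" where
  "hausdorff_dim A = (INF s \<in> {s. 0 \<le> s \<and> hausdorff_measure s A = 0}. ereal s)"

section \<open>Cellular self-similar structures\<close>

text \<open>Faces and cells are non-empty, whereas the empty set is a face in the sense of
  \<^term>\<open>(face_of)\<close>. Non-empty polytopes in the plane are exactly points, closed segments and closed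
  convex polygons.\<close>

definition convex_cell_complex :: "plane set set \<Rightarrow> bool" where
  "convex_cell_complex X \<longleftrightarrow>
     finite X \<and>
     (\<forall>c\<in>X. polytope c \<and> c \<noteq> {}) \<and>
     (\<forall>c\<in>X. \<forall>d. d face_of c \<and> d \<noteq> {} \<longrightarrow> d \<in> X) \<and>
     (\<forall>c\<in>X. \<forall>d\<in>X. c \<inter> d \<noteq> {} \<longrightarrow> (c \<inter> d) face_of c \<and> (c \<inter> d) face_of d)"

definition two_dimensional :: "plane set set \<Rightarrow> bool" where
  "two_dimensional X \<longleftrightarrow> (\<exists>c\<in>X. aff_dim c = 2)"

definition skeleton :: "plane set set \<Rightarrow> nat \<Rightarrow> plane set" where
  "skeleton X k = \<Union>{c \<in> X. aff_dim c \<le> int k}"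

text \<open>A self-map of \<open>A\<close> is represented by a function on the whole plane, of which only the
  values on \<open>A\<close> matter.\<close>

definition similitude_on :: "plane set \<Rightarrow> (plane \<Rightarrow> plane) \<Rightarrow> bool" where
  "similitude_on A F \<longleftrightarrow>
     F ` A \<subseteq> A \<and> (\<exists>r. 0 < r \<and> r \<le> 1 \<and> (\<forall>x\<in>A. \<forall>y\<in>A. dist (F x) (F y) = r * dist x y))"

definition cellular_self_similar_structure ::
  "plane set set \<Rightarrow> 'i set \<Rightarrow> ('i \<Rightarrow> plane \<Rightarrow> plane) \<Rightarrow> bool" where
  "cellular_self_similar_structure X S F \<longleftrightarrow>
     convex_cell_complex X \<and> two_dimensional X \<and> finite S \<and>
     (\<forall>j\<in>S. similitude_on (\<Union>X) (F j)) \<and>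
     frontier (\<Union>X) \<subseteq> frontier (\<Union>j\<in>S. F j ` \<Union>X) \<and>
     (\<forall>i\<in>S. \<forall>j\<in>S. i \<noteq> j \<longrightarrow> interior (F i ` \<Union>X) \<inter> interior (F j ` \<Union>X) = {})"

definition cellular_self_similar_set ::
  "plane set set \<Rightarrow> 'i set \<Rightarrow> ('i \<Rightarrow> plane \<Rightarrow> plane) \<Rightarrow> plane set \<Rightarrow> bool" where
  "cellular_self_similar_set X S F K \<longleftrightarrow>
     compact K \<and> K \<noteq> {} \<and> K \<subseteq> \<Union>X \<and> K = (\<Union>j\<in>S. F j ` K)"

section \<open>The complexes \<open>X\<^sub>n\<close> and their simplicial subdivisions\<close>

definition words :: "'i set \<Rightarrow> nat \<Rightarrow> 'i list set" where
  "words S n = {w. length w = n \<and> set w \<subseteq> S}"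

definition word_map :: "('i \<Rightarrow> plane \<Rightarrow> plane) \<Rightarrow> 'i list \<Rightarrow> plane \<Rightarrow> plane" where
  "word_map F w = foldr (\<lambda>j G. F j \<circ> G) w id"

definition level_space ::
  "plane set set \<Rightarrow> 'i set \<Rightarrow> ('i \<Rightarrow> plane \<Rightarrow> plane) \<Rightarrow> nat \<Rightarrow> plane set" where
  "level_space X S F n = (\<Union>w\<in>words S n. word_map F w ` \<Union>X)"

definition level_skeleton ::
  "plane set set \<Rightarrow> 'i set \<Rightarrow> ('i \<Rightarrow> plane \<Rightarrow> plane) \<Rightarrow> nat \<Rightarrow> nat \<Rightarrow> plane set" where
  "level_skeleton X S F n k = (\<Union>w\<in>words S n. word_map F w ` skeleton X k)"

definition level_cells ::
  "plane set set \<Rightarrow> 'i set \<Rightarrow> ('i \<Rightarrow> plane \<Rightarrow> plane) \<Rightarrow> nat \<Rightarrow> nat \<Rightarrow> plane set set" where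
  "level_cells X S F n k =
     closure ` components (level_skeleton X S F n k -
       (if k = 0 then {} else level_skeleton X S F n (k - 1)))"

definition vertices :: "plane set set \<Rightarrow> plane set" where
  "vertices T = {v. {v} \<in> T}"

definition simplicial_subdivision ::
  "plane set set \<Rightarrow> 'i set \<Rightarrow> ('i \<Rightarrow> plane \<Rightarrow> plane) \<Rightarrow> nat \<Rightarrow> plane set set \<Rightarrow> bool" where
  "simplicial_subdivision X S F n T \<longleftrightarrow>
     simplicial_complex T \<and>
     \<Union>T = level_space X S F n \<and>
     (\<forall>\<sigma>\<in>T. \<exists>k\<le>2. \<exists>c\<in>level_cells X S F n k. \<sigma> \<subseteq> c) \<and>
     (\<forall>k\<le>2. \<forall>c\<in>level_cells X S F n k. c = \<Union>{\<sigma> \<in> T. \<sigma> \<subseteq> c}) \<and>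
     vertices T = level_skeleton X S F n 0"

section \<open>Ordered and oriented simplicial chains\<close>

type_synonym chain = "plane list \<Rightarrow>\<^sub>0 complex"

definition ordered_simplices :: "plane set set \<Rightarrow> nat \<Rightarrow> plane list set" where
  "ordered_simplices T p =
     {x. length x = p + 1 \<and> set x \<subseteq> vertices T \<and> (\<exists>\<sigma>\<in>T. set x \<subseteq> \<sigma>)}"

definition ordered_chains :: "plane set set \<Rightarrow> nat \<Rightarrow> chain set" where
  "ordered_chains T p = {c. Poly_Mapping.keys c \<subseteq> ordered_simplices T p}"

definition ordered_boundary :: "chain \<Rightarrow> chain" where
  "ordered_boundary c =
     (\<Sum>x \<in> Poly_Mapping.keys c. \<Sum>j<length x.
        Poly_Mapping.single (take j x @ drop (Suc j) x) ((- 1) ^ j * Poly_Mapping.lookup c x))"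

text \<open>The kernel of the projection from ordered to oriented chains: the subspace generated by the
  degenerate tuples and by all \<open>x \<circ> \<tau> - sign \<tau> \<cdot> x\<close>.\<close>

inductive_set orientation_relations :: "plane set set \<Rightarrow> nat \<Rightarrow> chain set"
  for T :: "plane set set" and p :: nat where
  zero: "0 \<in> orientation_relations T p"
| degenerate: "\<lbrakk>r \<in> orientation_relations T p; x \<in> ordered_simplices T p; \<not> distinct x\<rbrakk>
    \<Longrightarrow> r + Poly_Mapping.single x a \<in> orientation_relations T p"
| permuted: "\<lbrakk>r \<in> orientation_relations T p; x \<in> ordered_simplices T p; \<tau> permutes {..<length x}\<rbrakk>
    \<Longrightarrow> r + (Poly_Mapping.single (permute_list \<tau> x) a
            - Poly_Mapping.single x (of_int (sign \<tau>) * a)) \<in> orientation_relations T p"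

text \<open>The quotient map; oriented chains are cosets of \<^const>\<open>orientation_relations\<close>.\<close>

definition oriented_class :: "plane set set \<Rightarrow> nat \<Rightarrow> chain \<Rightarrow> chain set" where
  "oriented_class T p c = {d \<in> ordered_chains T p. d - c \<in> orientation_relations T p}"

definition counterclockwise :: "plane \<Rightarrow> plane \<Rightarrow> plane \<Rightarrow> bool" where
  "counterclockwise a b c \<longleftrightarrow>
     (b $ 1 - a $ 1) * (c $ 2 - a $ 2) - (b $ 2 - a $ 2) * (c $ 1 - a $ 1) > 0"

text \<open>The three counterclockwise orderings of a triangle differ by even permutations, so the choice
  made here does not affect \<open>fundamental_chain\<close>.\<close>

definition ccw_ordering :: "plane set \<Rightarrow> plane list" where
  "ccw_ordering \<sigma> =
     (SOME x. \<exists>a b c. x = [a, b, c] \<and> \<sigma> = convex hull {a, b, c} \<and> counterclockwise a b c)"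

definition fundamental_chain :: "plane set set \<Rightarrow> chain set" where
  "fundamental_chain T =
     oriented_class T 2 (\<Sum>\<sigma> \<in> {\<sigma> \<in> T. 2 simplex \<sigma>}. Poly_Mapping.single (ccw_ordering \<sigma>) 1)"

text \<open>The admissible choices of \<open>s\<^sub>n\<close>; \<open>A\<close> is the underlying space of \<open>T\<close>.\<close>

definition admissible_lift :: "plane set set \<Rightarrow> plane set \<Rightarrow> chain \<Rightarrow> bool" where
  "admissible_lift T A s \<longleftrightarrow>
     s \<in> ordered_chains T 2 \<and>
     oriented_class T 2 s = fundamental_chain T \<and>
     (\<forall>x \<in> Poly_Mapping.keys s. distinct x) \<and>
     (\<forall>y \<in> Poly_Mapping.keys (ordered_boundary s). convex hull (set y) \<subseteq> frontier A)"

section \<open>Hoelder functions and the cyclic quasi-1-cocycle\<close>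

definition holder_functions :: "real \<Rightarrow> plane set \<Rightarrow> (plane \<Rightarrow> complex) set" where
  "holder_functions \<alpha> K =
     {f. \<exists>C. \<forall>x\<in>K. \<forall>y\<in>K. norm (f x - f y) \<le> C * dist x y powr \<alpha>}"

text \<open>In the next two definitions \<open>s\<close> is the chosen 2-chain, so that \<open>b = ordered_boundary s\<close>.\<close>

definition outer_chain :: "plane set set \<Rightarrow> chain \<Rightarrow> chain" where
  "outer_chain X s = (let b = ordered_boundary s in
     (\<Sum>y \<in> {y \<in> Poly_Mapping.keys b. convex hull (set y) \<subseteq> frontier (\<Union>X)}.
        Poly_Mapping.single y (Poly_Mapping.lookup b y)))"

definition inner_chain :: "plane set set \<Rightarrow> chain \<Rightarrow> chain" where
  "inner_chain X s = ordered_boundary s - outer_chain X s"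

definition cup_form :: "(plane \<Rightarrow> complex) \<Rightarrow> (plane \<Rightarrow> complex) \<Rightarrow> chain \<Rightarrow> complex" where
  "cup_form f g c =
     (\<Sum>y \<in> Poly_Mapping.keys c. Poly_Mapping.lookup c y *
        (f (y ! 0) * (g (y ! 1) - g (y ! 0)) - g (y ! 0) * (f (y ! 1) - f (y ! 0))))"

definition cyclic_quasi_cocycle ::
  "plane set set \<Rightarrow> (nat \<Rightarrow> chain) \<Rightarrow> (plane \<Rightarrow> complex) \<Rightarrow> (plane \<Rightarrow> complex) \<Rightarrow> nat \<Rightarrow> complex" where
  "cyclic_quasi_cocycle X s f g n = cup_form f g (inner_chain X (s n))"

end

theory Submission
  imports Defs
begin

text \<open>The summand of \<open>cup_form\<close> is \<open>\<omega>(x,y) = f(x) g(y) - g(x) f(y)\<close>, which is antisymmetric, so that only the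
oriented boundary of \<open>X\<^sub>n\<close> matters and \<open>\<phi>\<^sub>n = \<omega>(b\<^sub>n) - \<omega>(o\<^sub>n)\<close>. Let \<open>r\<^sub>j\<close> be the ratio of \<open>F\<^sub>j\<close>. Moran's lower bound for
the dimension gives \<open>\<Sum>\<^sub>j r\<^sub>j\<^sup>2\<^sup>\<alpha> < 1\<close>, and \<open>2\<alpha> > 1\<close> because \<open>K\<close> contains the frontier of \<open>|X|\<close>.

Up to subdivision of edges, \<open>b\<^sub>n\<close> is the sum over the words \<open>w\<close> of length \<open>n\<close> of the oriented boundaries of
the pieces \<open>F\<^sub>w(|X|)\<close>. Since \<open>2\<alpha> > 1\<close>, the sewing estimate makes the effect of subdividing an edge of such a piece
\<open>O(r\<^sub>w\<^sup>2\<^sup>\<alpha>)\<close>, and \<open>\<omega>\<close> is \<open>O(r\<^sub>w\<^sup>2\<^sup>\<alpha>)\<close> on the boundary of a piece, which is a cycle. Hence \<open>\<omega>(b\<^sub>n)\<close> is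
\<open>O((\<Sum>\<^sub>j r\<^sub>j\<^sup>2\<^sup>\<alpha>)\<^sup>n)\<close> and tends to 0. The chains \<open>o\<^sub>n\<close> are, up to boundedly many edges, subdivisions of the fixed
boundary of \<open>|X|\<close> with mesh tending to 0, on which the Young sums of \<open>\<omega>\<close> converge.\<close>

section \<open>Triangles and their local structure\<close>

text \<open>The obstacle is that nothing matches. The triangulation of \<open>X\<^sub>n\<close> is
  prescribed only through its vertices, and a corner of one piece \<open>F\<^sub>w(|X|)\<close> may
  lie inside an edge of a neighbouring piece, so \<open>b\<^sub>n\<close> cannot be compared with
  the boundaries of the pieces simplex by simplex. Instead, every edge is cut at all points of a
  finite set V on it. The net coefficient on a small interval between consecutive points is then the
  jump, from its right to its left side, of the sum of the indicator functions of the triangles.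
  Families of triangles covering the points beside the interval equally often therefore have the
  same refined boundary. Used only along the frontier of |X|, the same criterion identifies the
  refined outer boundaries of levels n and 0, because both spaces coincide near a generic point of
  an interval in this frontier. The vertex sets of the levels are not assumed to be nested, so this
  comparison takes place over their union; the boundedly many exceptional edges are those of level n
  that a vertex of level 0 cuts.\<close>

definition orient :: "plane \<Rightarrow> plane \<Rightarrow> plane \<Rightarrow> real" where
  "orient a b c = (b $ 1 - a $ 1) * (c $ 2 - a $ 2) - (b $ 2 - a $ 2) * (c $ 1 - a $ 1)"

lemma counterclockwise_iff: "counterclockwise a b c \<longleftrightarrow> orient a b c > 0"
  by (simp add: counterclockwise_def orient_def)

text \<open>The quarter turn to the left: for small \<open>e > 0\<close> the point
  \<open>m + e *\<^sub>R rot (q - p)\<close> lies to the left of the directed line from p to q, and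
  the point with \<open>- e\<close> to its right.\<close>

definition rot :: "plane \<Rightarrow> plane" where
  "rot v = vector [- v $ 2, v $ 1]"

lemma plane_eq_iff: "(x::plane) = y \<longleftrightarrow> x $ 1 = y $ 1 \<and> x $ 2 = y $ 2"
  by (simp add: vec_eq_iff forall_2)

lemma inner_plane: "(x::plane) \<bullet> y = x $ 1 * y $ 1 + x $ 2 * y $ 2"
  by (simp add: inner_vec_def sum_2)

lemma orient_rotate: "orient b c a = orient a b c"
  by (simp add: orient_def algebra_simps)

lemma orient_self [simp]: "orient a a b = 0" "orient a b a = 0" "orient a b b = 0"
  by (simp_all add: orient_def)

lemma orient_affine:
  "orient a b (x + t *\<^sub>R (y - x)) = (1 - t) * orient a b x + t * orient a b y"
  by (simp add: orient_def algebra_simps)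

lemma orient_sum: "orient a b z + orient b c z + orient c a z = orient a b c"
  by (simp add: orient_def algebra_simps)

text \<open>The inner product is the rate at which the signed area over uv grows when pq is crossed
  from right to left. This is why direction is tested by the sign of an inner product
  throughout.\<close>

lemma orient_normal: "orient u v (m + e *\<^sub>R rot (q - p)) = orient u v m + e * ((v - u) \<bullet> (q - p))"
  by (simp add: orient_def rot_def inner_plane vector_2 algebra_simps)

lemma continuous_orient [continuous_intros]: "continuous_on S (orient a b)"
  unfolding orient_def by (intro continuous_intros)

lemma orient_zero_param:
  assumes "a \<noteq> b" "orient a b p = 0"
  obtains t where "p = a + t *\<^sub>R (b - a)"
proof -
  define N where "N = (b - a) \<bullet> (b - a)"
  have N: "N > 0" using assms(1) by (simp add: N_def)
  define t where "t = ((p - a) \<bullet> (b - a)) / N"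
  \<comment> \<open>Expansion of \<open>p - a\<close> in the orthogonal basis \<open>b - a\<close>,
    \<open>rot (b - a)\<close>: the second coefficient is \<open>orient a b p\<close>.\<close>
  have *: "N * (p $ 1 - a $ 1) = ((p - a) \<bullet> (b - a)) * (b $ 1 - a $ 1) - orient a b p * (b $ 2 - a $ 2)"
       "N * (p $ 2 - a $ 2) = ((p - a) \<bullet> (b - a)) * (b $ 2 - a $ 2) + orient a b p * (b $ 1 - a $ 1)"
    by (simp_all add: N_def inner_plane orient_def algebra_simps)
  have Nt: "N * t = (p - a) \<bullet> (b - a)" using N by (simp add: t_def)
  have "N * (p $ 1 - a $ 1) = N * (t * (b $ 1 - a $ 1))" "N * (p $ 2 - a $ 2) = N * (t * (b $ 2 - a $ 2))"
    unfolding * mult.assoc[symmetric] Nt assms(2) by simp_all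
  then have "p = a + t *\<^sub>R (b - a)"
    using N by (simp add: plane_eq_iff)
  then show thesis ..
qed

text \<open>Cramer's rule: divided by \<open>orient a b c\<close>, the areas on the right become the
  barycentric coordinates of z.\<close>

lemma barycentric_orient:
  "orient a b c *\<^sub>R z = orient b c z *\<^sub>R a + orient c a z *\<^sub>R b + orient a b z *\<^sub>R c"
  by (simp add: plane_eq_iff orient_def algebra_simps)

lemma triangle_eq_orient:
  assumes "orient a b c > 0"
  shows "convex hull {a, b, c} = {z. orient a b z \<ge> 0 \<and> orient b c z \<ge> 0 \<and> orient c a z \<ge> 0}"
proof (intro set_eqI iffI)
  fix z assume "z \<in> convex hull {a, b, c}"
  then obtain u v w where z: "0 \<le> u" "0 \<le> v" "0 \<le> w" "u + v + w = 1" "z = u *\<^sub>R a + v *\<^sub>R b + w *\<^sub>R c"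
    unfolding convex_hull_3 by auto
  have u: "u = 1 - v - w" using z(4) by simp
  have "orient a b z = w * orient a b c" "orient b c z = u * orient a b c" "orient c a z = v * orient a b c"
    unfolding z(5) u by (simp_all add: orient_def algebra_simps)
  then show "z \<in> {z. orient a b z \<ge> 0 \<and> orient b c z \<ge> 0 \<and> orient c a z \<ge> 0}"
    using z assms by simp
next
  fix z assume z: "z \<in> {z. orient a b z \<ge> 0 \<and> orient b c z \<ge> 0 \<and> orient c a z \<ge> 0}"
  let ?d = "orient a b c"
  have "z = inverse ?d *\<^sub>R (?d *\<^sub>R z)" using assms by simp
  also have "\<dots> = (orient b c z / ?d) *\<^sub>R a + (orient c a z / ?d) *\<^sub>R b + (orient a b z / ?d) *\<^sub>R c"
    by (simp only: barycentric_orient[of a b c z] scaleR_add_right scaleR_scaleR divide_inverse mult.commute)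
  finally have "z = (orient b c z / ?d) *\<^sub>R a + (orient c a z / ?d) *\<^sub>R b + (orient a b z / ?d) *\<^sub>R c" .
  moreover have "orient b c z / ?d + orient c a z / ?d + orient a b z / ?d = 1"
    unfolding add_divide_distrib[symmetric] using assms orient_sum[of a b z c] by simp
  ultimately show "z \<in> convex hull {a, b, c}"
    unfolding convex_hull_3 mem_Collect_eq using z assms
    by (intro exI[of _ "orient b c z / ?d"] exI[of _ "orient c a z / ?d"] exI[of _ "orient a b z / ?d"])
      (simp only: mem_Collect_eq divide_nonneg_pos simp_thms)
qed

lemma triangle_interior:
  assumes "orient a b c > 0" "z \<in> convex hull {a, b, c}"
    "orient a b z \<noteq> 0" "orient b c z \<noteq> 0" "orient c a z \<noteq> 0"
  shows "z \<in> interior (convex hull {a, b, c})"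
proof -
  let ?U = "{z. orient a b z > 0 \<and> orient b c z > 0 \<and> orient c a z > 0}"
  have "open ?U"
    by (intro open_Collect_conj open_Collect_less continuous_intros)
  moreover have "?U \<subseteq> convex hull {a, b, c}" "z \<in> ?U"
    using assms by (auto simp: triangle_eq_orient)
  ultimately show ?thesis by (meson interiorI)
qed

lemma orient_closed_segment: "m \<in> closed_segment u v \<Longrightarrow> orient u v m = 0"
proof -
  assume "m \<in> closed_segment u v"
  then obtain t where m: "m = (1 - t) *\<^sub>R u + t *\<^sub>R v" by (auto simp: in_segment)
  show ?thesis unfolding m orient_def by (simp add: algebra_simps)
qed

lemma orient_open_segment: "m \<in> open_segment u v \<Longrightarrow> orient u v m = 0"
  using orient_closed_segment open_closed_segment by blast

lemma open_segment_param:
  fixes p q :: plane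
  assumes "p \<noteq> q" "0 < t" "t < 1"
  shows "p + t *\<^sub>R (q - p) \<in> open_segment p q"
proof -
  have "p + t *\<^sub>R (q - p) = (1 - t) *\<^sub>R p + t *\<^sub>R q" by (simp add: algebra_simps)
  then show ?thesis unfolding in_segment using assms by blast
qed

definition edge_ind :: "plane \<Rightarrow> plane \<Rightarrow> plane \<Rightarrow> plane \<Rightarrow> plane \<Rightarrow> real" where
  "edge_ind p q m u v = of_bool (m \<in> open_segment u v \<and> (v - u) \<bullet> (q - p) > 0)"

text \<open>Counts how often the cycle a, b, c, a passes through m in the direction from p to q,
  passages in the opposite direction counted negatively.\<close>

definition edge_sign :: "plane \<Rightarrow> plane \<Rightarrow> plane \<Rightarrow> plane \<Rightarrow> plane \<Rightarrow> plane \<Rightarrow> real" where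
  "edge_sign p q m a b c =
     (edge_ind p q m a b - edge_ind p q m b a) + (edge_ind p q m b c - edge_ind p q m c b)
     + (edge_ind p q m c a - edge_ind p q m a c)"

lemma edge_sign_rotate: "edge_sign p q m b c a = edge_sign p q m a b c"
  by (simp add: edge_sign_def)

lemma edge_ind_0: "orient u v m \<noteq> 0 \<Longrightarrow> edge_ind p q m u v = 0" "orient u v m \<noteq> 0 \<Longrightarrow> edge_ind p q m v u = 0"
  using orient_open_segment[of m u v] by (auto simp: edge_ind_def open_segment_commute)

text \<open>The germ of A at m is empty, full, or one of the two closed half discs bounded by the
  line pq. The number k is the jump of the indicator of A when this line is crossed from right to
  left.\<close>

definition local_type :: "plane set \<Rightarrow> plane \<Rightarrow> plane \<Rightarrow> plane \<Rightarrow> real \<Rightarrow> real \<Rightarrow> bool" where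
  "local_type A p q m \<rho> k \<longleftrightarrow>
     (A \<inter> ball m \<rho> = {} \<and> k = 0) \<or> (ball m \<rho> \<subseteq> A \<and> k = 0)
     \<or> (A \<inter> ball m \<rho> = {z \<in> ball m \<rho>. orient p q z \<ge> 0} \<and> k = 1)
     \<or> (A \<inter> ball m \<rho> = {z \<in> ball m \<rho>. orient p q z \<le> 0} \<and> k = -1)"

text \<open>Here m lies on the line ab. Were it also on a second side line, p and q would be two
  distinct points common to both lines, which meet in one point only. So the other two inequalities
  hold strictly near m, and the triangle is a half disc there.\<close>

lemma triangle_local_side:
  assumes abc: "orient a b c > 0" and pq: "p \<noteq> q"
    and m: "m \<in> convex hull {a, b, c}" and ab: "orient a b m = 0" "orient a b p = 0" "orient a b q = 0"
    and bc: "orient b c m = 0 \<Longrightarrow> orient b c p = 0 \<and> orient b c q = 0"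
    and ca: "orient c a m = 0 \<Longrightarrow> orient c a p = 0 \<and> orient c a q = 0"
  shows "\<exists>\<rho>>0. local_type (convex hull {a, b, c}) p q m \<rho> (edge_sign p q m a b c)"
proof -
  have "a \<noteq> b" using abc by auto
  then obtain s t \<tau> where s: "p = a + s *\<^sub>R (b - a)" and t: "q = a + t *\<^sub>R (b - a)" and \<tau>: "m = a + \<tau> *\<^sub>R (b - a)"
    using ab orient_zero_param by metis
  have st: "s \<noteq> t" using pq s t by auto
  have o1: "orient b c (a + x *\<^sub>R (b - a)) = (1 - x) * orient a b c"
    "orient c a (a + x *\<^sub>R (b - a)) = x * orient a b c" for x
    by (simp_all add: orient_def algebra_simps)
  have nbc: "orient b c m \<noteq> 0" using bc st abc unfolding s t o1 by auto
  have nca: "orient c a m \<noteq> 0" using ca st abc unfolding s t o1 by auto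
  have pos: "orient b c m > 0" "orient c a m > 0"
    using m nbc nca by (auto simp: triangle_eq_orient[OF abc])
  then have \<tau>01: "0 < \<tau>" "\<tau> < 1" using abc by (auto simp: \<tau> o1 zero_less_mult_iff)
  then have mo: "m \<in> open_segment a b"
    using open_segment_param[OF \<open>a \<noteq> b\<close>] unfolding \<tau> by blast
  let ?U = "{z. orient b c z > 0 \<and> orient c a z > 0}"
  have "open ?U" by (intro open_Collect_conj open_Collect_less continuous_intros)
  then obtain \<rho> where \<rho>: "\<rho> > 0" "ball m \<rho> \<subseteq> ?U" using pos open_contains_ball by blast
  have loc: "convex hull {a, b, c} \<inter> ball m \<rho> = {z \<in> ball m \<rho>. orient a b z \<ge> 0}"
    using \<rho> by (force simp: triangle_eq_orient[OF abc])
  have opq: "orient p q z = (t - s) * orient a b z" for z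
    unfolding s t by (simp add: orient_def algebra_simps)
  define N where "N = (b - a) \<bullet> (b - a)"
  have ip: "(b - a) \<bullet> (q - p) = (t - s) * N" "(a - b) \<bullet> (q - p) = (s - t) * N"
    unfolding s t N_def by (simp_all add: inner_plane algebra_simps)
  have N: "N > 0" using \<open>a \<noteq> b\<close> by (simp add: N_def)
  have z0: "edge_ind p q m b c = 0" "edge_ind p q m c b = 0" "edge_ind p q m c a = 0" "edge_ind p q m a c = 0"
    using edge_ind_0 nbc nca by blast+
  show ?thesis
  proof (cases "t > s")
    case True
    have "edge_sign p q m a b c = 1"
      using True N mo by (simp add: edge_sign_def z0, simp add: edge_ind_def ip open_segment_commute zero_less_mult_iff)
    moreover have "(orient p q z \<ge> 0) = (orient a b z \<ge> 0)" for z using True by (simp add: opq zero_le_mult_iff)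
    ultimately show ?thesis using loc \<rho> by (auto simp: local_type_def)
  next
    case False
    then have False: "s > t" using st by simp
    have "edge_sign p q m a b c = -1"
      using False N mo by (simp add: edge_sign_def z0, simp add: edge_ind_def ip open_segment_commute zero_less_mult_iff)
    moreover have "(orient p q z \<le> 0) = (orient a b z \<ge> 0)" for z using False by (auto simp add: opq mult_le_0_iff)
    ultimately show ?thesis using loc \<rho> by (auto simp: local_type_def)
  qed
qed

text \<open>The assumption on m rules out corners and sides transversal to pq. What remains is a
  point outside, a point inside, or a point within a side parallel to pq; in the last case the
  triangle lies to the left of its counterclockwise side, which gives the sign.\<close>

lemma triangle_local:
  assumes abc: "orient a b c > 0" and pq: "p \<noteq> q"
    and gen: "\<And>u v. \<lbrakk>m \<in> convex hull {a, b, c}; u \<in> {a, b, c}; v \<in> {a, b, c}; u \<noteq> v; orient u v m = 0\<rbrakk>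
                \<Longrightarrow> orient u v p = 0 \<and> orient u v q = 0"
  shows "\<exists>\<rho>>0. local_type (convex hull {a, b, c}) p q m \<rho> (edge_sign p q m a b c)"
proof (cases "m \<in> convex hull {a, b, c}")
  case False
  have "open (- (convex hull {a, b, c}))"
    by (intro open_Compl compact_imp_closed finite_imp_compact_convex_hull) auto
  then obtain \<rho> where "\<rho> > 0" "ball m \<rho> \<subseteq> - (convex hull {a, b, c})"
    using False open_contains_ball by blast
  moreover have "edge_ind p q m u v = 0" if "u \<in> {a, b, c}" "v \<in> {a, b, c}" for u v
  proof -
    have "m \<notin> open_segment u v" using that False
      by (meson closed_segment_subset convex_convex_hull hull_inc open_closed_segment subsetD)
    then show ?thesis by (simp add: edge_ind_def)
  qed
  ultimately show ?thesis by (auto simp: local_type_def edge_sign_def)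
next
  case True
  have ne: "a \<noteq> b" "b \<noteq> c" "c \<noteq> a" using abc by auto
  have g: "orient a b m = 0 \<Longrightarrow> orient a b p = 0 \<and> orient a b q = 0"
    "orient b c m = 0 \<Longrightarrow> orient b c p = 0 \<and> orient b c q = 0"
    "orient c a m = 0 \<Longrightarrow> orient c a p = 0 \<and> orient c a q = 0"
    using gen[OF True] ne by auto
  have rot: "orient b c a > 0" "orient c a b > 0" "{b, c, a} = {a, b, c}" "{c, a, b} = {a, b, c}"
    using abc orient_rotate by auto
  show ?thesis
  proof (cases "orient a b m = 0 \<or> orient b c m = 0 \<or> orient c a m = 0")
    case True2: True
    then show ?thesis
    proof (elim disjE)
      assume "orient a b m = 0" then show ?thesis using triangle_local_side[OF abc pq True] g by blast
    next
      assume "orient b c m = 0" then show ?thesis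
        using triangle_local_side[OF rot(1) pq, of m] g True rot edge_sign_rotate by metis
    next
      assume "orient c a m = 0" then show ?thesis
        using triangle_local_side[OF rot(2) pq, of m] g True rot edge_sign_rotate by metis
    qed
  next
    case False
    then have "m \<in> interior (convex hull {a, b, c})" using triangle_interior[OF abc True] by blast
    then obtain \<rho> where "\<rho> > 0" "ball m \<rho> \<subseteq> convex hull {a, b, c}" using mem_interior by blast
    moreover have "edge_sign p q m a b c = 0"
      using False edge_ind_0 by (simp add: edge_sign_def)
    ultimately show ?thesis by (auto simp: local_type_def)
  qed
qed

lemma local_type_jump:
  assumes "\<rho> > 0" "local_type A p q m \<rho> k" "p \<noteq> q" "orient p q m = 0"
  shows "\<forall>\<^sub>F e in at_right 0. indicator A (m + e *\<^sub>R rot (q - p)) - indicator A (m + (- e) *\<^sub>R rot (q - p)) = k"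
proof -
  define n where "n = rot (q - p)"
  have N: "(q - p) \<bullet> (q - p) > 0" using assms by simp
  have "\<forall>\<^sub>F e in at_right 0. e * norm n < \<rho>"
  proof -
    have "((\<lambda>e. e * norm n) \<longlongrightarrow> 0 * norm n) (at_right 0)" by (intro tendsto_intros)
    then show ?thesis using assms(1) by (intro order_tendstoD) auto
  qed
  moreover have "\<forall>\<^sub>F e in at_right (0::real). e > 0" by (simp add: eventually_at_right_less)
  ultimately show ?thesis
  proof eventually_elim
    case (elim e)
    then have b: "m + e *\<^sub>R n \<in> ball m \<rho>" "m + (- e) *\<^sub>R n \<in> ball m \<rho>" by (auto simp: dist_norm)
    have o: "orient p q (m + e *\<^sub>R n) > 0" "orient p q (m + (- e) *\<^sub>R n) < 0"
      using elim N assms(4) unfolding n_def orient_normal by (auto simp: mult_neg_pos)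
    have *: "z \<in> A \<longleftrightarrow> z \<in> C" if "A \<inter> B = C" "z \<in> B" for z :: plane and B C
      using that by blast
    from assms(2) have "indicator A (m + e *\<^sub>R n) - indicator A (m + (- e) *\<^sub>R n) = k"
      unfolding local_type_def
    proof (elim disjE conjE)
      assume "A \<inter> ball m \<rho> = {}" "k = 0"
      then show ?thesis using *[OF _ b(1)] *[OF _ b(2)] by simp
    next
      assume "ball m \<rho> \<subseteq> A" "k = 0"
      then have "m + e *\<^sub>R n \<in> A" "m + (- e) *\<^sub>R n \<in> A" using b by blast+
      then show ?thesis using \<open>k = 0\<close> by simp
    next
      assume A: "A \<inter> ball m \<rho> = {z \<in> ball m \<rho>. orient p q z \<ge> 0}" and k: "k = 1"
      have "m + e *\<^sub>R n \<in> A" "m + (- e) *\<^sub>R n \<notin> A" using *[OF A b(1)] *[OF A b(2)] b o by force+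
      then show ?thesis using k by simp
    next
      assume A: "A \<inter> ball m \<rho> = {z \<in> ball m \<rho>. orient p q z \<le> 0}" and k: "k = -1"
      have "m + e *\<^sub>R n \<notin> A" "m + (- e) *\<^sub>R n \<in> A" using *[OF A b(1)] *[OF A b(2)] b o by force+
      then show ?thesis using k by simp
    qed
    then show ?case by (simp only: n_def)
  qed
qed

text \<open>A line through two points of V may pass through m only if it contains all of pq. This
  makes a single point m representative of the whole interval.\<close>

definition generic_on :: "plane set \<Rightarrow> plane \<Rightarrow> plane \<Rightarrow> plane \<Rightarrow> bool" where
  "generic_on V p q m \<longleftrightarrow> m \<in> open_segment p q \<and>
     (\<forall>u\<in>V. \<forall>v\<in>V. u \<noteq> v \<longrightarrow> orient u v m = 0 \<longrightarrow> orient u v p = 0 \<and> orient u v q = 0)"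

text \<open>A line that does not contain pq meets it in at most one point, and V spans finitely many
  lines, so only finitely many parameters are bad.\<close>

lemma generic_on_exists:
  assumes "finite V" "p \<noteq> q"
  shows "\<exists>m. generic_on V p q m"
proof -
  define B where "B = (\<Union>u\<in>V. \<Union>v\<in>V. {t. \<not> (orient u v p = 0 \<and> orient u v q = 0) \<and> (1 - t) * orient u v p + t * orient u v q = 0})"
  have "finite {t::real. \<not> (x = 0 \<and> y = 0) \<and> (1 - t) * x + t * y = 0}" for x y :: real
  proof -
    have "t = x / (x - y)" if "\<not> (x = 0 \<and> y = 0)" "(1 - t) * x + t * y = 0" for t
    proof -
      have "t * (x - y) = x" using that(2) by (simp add: algebra_simps)
      moreover have "x \<noteq> y" using that calculation by auto
      ultimately show ?thesis by (simp add: eq_divide_eq)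
    qed
    then have "{t. \<not> (x = 0 \<and> y = 0) \<and> (1 - t) * x + t * y = 0} \<subseteq> {x / (x - y)}" by blast
    then show ?thesis using finite_subset by blast
  qed
  then have "finite B" unfolding B_def using assms(1) by blast
  moreover have "infinite {0<..<1::real}" by simp
  ultimately obtain t where t: "t \<in> {0<..<1}" "t \<notin> B" by (meson finite_subset subsetI)
  have "generic_on V p q (p + t *\<^sub>R (q - p))"
    unfolding generic_on_def using t open_segment_param[OF assms(2), of t]
    by (auto simp: orient_affine B_def)
  then show ?thesis ..
qed

text \<open>The lines through m are parallel to pq and are left at once in the normal direction; the
  others stay away from m by continuity.\<close>

lemma generic_on_off_lines:
  assumes "finite V" "generic_on V p q m" "p \<noteq> q"
  shows "\<forall>\<^sub>F e in at_right 0. \<forall>u\<in>V. \<forall>v\<in>V. u \<noteq> v \<longrightarrow>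
     orient u v (m + e *\<^sub>R rot (q - p)) \<noteq> 0 \<and> orient u v (m + (- e) *\<^sub>R rot (q - p)) \<noteq> 0"
proof -
  have "\<forall>\<^sub>F e in at_right 0. u \<noteq> v \<longrightarrow> orient u v (m + e *\<^sub>R rot (q - p)) \<noteq> 0 \<and> orient u v (m + (- e) *\<^sub>R rot (q - p)) \<noteq> 0"
    if uv: "u \<in> V" "v \<in> V" for u v
  proof (cases "u = v")
    case False
    define x c where "x = orient u v m" and "c = (v - u) \<bullet> (q - p)"
    show ?thesis
    proof (cases "x = 0")
      case True
      then have "orient u v p = 0" "orient u v q = 0" using assms(2) uv False by (auto simp: generic_on_def x_def)
      then obtain s t where st: "p = u + s *\<^sub>R (v - u)" "q = u + t *\<^sub>R (v - u)" using False orient_zero_param by metis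
      have "c = (t - s) * ((v - u) \<bullet> (v - u))" unfolding c_def st by (simp add: inner_plane algebra_simps)
      moreover have "s \<noteq> t" using st assms(3) by auto
      ultimately have "c \<noteq> 0" using False by simp
      have "\<forall>\<^sub>F e in at_right (0::real). e > 0" by (simp add: eventually_at_right_less)
      then show ?thesis unfolding orient_normal x_def[symmetric] c_def[symmetric]
        by eventually_elim (use True \<open>c \<noteq> 0\<close> in auto)
    next
      case x: False
      have l: "((\<lambda>e. x + e * c) \<longlongrightarrow> x + 0 * c) (at_right 0)" "((\<lambda>e. x + (-e) * c) \<longlongrightarrow> x + (-0) * c) (at_right 0)"
        by (intro tendsto_intros)+
      have "\<forall>\<^sub>F e in at_right 0. x + e * c \<noteq> 0" "\<forall>\<^sub>F e in at_right 0. x + (-e) * c \<noteq> 0"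
        using l[THEN tendsto_imp_eventually_ne, of 0] x by simp_all
      then show ?thesis unfolding orient_normal x_def[symmetric] c_def[symmetric]
        by eventually_elim blast
    qed
  qed simp
  then show ?thesis
    by (intro eventually_ball_finite[OF assms(1)] ballI) auto
qed

section \<open>Subdivided edges and boundaries of triangles\<close>

text \<open>Both orders of each pair occur, and the pair need not span an edge of any complex: all
  pairs of points of V that see each other are included. Which of them matter is decided by their
  coefficients.\<close>

definition gaps :: "plane set \<Rightarrow> (plane \<times> plane) set" where
  "gaps V = {(p, q). p \<in> V \<and> q \<in> V \<and> p \<noteq> q \<and> open_segment p q \<inter> V = {}}"

text \<open>Evaluation of h on the edge ab after it has been subdivided at V. The inner product
  selects, of the two orders of every gap, the one that agrees with ab. The ends are meant to lie in
  V, since otherwise the outermost parts of the edge are lost.\<close>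

definition refine :: "plane set \<Rightarrow> (plane \<Rightarrow> plane \<Rightarrow> complex) \<Rightarrow> plane \<Rightarrow> plane \<Rightarrow> complex" where
  "refine V h a b = (\<Sum>(p, q) \<in> {(p, q) \<in> gaps V. p \<in> closed_segment a b \<and> q \<in> closed_segment a b
     \<and> (b - a) \<bullet> (q - p) > 0}. h p q)"

definition antisymmetric :: "(plane \<Rightarrow> plane \<Rightarrow> complex) \<Rightarrow> bool" where
  "antisymmetric h \<longleftrightarrow> (\<forall>x y. h y x = - h x y)"

definition bdry :: "(plane \<Rightarrow> plane \<Rightarrow> complex) \<Rightarrow> plane \<times> plane \<times> plane \<Rightarrow> complex" where
  "bdry h = (\<lambda>(a, b, c). h a b + h b c + h c a)"

lemma antisymmetricD: "antisymmetric h \<Longrightarrow> h y x = - h x y"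
  unfolding antisymmetric_def by blast

lemma antisymmetric_self: "antisymmetric h \<Longrightarrow> h x x = 0"
proof -
  assume "antisymmetric h"
  then have "h x x + h x x = 0" using antisymmetricD[of h x x] by (metis add.right_inverse)
  then have "2 * h x x = 0" by (simp only: mult_2)
  then show ?thesis by simp
qed

lemma finite_gaps: "finite V \<Longrightarrow> finite (gaps V)"
  by (rule finite_subset[of _ "V \<times> V"]) (auto simp: gaps_def)

lemma gaps_sym: "(p, q) \<in> gaps V \<Longrightarrow> (q, p) \<in> gaps V"
  by (auto simp: gaps_def open_segment_commute)

lemma affine_param:
  fixes a d :: plane
  shows "(1 - u) *\<^sub>R (a + x *\<^sub>R d) + u *\<^sub>R (a + y *\<^sub>R d) = a + ((1 - u) * x + u * y) *\<^sub>R d"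
  by (simp add: algebra_simps)

lemma closed_segment_param:
  fixes a d :: plane
  assumes "d \<noteq> 0" "x \<le> y"
  shows "a + s *\<^sub>R d \<in> closed_segment (a + x *\<^sub>R d) (a + y *\<^sub>R d) \<longleftrightarrow> x \<le> s \<and> s \<le> y"
proof -
  have "a + s *\<^sub>R d \<in> closed_segment (a + x *\<^sub>R d) (a + y *\<^sub>R d) \<longleftrightarrow> s \<in> closed_segment x y"
    unfolding in_segment affine_param add_left_cancel scaleR_cancel_right real_scaleR_def using assms(1) by blast
  then show ?thesis using assms(2) by (simp add: closed_segment_eq_real_ivl)
qed

lemma open_segment_param_iff:
  fixes a d :: plane
  assumes "d \<noteq> 0" "x < y"
  shows "a + s *\<^sub>R d \<in> open_segment (a + x *\<^sub>R d) (a + y *\<^sub>R d) \<longleftrightarrow> x < s \<and> s < y"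
proof -
  have "a + s *\<^sub>R d \<in> open_segment (a + x *\<^sub>R d) (a + y *\<^sub>R d) \<longleftrightarrow> x \<le> s \<and> s \<le> y \<and> s \<noteq> x \<and> s \<noteq> y"
    using closed_segment_param[of d x y a s] assms by (auto simp: open_segment_def)
  then show ?thesis by auto
qed

lemma closed_segment_obtain:
  fixes a b :: plane
  assumes "p \<in> closed_segment a b"
  obtains t where "p = a + t *\<^sub>R (b - a)" "0 \<le> t" "t \<le> 1"
proof -
  obtain u where "p = (1 - u) *\<^sub>R a + u *\<^sub>R b" "0 \<le> u" "u \<le> 1" using assms by (auto simp: in_segment)
  then have "p = a + u *\<^sub>R (b - a)" by (simp add: algebra_simps)
  then show thesis using that \<open>0 \<le> u\<close> \<open>u \<le> 1\<close> by blast
qed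

lemma segment_param01:
  fixes a b :: plane
  assumes "a \<noteq> b"
  shows "a + s *\<^sub>R (b - a) \<in> closed_segment a b \<longleftrightarrow> 0 \<le> s \<and> s \<le> 1"
    and "a + s *\<^sub>R (b - a) \<in> open_segment a b \<longleftrightarrow> 0 < s \<and> s < 1"
  using closed_segment_param[of "b - a" 0 1 a s] open_segment_param_iff[of "b - a" 0 1 a s] assms by simp_all

text \<open>All points are on one line. The intervals overlap at m, and neither end of uv is
  strictly inside pq, so pq cannot leave uv.\<close>

lemma gap_in_segment:
  fixes p q u v :: plane
  assumes "m \<in> open_segment p q" "m \<in> closed_segment u v" "u \<noteq> v"
    "orient u v p = 0" "orient u v q = 0" "u \<notin> open_segment p q" "v \<notin> open_segment p q"
  shows "p \<in> closed_segment u v \<and> q \<in> closed_segment u v"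
proof -
  have *: "x \<in> closed_segment u v \<and> y \<in> closed_segment u v"
    if x: "x = u + s *\<^sub>R (v - u)" and y: "y = u + t *\<^sub>R (v - u)" and "s < t" and m: "m \<in> open_segment x y"
      and n: "u \<notin> open_segment x y" "v \<notin> open_segment x y" for x y s t
  proof -
    have d: "v - u \<noteq> 0" using assms(3) by simp
    obtain \<tau> where \<tau>: "m = u + \<tau> *\<^sub>R (v - u)" "0 \<le> \<tau>" "\<tau> \<le> 1" using assms(2) closed_segment_obtain by blast
    have "s < \<tau>" "\<tau> < t" using m open_segment_param_iff[OF d \<open>s < t\<close>] unfolding x y \<tau> by auto
    moreover have "\<not> (s < 0 \<and> 0 < t)" using n(1) open_segment_param_iff[OF d \<open>s < t\<close>, of u 0] unfolding x y by simp
    moreover have "\<not> (s < 1 \<and> 1 < t)" using n(2) open_segment_param_iff[OF d \<open>s < t\<close>, of u 1] unfolding x y by simp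
    ultimately have "0 \<le> s" "s \<le> 1" "0 \<le> t" "t \<le> 1" using \<tau> by auto
    then show ?thesis unfolding x y using segment_param01(1)[OF assms(3)] by blast
  qed
  obtain s t where st: "p = u + s *\<^sub>R (v - u)" "q = u + t *\<^sub>R (v - u)"
    using assms(3-5) orient_zero_param by metis
  have "s \<noteq> t" using assms(1) st by auto
  then consider "s < t" | "t < s" by linarith
  then show ?thesis
  proof cases
    case 1 then show ?thesis using *[OF st 1] assms by blast
  next
    case 2 then show ?thesis using *[OF st(2,1) 2] assms by (simp add: open_segment_commute)
  qed
qed

lemma refine_self [simp]: "refine V h a a = 0"
  by (simp add: refine_def)

lemma refine_swap:
  assumes "antisymmetric h"
  shows "refine V h b a = - refine V h a b"
  unfolding refine_def sum_negf[symmetric]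
proof (rule sum.reindex_bij_witness[of _ prod.swap prod.swap])
  fix x assume "x \<in> {(p, q) \<in> gaps V. p \<in> closed_segment b a \<and> q \<in> closed_segment b a \<and> 0 < (a - b) \<bullet> (q - p)}"
  then obtain p q where x: "x = (p, q)" "(p, q) \<in> gaps V" "p \<in> closed_segment b a" "q \<in> closed_segment b a" "0 < (a - b) \<bullet> (q - p)"
    by auto
  then show "prod.swap x \<in> {(p, q) \<in> gaps V. p \<in> closed_segment a b \<and> q \<in> closed_segment a b \<and> 0 < (b - a) \<bullet> (q - p)}"
    using gaps_sym[of p q V] by (simp add: closed_segment_commute inner_diff algebra_simps)
  show "- (case prod.swap x of (p, q) \<Rightarrow> h p q) = (case x of (p, q) \<Rightarrow> h p q)"
    using x antisymmetricD[OF assms, of p q] by simp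
next
  fix x assume "x \<in> {(p, q) \<in> gaps V. p \<in> closed_segment a b \<and> q \<in> closed_segment a b \<and> 0 < (b - a) \<bullet> (q - p)}"
  then obtain p q where x: "x = (p, q)" "(p, q) \<in> gaps V" "p \<in> closed_segment a b" "q \<in> closed_segment a b" "0 < (b - a) \<bullet> (q - p)"
    by auto
  then show "prod.swap x \<in> {(p, q) \<in> gaps V. p \<in> closed_segment b a \<and> q \<in> closed_segment b a \<and> 0 < (a - b) \<bullet> (q - p)}"
    using gaps_sym[of p q V] by (simp add: closed_segment_commute inner_diff algebra_simps)
qed auto

lemma antisymmetric_refine: "antisymmetric h \<Longrightarrow> antisymmetric (refine V h)"
  unfolding antisymmetric_def[of "refine V h"] using refine_swap by blast

lemma refine_gap:
  assumes "(a, b) \<in> gaps V"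
  shows "refine V h a b = h a b"
proof -
  have ab: "a \<noteq> b" "a \<in> V" "b \<in> V" "open_segment a b \<inter> V = {}" using assms by (auto simp: gaps_def)
  have "{(p, q) \<in> gaps V. p \<in> closed_segment a b \<and> q \<in> closed_segment a b \<and> (b - a) \<bullet> (q - p) > 0} = {(a, b)}"
  proof (intro set_eqI iffI; clarify)
    fix p q assume *: "(p, q) \<in> gaps V" "p \<in> closed_segment a b" "q \<in> closed_segment a b" "0 < (b - a) \<bullet> (q - p)"
    then have "p \<in> {a, b}" "q \<in> {a, b}" using ab by (auto simp: gaps_def open_segment_def)
    moreover have "p \<noteq> q" using * by auto
    moreover have "\<not> (p = b \<and> q = a)"
    proof
      assume "p = b \<and> q = a"
      then have "(b - a) \<bullet> (q - p) = - ((b - a) \<bullet> (b - a))" by (simp add: inner_diff)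
      then show False using * inner_ge_zero[of "b - a"] by linarith
    qed
    ultimately show "p = a \<and> q = b" by auto
  qed (use assms ab in auto)
  then show ?thesis by (simp add: refine_def)
qed

lemma refine_add:
  assumes "finite V" "b \<in> V" "b \<in> open_segment a c"
  shows "refine V h a c = refine V h a b + refine V h b c"
proof -
  define A where "A x y = {(p, q) \<in> gaps V. p \<in> closed_segment x y \<and> q \<in> closed_segment x y \<and> (y - x) \<bullet> (q - p) > 0}" for x y
  have ac: "a \<noteq> c" using assms(3) by auto
  define d where "d = c - a"
  have d: "d \<noteq> 0" "0 < d \<bullet> d" using ac by (auto simp: d_def)
  define P where "P t = a + t *\<^sub>R d" for t
  obtain \<beta> where \<beta>: "b = P \<beta>" "0 < \<beta>" "\<beta> < 1"
    using assms(3) open_closed_segment[OF assms(3)] closed_segment_obtain segment_param01(2)[OF ac] unfolding P_def d_def by metis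
  have P01: "a = P 0" "c = P 1" by (simp_all add: P_def d_def)
  have cs: "P s \<in> closed_segment (P x) (P y) \<longleftrightarrow> x \<le> s \<and> s \<le> y" if "x \<le> y" for s x y
    unfolding P_def using closed_segment_param[OF d(1) that] .
  have os: "P s \<in> open_segment (P x) (P y) \<longleftrightarrow> x < s \<and> s < y" if "x < y" for s x y
    unfolding P_def using open_segment_param_iff[OF d(1) that] .
  have ip: "(P y - P x) \<bullet> (P t - P s) > 0 \<longleftrightarrow> s < t" if "x < y" for x y s t
  proof -
    have "(P y - P x) \<bullet> (P t - P s) = (y - x) * (t - s) * (d \<bullet> d)"
      by (simp add: P_def algebra_simps)
    then have "(P y - P x) \<bullet> (P t - P s) = ((y - x) * (d \<bullet> d)) * (t - s)" by (simp only: mult_ac)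
    moreover have "(y - x) * (d \<bullet> d) > 0" using that d(2) by (intro mult_pos_pos) simp_all
    then have "((y - x) * (d \<bullet> d)) * 0 < ((y - x) * (d \<bullet> d)) * (t - s) \<longleftrightarrow> 0 < t - s"
      by (rule mult_less_cancel_left_pos)
    ultimately show ?thesis by simp
  qed
  have ex: "\<exists>s. p = P s" if "p \<in> closed_segment a c" for p
    using that closed_segment_obtain unfolding P_def d_def by metis
  have sub: "closed_segment a b \<subseteq> closed_segment a c" "closed_segment b c \<subseteq> closed_segment a c"
    using open_closed_segment[OF assms(3)] by (simp_all add: subset_closed_segment)
  have "A a c = A a b \<union> A b c"
  proof (intro set_eqI iffI)
    fix x assume x: "x \<in> A a c"
    then obtain p q s t where x': "x = (p, q)" "(p, q) \<in> gaps V" "p = P s" "q = P t"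
      using ex unfolding A_def by blast
    have "0 \<le> s" "t \<le> 1" "s < t" using x cs[of 0 1] ip[of 0 1] unfolding x' A_def P01 by auto
    \<comment> \<open>No gap straddles b, because b belongs to V.\<close>
    moreover have "\<not> (s < \<beta> \<and> \<beta> < t)"
      using x' assms(2) os[OF \<open>s < t\<close>, of \<beta>] unfolding gaps_def \<beta>(1) by blast
    ultimately show "x \<in> A a b \<union> A b c"
      using x' cs[of 0 \<beta>] cs[of \<beta> 1] ip[of 0 \<beta>] ip[of \<beta> 1] \<beta> unfolding A_def P01 by auto
  next
    fix x assume x: "x \<in> A a b \<union> A b c"
    then obtain p q where x': "x = (p, q)" "(p, q) \<in> gaps V" "p \<in> closed_segment a c" "q \<in> closed_segment a c"
      using sub unfolding A_def by blast
    then obtain s t where st: "p = P s" "q = P t" using ex by blast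
    have "s < t" using x \<beta> ip[of 0 \<beta>] ip[of \<beta> 1] unfolding x' st A_def P01 by auto
    then show "x \<in> A a c" using x' st ip[of 0 1] unfolding A_def P01 by auto
  qed
  moreover have "A a b \<inter> A b c = {}"
  proof (rule ccontr)
    assume "A a b \<inter> A b c \<noteq> {}"
    then obtain x where x: "x \<in> A a b" "x \<in> A b c" by blast
    then obtain p q where pq: "x = (p, q)" "p \<in> closed_segment a b" "q \<in> closed_segment a b"
      "p \<in> closed_segment b c" "q \<in> closed_segment b c" "(b - a) \<bullet> (q - p) > 0"
      unfolding A_def by blast
    obtain s where s: "p = P s" using ex pq(2) sub(1) by blast
    obtain t where t: "q = P t" using ex pq(3) sub(1) by blast
    have "s \<le> \<beta>" "t \<le> \<beta>" using pq(2,3) cs[of 0 \<beta>] \<beta> unfolding s t P01 by simp_all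
    moreover have "\<beta> \<le> s" "\<beta> \<le> t" using pq(4,5) cs[of \<beta> 1] \<beta> unfolding s t P01 by simp_all
    moreover have "s < t" using pq(6) ip[of 0 \<beta>] \<beta> unfolding s t P01 by simp
    ultimately show False by linarith
  qed
  moreover have "finite (A x y)" for x y
    by (rule finite_subset[OF _ finite_gaps[OF assms(1)]]) (auto simp: A_def)
  ultimately show ?thesis
    unfolding refine_def A_def[symmetric] by (simp add: sum.union_disjoint)
qed

text \<open>At a generic point of a gap, m lies inside the edge ab exactly if the whole gap lies on
  it. So the pointwise test agrees with the index set of \<open>refine\<close>.\<close>

lemma edge_ind_gap:
  assumes "(p, q) \<in> gaps V" "generic_on V p q m" "a \<in> V" "b \<in> V"
  shows "edge_ind p q m a b = of_bool (p \<in> closed_segment a b \<and> q \<in> closed_segment a b \<and> (b - a) \<bullet> (q - p) > 0)"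
proof (cases "a = b")
  case True then show ?thesis by (simp add: edge_ind_def)
next
  case False
  have m: "m \<in> open_segment p q" using assms(2) by (simp add: generic_on_def)
  have n: "a \<notin> open_segment p q" "b \<notin> open_segment p q" using assms(1,3,4) by (auto simp: gaps_def)
  have "p \<in> closed_segment a b \<and> q \<in> closed_segment a b" if "m \<in> open_segment a b"
  proof (rule gap_in_segment[OF m open_closed_segment[OF that] False _ _ n])
    show "orient a b p = 0" "orient a b q = 0"
      using assms(2-4) False orient_open_segment[OF that] by (auto simp: generic_on_def)
  qed
  moreover have "m \<in> open_segment a b" if "p \<in> closed_segment a b" "q \<in> closed_segment a b"
  proof -
    have "m \<in> closed_segment a b"
      using open_closed_segment[OF m] that by (meson closed_segment_subset convex_closed_segment subsetD)
    moreover have "m \<noteq> a" "m \<noteq> b" using m n by auto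
    ultimately show ?thesis by (simp add: open_segment_def)
  qed
  ultimately show ?thesis by (auto simp: edge_ind_def)
qed

lemma refine_generic:
  assumes "finite V" "a \<in> V" "b \<in> V" and m: "\<And>p q. (p, q) \<in> gaps V \<Longrightarrow> generic_on V p q (m p q)"
  shows "refine V h a b = (\<Sum>(p, q) \<in> gaps V. of_real (edge_ind p q (m p q) a b) * h p q)"
proof -
  have "refine V h a b = (\<Sum>x \<in> {(p, q) \<in> gaps V. p \<in> closed_segment a b \<and> q \<in> closed_segment a b
     \<and> (b - a) \<bullet> (q - p) > 0}. case x of (p, q) \<Rightarrow> of_real (edge_ind p q (m p q) a b) * h p q)"
    unfolding refine_def
    by (rule sum.cong) (use edge_ind_gap[OF _ m assms(2,3)] in \<open>auto\<close>)
  also have "\<dots> = (\<Sum>(p, q) \<in> gaps V. of_real (edge_ind p q (m p q) a b) * h p q)"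
    by (rule sum.mono_neutral_left[OF finite_gaps[OF assms(1)]])
      (use edge_ind_gap[OF _ m assms(2,3)] in \<open>auto\<close>)
  finally show ?thesis .
qed

text \<open>The factor 2 appears because \<open>gaps\<close> contains each gap in both orders and,
  by antisymmetry, both contribute equally.\<close>

lemma bdry_refine:
  assumes "finite V" "a \<in> V" "b \<in> V" "c \<in> V" "antisymmetric h"
    and m: "\<And>p q. (p, q) \<in> gaps V \<Longrightarrow> generic_on V p q (m p q)"
  shows "2 * bdry (refine V h) (a, b, c) = (\<Sum>(p, q) \<in> gaps V. of_real (edge_sign p q (m p q) a b c) * h p q)"
proof -
  have *: "2 * refine V h x y = (\<Sum>(p, q) \<in> gaps V. of_real (edge_ind p q (m p q) x y - edge_ind p q (m p q) y x) * h p q)"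
    if "x \<in> V" "y \<in> V" for x y
  proof -
    have "2 * refine V h x y = refine V h x y - refine V h y x"
      unfolding refine_swap[OF assms(5), of V y x] by simp
    also have "\<dots> = (\<Sum>(p, q) \<in> gaps V. of_real (edge_ind p q (m p q) x y - edge_ind p q (m p q) y x) * h p q)"
    proof -
      have "refine V h x y = (\<Sum>(p, q) \<in> gaps V. of_real (edge_ind p q (m p q) x y) * h p q)"
        "refine V h y x = (\<Sum>(p, q) \<in> gaps V. of_real (edge_ind p q (m p q) y x) * h p q)"
        using that assms(1) m by (intro refine_generic; blast)+
      then show ?thesis by (simp add: sum_subtractf case_prod_unfold left_diff_distrib)
    qed
    finally show ?thesis .
  qed
  have "2 * bdry (refine V h) (a, b, c) = 2 * refine V h a b + 2 * refine V h b c + 2 * refine V h c a"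
    by (simp add: bdry_def)
  also have "\<dots> = (\<Sum>(p, q) \<in> gaps V. of_real (edge_sign p q (m p q) a b c) * h p q)"
    unfolding *[OF assms(2,3)] *[OF assms(3,4)] *[OF assms(4,2)] sum.distrib[symmetric]
    by (simp add: case_prod_unfold edge_sign_def algebra_simps)
  finally show ?thesis .
qed

section \<open>Jumps of indicator functions across gaps\<close>

definition triangle :: "plane \<times> plane \<times> plane \<Rightarrow> plane set" where
  "triangle = (\<lambda>(a, b, c). convex hull {a, b, c})"

definition ccw_in :: "plane set \<Rightarrow> plane \<times> plane \<times> plane \<Rightarrow> bool" where
  "ccw_in V = (\<lambda>(a, b, c). a \<in> V \<and> b \<in> V \<and> c \<in> V \<and> orient a b c > 0)"

definition jump :: "plane \<Rightarrow> plane \<Rightarrow> plane \<Rightarrow> (plane \<Rightarrow> real) \<Rightarrow> real \<Rightarrow> bool" where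
  "jump p q m F k \<longleftrightarrow> (\<forall>\<^sub>F e in at_right 0. F (m + e *\<^sub>R rot (q - p)) - F (m + (- e) *\<^sub>R rot (q - p)) = k)"

lemma jump_unique: "jump p q m F k \<Longrightarrow> jump p q m F k' \<Longrightarrow> k = k'"
proof -
  assume "jump p q m F k" "jump p q m F k'"
  then have "\<forall>\<^sub>F e in at_right (0::real). k = k'" unfolding jump_def by eventually_elim simp
  then show ?thesis by (simp add: trivial_limit_at_right_real)
qed

definition sign_of :: "plane \<Rightarrow> plane \<Rightarrow> plane \<Rightarrow> plane \<times> plane \<times> plane \<Rightarrow> real" where
  "sign_of p q m = (\<lambda>(a, b, c). edge_sign p q m a b c)"

lemma triangle_jump:
  assumes "ccw_in V t" "p \<noteq> q" "generic_on V p q m"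
  shows "jump p q m (indicator (triangle t)) (sign_of p q m t)"
proof -
  obtain a b c where t: "t = (a, b, c)" by (cases t)
  have abc: "a \<in> V" "b \<in> V" "c \<in> V" "orient a b c > 0" using assms(1) by (auto simp: ccw_in_def t)
  have "\<exists>\<rho>>0. local_type (convex hull {a, b, c}) p q m \<rho> (edge_sign p q m a b c)"
    by (rule triangle_local[OF abc(4) assms(2)]) (use assms(3) abc in \<open>auto simp: generic_on_def\<close>)
  moreover have "orient p q m = 0" using assms(3) orient_open_segment by (auto simp: generic_on_def)
  ultimately show ?thesis
    using local_type_jump assms(2) unfolding jump_def t triangle_def sign_of_def by auto
qed

lemma jump_sum:
  assumes "finite I" "\<And>i. i \<in> I \<Longrightarrow> jump p q m (F i) (k i)"
  shows "jump p q m (\<lambda>z. \<Sum>i\<in>I. F i z) (\<Sum>i\<in>I. k i)"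
proof -
  have "\<forall>\<^sub>F e in at_right 0. \<forall>i\<in>I. F i (m + e *\<^sub>R rot (q - p)) - F i (m + (- e) *\<^sub>R rot (q - p)) = k i"
    using assms by (intro eventually_ball_finite) (auto simp: jump_def)
  then show ?thesis unfolding jump_def
    by eventually_elim (simp add: sum_subtractf[symmetric])
qed

lemma bdry_sum_refine:
  assumes "finite V" "finite I" "antisymmetric h" "\<And>i. i \<in> I \<Longrightarrow> ccw_in V (t i)"
    and m: "\<And>p q. (p, q) \<in> gaps V \<Longrightarrow> generic_on V p q (m p q)"
  shows "2 * (\<Sum>i\<in>I. bdry (refine V h) (t i)) = (\<Sum>(p, q) \<in> gaps V. of_real (\<Sum>i\<in>I. sign_of p q (m p q) (t i)) * h p q)"
proof -
  have *: "2 * bdry (refine V h) (t i) = (\<Sum>(p, q) \<in> gaps V. of_real (sign_of p q (m p q) (t i)) * h p q)" if "i \<in> I" for i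
  proof -
    obtain a b c where t: "t i = (a, b, c)" by (cases "t i")
    show ?thesis using assms(4)[OF that] bdry_refine[OF assms(1) _ _ _ assms(3) m, of a b c]
      unfolding t sign_of_def ccw_in_def by simp
  qed
  have "2 * (\<Sum>i\<in>I. bdry (refine V h) (t i)) = (\<Sum>i\<in>I. \<Sum>x \<in> gaps V. case x of (p, q) \<Rightarrow> of_real (sign_of p q (m p q) (t i)) * h p q)"
    unfolding sum_distrib_left by (intro sum.cong refl *)
  also have "\<dots> = (\<Sum>x \<in> gaps V. \<Sum>i\<in>I. case x of (p, q) \<Rightarrow> of_real (sign_of p q (m p q) (t i)) * h p q)"
    by (rule sum.swap)
  finally show ?thesis by (simp add: case_prod_unfold sum_distrib_right)
qed

text \<open>The coefficient of a 1-chain on a small edge is read off from the jump of the sum of the indicator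
  functions across that edge, so only this sum matters.\<close>

lemma bdry_sum_refine_eq:
  assumes "finite V" "finite I" "finite J" "antisymmetric h"
    and I: "\<And>i. i \<in> I \<Longrightarrow> ccw_in V (t i)" and J: "\<And>i. i \<in> J \<Longrightarrow> ccw_in V (t' i)"
    and eq: "\<And>p q m. \<lbrakk>(p, q) \<in> gaps V; h p q \<noteq> 0; generic_on V p q m\<rbrakk> \<Longrightarrow>
      \<forall>\<^sub>F e in at_right 0. (\<Sum>i\<in>I. indicator (triangle (t i)) (m + e *\<^sub>R rot (q - p)) :: real) =
          (\<Sum>i\<in>J. indicator (triangle (t' i)) (m + e *\<^sub>R rot (q - p))) \<and>
          (\<Sum>i\<in>I. indicator (triangle (t i)) (m + (- e) *\<^sub>R rot (q - p)) :: real) =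
          (\<Sum>i\<in>J. indicator (triangle (t' i)) (m + (- e) *\<^sub>R rot (q - p)))"
  shows "(\<Sum>i\<in>I. bdry (refine V h) (t i)) = (\<Sum>i\<in>J. bdry (refine V h) (t' i))"
proof -
  have "\<forall>p q. \<exists>m. (p, q) \<in> gaps V \<longrightarrow> generic_on V p q m"
    using generic_on_exists[OF assms(1)] by (auto simp: gaps_def)
  then obtain m where m: "\<And>p q. (p, q) \<in> gaps V \<Longrightarrow> generic_on V p q (m p q)" by metis
  \<comment> \<open>Both sides are jumps of functions that agree beside the gap. Asking for this
    only where h does not vanish allows functions supported on a frontier to be treated by looking
    at the sets near that frontier.\<close>
  have k: "(\<Sum>i\<in>I. sign_of p q (m p q) (t i)) = (\<Sum>i\<in>J. sign_of p q (m p q) (t' i))"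
    if "(p, q) \<in> gaps V" "h p q \<noteq> 0" for p q
  proof (rule jump_unique)
    have pq: "p \<noteq> q" using that by (auto simp: gaps_def)
    show *: "jump p q (m p q) (\<lambda>z. \<Sum>i\<in>I. indicator (triangle (t i)) z) (\<Sum>i\<in>I. sign_of p q (m p q) (t i))"
      using assms(2) triangle_jump[OF I pq m] that by (intro jump_sum) auto
    have "jump p q (m p q) (\<lambda>z. \<Sum>i\<in>J. indicator (triangle (t' i)) z) (\<Sum>i\<in>J. sign_of p q (m p q) (t' i))"
      using assms(3) triangle_jump[OF J pq m] that by (intro jump_sum) auto
    then show "jump p q (m p q) (\<lambda>z. \<Sum>i\<in>I. indicator (triangle (t i)) z) (\<Sum>i\<in>J. sign_of p q (m p q) (t' i))"
      unfolding jump_def using eq[OF that m[OF that(1)]] by eventually_elim simp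
  qed
  have "(\<Sum>(p, q) \<in> gaps V. of_real (\<Sum>i\<in>I. sign_of p q (m p q) (t i)) * h p q)
    = (\<Sum>(p, q) \<in> gaps V. of_real (\<Sum>i\<in>J. sign_of p q (m p q) (t' i)) * h p q)"
  proof (intro sum.cong refl, clarify)
    fix p q assume "(p, q) \<in> gaps V"
    then show "of_real (\<Sum>i\<in>I. sign_of p q (m p q) (t i)) * h p q = of_real (\<Sum>i\<in>J. sign_of p q (m p q) (t' i)) * h p q"
      using k[of p q] by (cases "h p q = 0") simp_all
  qed
  then have "2 * (\<Sum>i\<in>I. bdry (refine V h) (t i)) = 2 * (\<Sum>i\<in>J. bdry (refine V h) (t' i))"
    using bdry_sum_refine[OF assms(1,2,4) I m] bdry_sum_refine[OF assms(1,3,4) J m] by simp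
  then show ?thesis by simp
qed

section \<open>The sewing estimate\<close>

lemma refine_add_closed:
  assumes "finite V" "b \<in> V" "b \<in> closed_segment a c"
  shows "refine V h a c = refine V h a b + refine V h b c"
proof (cases "b = a \<or> b = c")
  case False
  then have "b \<in> open_segment a c" using assms by (auto simp: open_segment_def)
  then show ?thesis using refine_add assms by blast
qed auto

lemma closed_segment_antisym:
  fixes a b c :: plane
  assumes "b \<in> closed_segment a c" "c \<in> closed_segment a b"
  shows "b = c"
proof -
  have "dist a c = dist a b + dist b c" "dist a b = dist a c + dist c b"
    using assms by (simp_all add: between_mem_segment[symmetric] between)
  then have "dist b c + dist c b = 0" by linarith
  then show ?thesis by (simp add: dist_commute)
qed

lemma open_segment_mono_left:
  fixes a b c :: plane
  assumes "c \<in> closed_segment a b" "c \<noteq> b"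
  shows "open_segment a c \<subseteq> open_segment a b"
proof
  fix x assume x: "x \<in> open_segment a c"
  then have "x \<in> closed_segment a c" "x \<noteq> a" by (simp_all add: open_segment_def)
  moreover have "closed_segment a c \<subseteq> closed_segment a b" using assms(1) by (simp add: subset_closed_segment)
  moreover have "x \<noteq> b" using calculation(1) assms closed_segment_antisym by blast
  ultimately show "x \<in> open_segment a b" by (auto simp: open_segment_def)
qed

lemma open_segment_mono_right:
  fixes a b d :: plane
  assumes "d \<in> closed_segment a b" "d \<noteq> a"
  shows "open_segment d b \<subseteq> open_segment a b"
  using open_segment_mono_left[of d b a] assms by (simp add: closed_segment_commute open_segment_commute)

lemma finite_max:
  fixes f :: "'a \<Rightarrow> real"
  assumes "finite A" "A \<noteq> {}"
  obtains x where "x \<in> A" "\<And>y. y \<in> A \<Longrightarrow> f y \<le> f x"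
proof -
  have "Max (f ` A) \<in> f ` A" using assms by (intro Max_in) auto
  then obtain x where "x \<in> A" "f x = Max (f ` A)" by auto
  then show thesis using that assms by (metis Max_ge finite_imageI imageI)
qed

lemma norm4:
  fixes p q r s :: complex
  shows "norm (p + q - r - s) \<le> norm p + norm q + norm r + norm s"
  using norm_triangle_ineq[of p q] norm_triangle_ineq4[of "p + q" r] norm_triangle_ineq4[of "p + q - r" s]
  by linarith

text \<open>The solution Y of Y = 2 C + 2 (1/2)^\<theta> Y, the recursion of a bisection with two
  defects of size C and two halves; it is the sum of a geometric series that converges for \<theta>
  > 1.\<close>

definition young_const :: "real \<Rightarrow> real \<Rightarrow> real" where
  "young_const C \<theta> = 2 * C / (1 - 2 * (1/2) powr \<theta>)"

lemma young_const:
  assumes "C \<ge> 0" "\<theta> > 1"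
  shows "young_const C \<theta> \<ge> 0" "2 * C + 2 * (young_const C \<theta> * (1/2) powr \<theta>) = young_const C \<theta>"
proof -
  have "(1/2) powr \<theta> < (1/2 :: real) powr 1" using assms(2) by (intro powr_less_mono') auto
  then have d: "1 - 2 * (1/2) powr \<theta> > 0" by simp
  show "young_const C \<theta> \<ge> 0" unfolding young_const_def using assms(1) d by (intro divide_nonneg_pos) auto
  have "young_const C \<theta> * (1 - 2 * (1/2) powr \<theta>) = 2 * C" unfolding young_const_def using d by simp
  then show "2 * C + 2 * (young_const C \<theta> * (1/2) powr \<theta>) = young_const C \<theta>" by (simp add: algebra_simps)
qed

text \<open>The midpoint need not belong to V. So c and d are the points of V nearest to it on
  either side; they coincide or bound a gap, and what lies outside them has at most half the length
  on each side.\<close>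

lemma split_at_midpoint:
  assumes "finite V" "a \<in> V" "b \<in> V" "a \<noteq> b"
  obtains c d where "c \<in> V" "d \<in> V" "c \<in> closed_segment a b" "d \<in> closed_segment c b"
    "dist a c \<le> dist a b / 2" "dist d b \<le> dist a b / 2" "c = d \<or> (c, d) \<in> gaps V"
proof -
  define P where "P t = a + t *\<^sub>R (b - a)" for t
  define l where "l = dist a b"
  have ba: "b - a \<noteq> 0" using assms by simp
  have l: "l > 0" using assms(4) by (simp add: l_def)
  have P01: "a = P 0" "b = P 1" by (simp_all add: P_def)
  have dP: "dist (P s) (P t) = \<bar>t - s\<bar> * l" for s t
  proof -
    have "P s - P t = (s - t) *\<^sub>R (b - a)" by (simp add: P_def algebra_simps)
    then show ?thesis by (simp add: dist_norm l_def norm_minus_commute abs_minus_commute)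
  qed
  have cs: "P s \<in> closed_segment (P x) (P y) \<longleftrightarrow> x \<le> s \<and> s \<le> y" if "x \<le> y" for s x y
    unfolding P_def using closed_segment_param[OF ba that] .
  have os: "P s \<in> open_segment (P x) (P y) \<longleftrightarrow> x < s \<and> s < y" if "x < y" for s x y
    unfolding P_def using open_segment_param_iff[OF ba that] .
  have inj: "P s = P t \<longleftrightarrow> s = t" for s t unfolding P_def using ba by simp
  define T where "T = {t. 0 \<le> t \<and> t \<le> 1 \<and> P t \<in> V}"
  have "P ` T \<subseteq> V" "inj_on P T" using inj by (auto simp: T_def inj_on_def)
  then have "finite T" using assms(1) by (meson finite_imageD finite_subset)
  have T01: "0 \<in> T" "1 \<in> T" using assms(2,3) P01 by (simp_all add: T_def)
  have "\<exists>\<gamma>\<in>{t \<in> T. t \<le> 1/2}. \<forall>t\<in>{t \<in> T. t \<le> 1/2}. t \<le> \<gamma>"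
    by (rule finite_max[of "{t \<in> T. t \<le> 1/2}" "\<lambda>t. t"]) (use \<open>finite T\<close> T01 in \<open>fastforce+\<close>)
  then obtain \<gamma> where \<gamma>: "\<gamma> \<in> T" "\<gamma> \<le> 1/2" "\<And>t. t \<in> T \<Longrightarrow> t \<le> 1/2 \<Longrightarrow> t \<le> \<gamma>" by blast
  have "\<exists>\<delta>\<in>{t \<in> T. t \<ge> 1/2}. \<forall>t\<in>{t \<in> T. t \<ge> 1/2}. - t \<le> - \<delta>"
    by (rule finite_max[of "{t \<in> T. t \<ge> 1/2}" "\<lambda>t. - t"]) (use \<open>finite T\<close> T01 in \<open>fastforce+\<close>)
  then obtain \<delta> where \<delta>: "\<delta> \<in> T" "\<delta> \<ge> 1/2" "\<And>t. t \<in> T \<Longrightarrow> t \<ge> 1/2 \<Longrightarrow> t \<ge> \<delta>"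
    unfolding neg_le_iff_le by blast
  have g01: "0 \<le> \<gamma>" "\<delta> \<le> 1" "P \<gamma> \<in> V" "P \<delta> \<in> V" using \<gamma> \<delta> by (auto simp: T_def)
  show thesis
  proof (rule that[of "P \<gamma>" "P \<delta>"])
    show "P \<gamma> \<in> closed_segment a b" "P \<delta> \<in> closed_segment (P \<gamma>) b"
      using cs[of 0 1 \<gamma>] cs[of \<gamma> 1 \<delta>] g01 \<gamma>(2) \<delta>(2) unfolding P01 by simp_all
    show "dist a (P \<gamma>) \<le> dist a b / 2" "dist (P \<delta>) b \<le> dist a b / 2"
      using mult_right_mono[of \<gamma> "1/2" l] mult_right_mono[of "1 - \<delta>" "1/2" l] g01 \<gamma>(2) \<delta>(2) l dP[of 0 \<gamma>] dP[of \<delta> 1]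
      unfolding l_def[symmetric] P01(1)[symmetric] P01(2)[symmetric] by simp_all
    show "P \<gamma> = P \<delta> \<or> (P \<gamma>, P \<delta>) \<in> gaps V"
    proof (cases "\<gamma> = \<delta>")
      case False
      then have lt: "\<gamma> < \<delta>" using \<gamma> \<delta> by linarith
      have "x \<notin> V" if "x \<in> open_segment (P \<gamma>) (P \<delta>)" for x
      proof
        assume "x \<in> V"
        have "open_segment (P \<gamma>) (P \<delta>) \<subseteq> closed_segment a b"
          using cs[of 0 1 \<gamma>] cs[of 0 1 \<delta>] g01 \<gamma>(2) \<delta>(2) P01
          by (intro subset_trans[OF segment_open_subset_closed]) (simp add: subset_closed_segment)
        then have "x \<in> closed_segment a b" using that by blast
        then obtain s where s: "x = P s"
          using closed_segment_obtain unfolding P_def by metis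
        have "\<gamma> < s" "s < \<delta>" using that os[OF lt] unfolding s by auto
        moreover have "s \<in> T" using \<open>x \<in> V\<close> calculation g01 by (auto simp: s T_def)
        ultimately show False using \<gamma>(3)[of s] \<delta>(3)[of s] by linarith
      qed
      then show ?thesis using g01 False inj by (auto simp: gaps_def)
    qed simp
  qed (use g01 in auto)
qed

text \<open>The sewing estimate behind Young's integral, for the possibly very uneven subdivision of the
  segment by \<open>V\<close>: splitting next to the midpoint halves both remaining parts.\<close>

lemma refine_young:
  assumes "finite V" "a \<in> V" "b \<in> V" "C \<ge> 0" "\<theta> > 1" "\<And>x. h x x = 0"
    and "\<And>x y z. \<lbrakk>x \<in> closed_segment a b; z \<in> closed_segment a b; y \<in> closed_segment x z\<rbrakk>
           \<Longrightarrow> norm (h x z - h x y - h y z) \<le> C * dist x z powr \<theta>"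
  shows "norm (refine V h a b - h a b) \<le> young_const C \<theta> * dist a b powr \<theta>"
  using assms(2,3,7)
\<comment> \<open>Induction on the number of points of V strictly between a and b; each of the two
  outer parts has fewer.\<close>
proof (induction "card (V \<inter> open_segment a b)" arbitrary: a b rule: less_induct)
  case less
  let ?C = "young_const C \<theta>"
  show ?case
  proof (cases "a = b")
    case True then show ?thesis using assms(6) by simp
  next
    case False
    obtain c d where cd: "c \<in> V" "d \<in> V" "c \<in> closed_segment a b" "d \<in> closed_segment c b"
      "dist a c \<le> dist a b / 2" "dist d b \<le> dist a b / 2" "c = d \<or> (c, d) \<in> gaps V"
      using split_at_midpoint[OF assms(1) less.prems(1,2) False] .
    have cb: "closed_segment c b \<subseteq> closed_segment a b" "closed_segment a c \<subseteq> closed_segment a b"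
      using cd(3) by (simp_all add: subset_closed_segment)
    have d: "d \<in> closed_segment a b" using cd(4) cb(1) by blast
    then have db: "d \<in> closed_segment a b" "closed_segment d b \<subseteq> closed_segment a b"
      by (simp_all add: subset_closed_segment)
    have ne: "c \<noteq> b" "d \<noteq> a"
      using cd(5,6) False by (auto simp: dist_commute)
    have finV: "finite (V \<inter> open_segment a b)" using assms(1) by simp
    have half: "?C * r powr \<theta> \<le> ?C * ((1/2) powr \<theta> * dist a b powr \<theta>)" if "0 \<le> r" "r \<le> dist a b / 2" for r
    proof -
      have "r powr \<theta> \<le> (1/2 * dist a b) powr \<theta>" using that assms(5) by (intro powr_mono2) auto
      also have "\<dots> = (1/2) powr \<theta> * dist a b powr \<theta>" by (rule powr_mult)
      finally show ?thesis using young_const(1)[OF assms(4,5)] by (rule mult_left_mono)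
    qed
    have IH1: "norm (refine V h a c - h a c) \<le> ?C * dist a c powr \<theta>"
    proof (cases "a = c")
      case False
      have "V \<inter> open_segment a c \<subset> V \<inter> open_segment a b"
      proof
        show "V \<inter> open_segment a c \<subseteq> V \<inter> open_segment a b"
          using open_segment_mono_left[OF cd(3) ne(1)] by blast
        show "V \<inter> open_segment a c \<noteq> V \<inter> open_segment a b"
          using cd(1,3) ne False by (auto simp: open_segment_def)
      qed
      then show ?thesis
        using less.hyps[of a c] less.prems cd(1) cb(2) finV by (meson psubset_card_mono subsetD)
    qed (simp add: assms(6))
    have IH2: "norm (refine V h d b - h d b) \<le> ?C * dist d b powr \<theta>"
    proof (cases "d = b")
      case False
      have "V \<inter> open_segment d b \<subset> V \<inter> open_segment a b"
      proof
        show "V \<inter> open_segment d b \<subseteq> V \<inter> open_segment a b"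
          using open_segment_mono_right[OF d ne(2)] by blast
        show "V \<inter> open_segment d b \<noteq> V \<inter> open_segment a b"
          using cd(2) db ne False by (auto simp: open_segment_def)
      qed
      then show ?thesis
        using less.hyps[of d b] less.prems cd(2) db(2) finV by (meson psubset_card_mono subsetD)
    qed (simp add: assms(6))
    \<comment> \<open>The middle part is a gap or a point and causes no error. The total error
      consists of the errors of the two outer parts and of the defects from inserting c and then
      d.\<close>
    have "refine V h c d = h c d" using cd(7) refine_gap assms(6) by auto
    then have R: "refine V h a b = refine V h a c + h c d + refine V h d b"
      using refine_add_closed[OF assms(1) cd(1,3), of h] refine_add_closed[OF assms(1) cd(2,4), of h] by simp
    have e1: "norm (h a b - h a c - h c b) \<le> C * dist a b powr \<theta>"
      using less.prems(3)[of a b c] cd by simp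
    have "norm (h c b - h c d - h d b) \<le> C * dist c b powr \<theta>"
      using less.prems(3)[of c b d] cd by simp
    also have "\<dots> \<le> C * dist a b powr \<theta>"
      using cd(3) assms(4,5) by (intro mult_left_mono powr_mono2) (auto simp: between_mem_segment[symmetric] between)
    finally have e2: "norm (h c b - h c d - h d b) \<le> C * dist a b powr \<theta>" .
    have "refine V h a b - h a b = (refine V h a c - h a c) + (refine V h d b - h d b)
        - (h a b - h a c - h c b) - (h c b - h c d - h d b)"
      unfolding R by simp
    then have "norm (refine V h a b - h a b) \<le> norm (refine V h a c - h a c) + norm (refine V h d b - h d b)
        + norm (h a b - h a c - h c b) + norm (h c b - h c d - h d b)"
      using norm4 by metis
    also have "\<dots> \<le> ?C * ((1/2) powr \<theta> * dist a b powr \<theta>) + ?C * ((1/2) powr \<theta> * dist a b powr \<theta>)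
       + C * dist a b powr \<theta> + C * dist a b powr \<theta>"
      using IH1 IH2 half[OF _ cd(5)] half[OF _ cd(6)] e1 e2 by (intro add_mono) (auto intro: order_trans)
    also have "\<dots> = (2 * C + 2 * (?C * (1/2) powr \<theta>)) * dist a b powr \<theta>" by (simp add: algebra_simps)
    also have "\<dots> = ?C * dist a b powr \<theta>" using young_const(2)[OF assms(4,5)] by simp
    finally show ?thesis .
  qed
qed

text \<open>With Y for the constant, the sewing estimate costs Y d^\<theta> \<le> Y
  \<delta>^(\<theta> - 1) d on a gap of V of length d \<le> \<delta>, and the lengths of the gaps on
  ab add up to its length.\<close>

lemma refine_mesh:
  assumes "finite W" "V \<subseteq> W" "a \<in> V" "b \<in> V" "C \<ge> 0" "\<theta> > 1" "\<And>x. h x x = 0"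
    and "\<And>x y z. \<lbrakk>x \<in> closed_segment a b; z \<in> closed_segment a b; y \<in> closed_segment x z\<rbrakk>
           \<Longrightarrow> norm (h x z - h x y - h y z) \<le> C * dist x z powr \<theta>"
    and "\<And>p q. \<lbrakk>(p, q) \<in> gaps V; p \<in> closed_segment a b; q \<in> closed_segment a b\<rbrakk> \<Longrightarrow> dist p q \<le> \<delta>"
  shows "norm (refine W h a b - refine V h a b) \<le> young_const C \<theta> * \<delta> powr (\<theta> - 1) * dist a b"
  using assms(3,4,8,9)
proof (induction "card (V \<inter> open_segment a b)" arbitrary: a b rule: less_induct)
  case less
  let ?C = "young_const C \<theta>"
  have finV: "finite V" using assms(1,2) finite_subset by blast
  show ?case
  proof (cases "V \<inter> open_segment a b = {}")
    case True
    show ?thesis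
    proof (cases "a = b")
      case False
      then have g: "(a, b) \<in> gaps V" using True less.prems by (auto simp: gaps_def)
      have d: "dist a b \<le> \<delta>" using less.prems(4)[OF g] by simp
      have "norm (refine W h a b - h a b) \<le> ?C * dist a b powr \<theta>"
        using refine_young[where h = h and a = a and b = b, OF assms(1) _ _ assms(5-7)]  less.prems assms(2) by blast
      also have "dist a b powr \<theta> = dist a b powr (\<theta> - 1) * dist a b"
        using False by (simp add: powr_diff)
      also have "?C * (dist a b powr (\<theta> - 1) * dist a b) \<le> ?C * (\<delta> powr (\<theta> - 1) * dist a b)"
        using young_const(1)[OF assms(5,6)] d assms(6) by (intro mult_left_mono mult_right_mono powr_mono2) auto
      finally show ?thesis using refine_gap[OF g] by (simp add: mult_ac)
    qed simp
  next
    case False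
    then obtain c where c: "c \<in> V" "c \<in> open_segment a b" by auto
    have cc: "c \<in> closed_segment a b" "c \<noteq> a" "c \<noteq> b" using c(2) by (auto simp: open_segment_def)
    have sub: "closed_segment a c \<subseteq> closed_segment a b" "closed_segment c b \<subseteq> closed_segment a b"
      using cc by (simp_all add: subset_closed_segment)
    have "V \<inter> open_segment a c \<subset> V \<inter> open_segment a b"
      using open_segment_mono_left[OF cc(1,3)] c by (auto simp: open_segment_def)
    then have 1: "norm (refine W h a c - refine V h a c) \<le> ?C * \<delta> powr (\<theta> - 1) * dist a c"
      by (intro less.hyps psubset_card_mono less.prems(1,3,4) c(1)) (use finV sub(1) in blast)+
    have "V \<inter> open_segment c b \<subset> V \<inter> open_segment a b"
      using open_segment_mono_right[OF cc(1,2)] c by (auto simp: open_segment_def)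
    then have 2: "norm (refine W h c b - refine V h c b) \<le> ?C * \<delta> powr (\<theta> - 1) * dist c b"
      by (intro less.hyps psubset_card_mono less.prems(2,3,4) c(1)) (use finV sub(2) in blast)+
    have "refine W h a b - refine V h a b = (refine W h a c - refine V h a c) + (refine W h c b - refine V h c b)"
    proof -
      have "c \<in> W" using c(1) assms(2) by blast
      show ?thesis unfolding refine_add[OF finV c, of h] refine_add[OF assms(1) \<open>c \<in> W\<close> c(2), of h] by simp
    qed
    then have "norm (refine W h a b - refine V h a b) \<le> norm (refine W h a c - refine V h a c) + norm (refine W h c b - refine V h c b)"
      by (simp only: norm_triangle_ineq)
    also have "\<dots> \<le> ?C * \<delta> powr (\<theta> - 1) * dist a c + ?C * \<delta> powr (\<theta> - 1) * dist c b"
      using 1 2 by (rule add_mono)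
    also have "\<dots> = ?C * \<delta> powr (\<theta> - 1) * (dist a c + dist c b)" by (simp add: algebra_simps)
    also have "dist a c + dist c b = dist a b" using cc(1) by (simp add: between_mem_segment[symmetric] between)
    finally show ?thesis .
  qed
qed

section \<open>The edge function of f and g and its second-order defect\<close>

definition wedge :: "(plane \<Rightarrow> complex) \<Rightarrow> (plane \<Rightarrow> complex) \<Rightarrow> plane \<Rightarrow> plane \<Rightarrow> complex" where
  "wedge f g x y = f x * (g y - g x) - g x * (f y - f x)"

lemma antisymmetric_wedge: "antisymmetric (wedge f g)"
  unfolding antisymmetric_def by (simp add: wedge_def algebra_simps)

text \<open>Only products of an increment of f with an increment of g remain. This doubles the
  Hoelder exponent and is the source of 2 \<alpha>.\<close>

lemma wedge_defect:
  "wedge f g x z - wedge f g x y - wedge f g y z = (f x - f y) * (g z - g y) - (g x - g y) * (f z - f y)"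
  by (simp add: wedge_def algebra_simps)

lemma holder_bound:
  assumes "f \<in> holder_functions \<alpha> K"
  obtains A where "A \<ge> 0" "\<And>x y. x \<in> K \<Longrightarrow> y \<in> K \<Longrightarrow> norm (f x - f y) \<le> A * dist x y powr \<alpha>"
proof -
  obtain C where C: "\<And>x y. x \<in> K \<Longrightarrow> y \<in> K \<Longrightarrow> norm (f x - f y) \<le> C * dist x y powr \<alpha>"
    using assms unfolding holder_functions_def by blast
  have "norm (f x - f y) \<le> \<bar>C\<bar> * dist x y powr \<alpha>" if "x \<in> K" "y \<in> K" for x y
    using C[OF that] by (meson abs_ge_self dual_order.trans mult_right_mono powr_ge_zero)
  then show thesis using that[of "\<bar>C\<bar>"] by simp
qed

lemma wedge_defect_bound:
  assumes "f \<in> holder_functions \<alpha> K" "g \<in> holder_functions \<alpha> K" "\<alpha> > 0"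
  obtains C where "C \<ge> 0"
    "\<And>x y z r. \<lbrakk>x \<in> K; y \<in> K; z \<in> K; dist x y \<le> r; dist y z \<le> r\<rbrakk>
       \<Longrightarrow> norm (wedge f g x z - wedge f g x y - wedge f g y z) \<le> C * r powr (2 * \<alpha>)"
proof -
  obtain A where A: "A \<ge> 0" "\<And>x y. x \<in> K \<Longrightarrow> y \<in> K \<Longrightarrow> norm (f x - f y) \<le> A * dist x y powr \<alpha>"
    using holder_bound[OF assms(1)] by blast
  obtain B where B: "B \<ge> 0" "\<And>x y. x \<in> K \<Longrightarrow> y \<in> K \<Longrightarrow> norm (g x - g y) \<le> B * dist x y powr \<alpha>"
    using holder_bound[OF assms(2)] by blast
  have "norm (wedge f g x z - wedge f g x y - wedge f g y z) \<le> (2 * A * B) * r powr (2 * \<alpha>)"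
    if "x \<in> K" "y \<in> K" "z \<in> K" "dist x y \<le> r" "dist y z \<le> r" for x y z r
  proof -
    have p: "dist u v powr \<alpha> \<le> r powr \<alpha>" if "dist u v \<le> r" for u v :: plane
      using that assms(3) by (intro powr_mono2) auto
    have f: "norm (f u - f v) \<le> A * r powr \<alpha>" if "u \<in> K" "v \<in> K" "dist u v \<le> r" for u v
      using A(2)[OF that(1,2)] mult_left_mono[OF p[OF that(3)] A(1)] by linarith
    have g: "norm (g u - g v) \<le> B * r powr \<alpha>" if "u \<in> K" "v \<in> K" "dist u v \<le> r" for u v
      using B(2)[OF that(1,2)] mult_left_mono[OF p[OF that(3)] B(1)] by linarith
    have zy: "dist z y \<le> r" using that by (simp add: dist_commute)
    have "norm (wedge f g x z - wedge f g x y - wedge f g y z)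
      \<le> norm (f x - f y) * norm (g z - g y) + norm (g x - g y) * norm (f z - f y)"
      unfolding wedge_defect by (metis norm_mult norm_triangle_ineq4)
    also have "\<dots> \<le> (A * r powr \<alpha>) * (B * r powr \<alpha>) + (B * r powr \<alpha>) * (A * r powr \<alpha>)"
      using that zy f g A(1) B(1) by (intro add_mono mult_mono) auto
    also have "\<dots> = (2 * A * B) * (r powr \<alpha> * r powr \<alpha>)" by (simp add: algebra_simps)
    also have "r powr \<alpha> * r powr \<alpha> = r powr (2 * \<alpha>)" by (simp add: powr_add[symmetric])
    finally show ?thesis .
  qed
  then show thesis using that[of "2 * A * B"] A(1) B(1) by simp
qed

section \<open>Ordered chains and antisymmetric edge functions\<close>

definition chain_eval :: "(plane list \<Rightarrow> complex) \<Rightarrow> chain \<Rightarrow> complex" where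
  "chain_eval u c = (\<Sum>y \<in> Poly_Mapping.keys c. Poly_Mapping.lookup c y * u y)"

lemma chain_eval_superset:
  assumes "finite A" "Poly_Mapping.keys c \<subseteq> A"
  shows "chain_eval u c = (\<Sum>y \<in> A. Poly_Mapping.lookup c y * u y)"
  unfolding chain_eval_def using assms by (intro sum.mono_neutral_left) (auto simp: in_keys_iff)

lemma chain_eval_add: "chain_eval u (c + d) = chain_eval u c + chain_eval u d"
proof -
  let ?A = "Poly_Mapping.keys c \<union> Poly_Mapping.keys d"
  have "finite ?A" by simp
  then show ?thesis
    using chain_eval_superset[of ?A c u] chain_eval_superset[of ?A d u] chain_eval_superset[of ?A "c + d" u] keys_add[of c d]
    by (simp add: sum.distrib lookup_add distrib_right)
qed

lemma chain_eval_0 [simp]: "chain_eval u 0 = 0"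
  by (simp add: chain_eval_def)

lemma chain_eval_diff: "chain_eval u (c - d) = chain_eval u c - chain_eval u d"
  using chain_eval_add[of u "c - d" d] by simp

lemma chain_eval_single [simp]: "chain_eval u (Poly_Mapping.single y a) = a * u y"
  by (cases "a = 0") (simp_all add: chain_eval_def)

lemma chain_eval_sum: "chain_eval u (\<Sum>i\<in>I. c i) = (\<Sum>i\<in>I. chain_eval u (c i))"
  by (induction I rule: infinite_finite_induct) (simp_all add: chain_eval_add)

lemma chain_eval_boundary:
  "chain_eval u (ordered_boundary c) = chain_eval (\<lambda>x. \<Sum>j<length x. (- 1) ^ j * u (take j x @ drop (Suc j) x)) c"
  unfolding ordered_boundary_def chain_eval_sum chain_eval_single
  by (simp add: chain_eval_def sum_distrib_left mult_ac)

definition edge_fun :: "(plane \<Rightarrow> plane \<Rightarrow> complex) \<Rightarrow> plane list \<Rightarrow> complex" where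
  "edge_fun h y = h (y ! 0) (y ! 1)"

definition bdry_list :: "(plane \<Rightarrow> plane \<Rightarrow> complex) \<Rightarrow> plane list \<Rightarrow> complex" where
  "bdry_list h x = bdry h (x ! 0, x ! 1, x ! 2)"

lemma length3E:
  assumes "length x = 3"
  obtains a b c where "x = [a, b, c]"
  using assms by (auto simp: numeral_3_eq_3 length_Suc_conv)

lemma chain_eval_boundary3:
  assumes "antisymmetric h" "\<And>x. x \<in> Poly_Mapping.keys c \<Longrightarrow> length x = 3"
  shows "chain_eval (edge_fun h) (ordered_boundary c) = chain_eval (bdry_list h) c"
proof -
  have "(\<Sum>j<length x. (- 1) ^ j * edge_fun h (take j x @ drop (Suc j) x)) = bdry_list h x"
    if x: "length x = 3" for x
  proof -
    obtain p q r where x: "x = [p, q, r]" using length3E[OF x] .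
    have "{..<length x} = {0, 1, 2}" by (auto simp: x)
    then have "(\<Sum>j<length x. (- 1) ^ j * edge_fun h (take j x @ drop (Suc j) x)) = h q r - h p r + h p q"
      by (simp add: x edge_fun_def numeral_2_eq_2)
    also have "\<dots> = bdry_list h x"
      unfolding antisymmetricD[OF assms(1), of p r] by (simp add: x bdry_list_def bdry_def)
    finally show ?thesis .
  qed
  then show ?thesis
    unfolding chain_eval_boundary unfolding chain_eval_def using assms(2) by (intro sum.cong) auto
qed

lemma bdry_list_degenerate:
  assumes "antisymmetric h" "length x = 3" "\<not> distinct x"
  shows "bdry_list h x = 0"
proof -
  obtain a b c where x: "x = [a, b, c]" using length3E[OF assms(2)] .
  have "a = b \<or> b = c \<or> a = c" using assms(3) by (auto simp: x)
  then show ?thesis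
    unfolding x bdry_list_def bdry_def
    using antisymmetric_self[OF assms(1)] antisymmetricD[OF assms(1), of a b] antisymmetricD[OF assms(1), of a c]
    by auto
qed

lemma bdry_list_transpose:
  assumes "antisymmetric h" "length x = 3" "i < 3" "j < 3" "i \<noteq> j"
  shows "bdry_list h (permute_list (Transposition.transpose i j) x) = - bdry_list h x"
proof -
  obtain a b c where x: "x = [a, b, c]" using length3E[OF assms(2)] .
  have s: "h b a = - h a b" "h c b = - h b c" "h a c = - h c a"
    using antisymmetricD[OF assms(1)] by blast+
  have *: "bdry_list h (permute_list (Transposition.transpose k l) x) = - bdry_list h x"
    if "(k, l) \<in> {(0, 1), (0, 2), (1, 2)}" for k l :: nat
  proof -
    have p: "permute_list \<pi> [a, b, c] ! 0 = [a, b, c] ! \<pi> 0" "permute_list \<pi> [a, b, c] ! Suc 0 = [a, b, c] ! \<pi> 1"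
      "permute_list \<pi> [a, b, c] ! 2 = [a, b, c] ! \<pi> 2" for \<pi>
      by (simp_all add: permute_list_def numeral_2_eq_2)
    from that consider "k = 0" "l = 1" | "k = 0" "l = 2" | "k = 1" "l = 2" by auto
    then show ?thesis
      by cases (simp_all add: p x bdry_list_def bdry_def Transposition.transpose_def s)
  qed
  have "(i, j) \<in> {(0, 1), (0, 2), (1, 2)} \<or> (j, i) \<in> {(0, 1), (0, 2), (1, 2)}" using assms(3-5) by auto
  then show ?thesis
  proof
    assume "(i, j) \<in> {(0, 1), (0, 2), (1, 2)}" then show ?thesis by (rule *)
  next
    assume "(j, i) \<in> {(0, 1), (0, 2), (1, 2)}" then show ?thesis unfolding transpose_commute[of i j] by (rule *)
  qed
qed

lemma bdry_list_permute:
  assumes "antisymmetric h" "\<tau> permutes {..<3}" "length x = 3"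
  shows "bdry_list h (permute_list \<tau> x) = of_int (sign \<tau>) * bdry_list h x"
proof -
  have "finite {..<3::nat}" by simp
  then show ?thesis using assms(2)
  proof (induction rule: permutes_rev_induct)
    case id then show ?case by simp
  next
    case (swap i j p)
    have t: "Transposition.transpose i j permutes {..<length x}"
      using swap.hyps assms(3) by (intro permutes_swap_id) auto
    have "permute_list (p \<circ> Transposition.transpose i j) x = permute_list (Transposition.transpose i j) (permute_list p x)"
      by (rule permute_list_compose[OF t])
    moreover have "bdry_list h (permute_list (Transposition.transpose i j) (permute_list p x)) = - bdry_list h (permute_list p x)"
      by (rule bdry_list_transpose) (use swap.hyps assms in auto)
    moreover have "sign (p \<circ> Transposition.transpose i j) = - sign p"
      using swap.hyps permutes_imp_permutation[of "{..<3}" p]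
      by (subst sign_compose) (auto simp: sign_swap_id permutation_swap_id)
    ultimately show ?case by (simp only: swap.IH of_int_minus mult_minus_left)
  qed
qed

text \<open>The reason for insisting on antisymmetric edge functions: their boundary values vanish
  on degenerate triples and pick up the sign under permutations, so they are well defined on
  oriented chains.\<close>

lemma chain_eval_relations:
  assumes "antisymmetric h" "r \<in> orientation_relations T 2"
  shows "chain_eval (bdry_list h) r = 0"
  using assms(2)
proof induction
  case zero then show ?case by simp
next
  case (degenerate r x a)
  then have "length x = 3" by (simp add: ordered_simplices_def)
  then show ?case using degenerate bdry_list_degenerate[OF assms(1)] by (simp add: chain_eval_add)
next
  case (permuted r x \<tau> a)
  then have "length x = 3" by (simp add: ordered_simplices_def)
  then show ?case using permuted bdry_list_permute[OF assms(1), of \<tau> x]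
    by (simp add: chain_eval_add chain_eval_diff)
qed

definition ccw_triple :: "plane set \<Rightarrow> plane \<times> plane \<times> plane" where
  "ccw_triple \<sigma> = (ccw_ordering \<sigma> ! 0, ccw_ordering \<sigma> ! 1, ccw_ordering \<sigma> ! 2)"

definition triangles :: "plane set set \<Rightarrow> plane set set" where
  "triangles T = {\<sigma> \<in> T. 2 simplex \<sigma>}"

text \<open>An antisymmetric function on edges only sees the oriented boundary, in which the choice of the
  lift has no influence.\<close>

lemma chain_eval_lift:
  assumes "antisymmetric h" "admissible_lift T A s"
  shows "chain_eval (edge_fun h) (ordered_boundary s) = (\<Sum>\<sigma> \<in> triangles T. bdry h (ccw_triple \<sigma>))"
proof -
  let ?c = "\<Sum>\<sigma> \<in> {\<sigma> \<in> T. 2 simplex \<sigma>}. Poly_Mapping.single (ccw_ordering \<sigma>) (1::complex)"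
  have s: "s \<in> ordered_chains T 2" "oriented_class T 2 s = fundamental_chain T"
    using assms(2) by (auto simp: admissible_lift_def)
  have "s \<in> oriented_class T 2 s"
    using s(1) orientation_relations.zero by (simp add: oriented_class_def)
  then have "s \<in> fundamental_chain T" by (simp only: s(2))
  then have "s - ?c \<in> orientation_relations T 2"
    unfolding fundamental_chain_def oriented_class_def by blast
  then have "chain_eval (bdry_list h) (s - ?c) = 0"
    by (rule chain_eval_relations[OF assms(1)])
  then have "chain_eval (bdry_list h) s = chain_eval (bdry_list h) ?c"
    by (simp only: chain_eval_diff right_minus_eq)
  moreover have "length x = 3" if "x \<in> Poly_Mapping.keys s" for x
    using s(1) that by (auto simp: ordered_chains_def ordered_simplices_def)
  ultimately show ?thesis
    using chain_eval_boundary3[OF assms(1), of s]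
    by (simp add: chain_eval_sum triangles_def bdry_list_def ccw_triple_def)
qed

lemma keys_ordered_boundary:
  assumes "y \<in> Poly_Mapping.keys (ordered_boundary c)"
  obtains x j where "x \<in> Poly_Mapping.keys c" "j < length x" "y = take j x @ drop (Suc j) x"
proof -
  have "Poly_Mapping.keys (ordered_boundary c) \<subseteq> (\<Union>x \<in> Poly_Mapping.keys c. \<Union>j<length x. {take j x @ drop (Suc j) x})"
    unfolding ordered_boundary_def
    by (intro order_trans[OF keys_sum] UN_mono order_refl) auto
  then show thesis using assms that by blast
qed

lemma cup_form_eq: "cup_form f g c = chain_eval (edge_fun (wedge f g)) c"
  by (simp add: cup_form_def chain_eval_def edge_fun_def wedge_def)

text \<open>Instead of cutting the chain \<open>b\<^sub>n\<close> down to the edges on the frontier,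
  the edge function is cut down. It remains antisymmetric, so the outer part can be computed from
  the oriented boundary as well.\<close>

definition restrict_to :: "plane set \<Rightarrow> (plane \<Rightarrow> plane \<Rightarrow> complex) \<Rightarrow> plane \<Rightarrow> plane \<Rightarrow> complex" where
  "restrict_to E h x y = (if closed_segment x y \<subseteq> E then h x y else 0)"

lemma antisymmetric_restrict:
  assumes "antisymmetric h"
  shows "antisymmetric (restrict_to E h)"
  unfolding antisymmetric_def
proof (intro allI)
  fix x y show "restrict_to E h y x = - restrict_to E h x y"
    unfolding restrict_to_def antisymmetricD[OF assms, of y x] by (simp add: closed_segment_commute)
qed

lemma antisymmetric_diff: "antisymmetric h \<Longrightarrow> antisymmetric k \<Longrightarrow> antisymmetric (\<lambda>x y. h x y - k x y)"
  unfolding antisymmetric_def by (metis minus_diff_minus)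

lemma keys_boundary_lift:
  assumes "admissible_lift T A s" "y \<in> Poly_Mapping.keys (ordered_boundary s)"
  obtains a b c where "[a, b, c] \<in> Poly_Mapping.keys s \<or> [a, c, b] \<in> Poly_Mapping.keys s \<or> [c, a, b] \<in> Poly_Mapping.keys s" "y = [a, b]"
    "closed_segment a b \<subseteq> frontier A"
proof -
  obtain x j where x: "x \<in> Poly_Mapping.keys s" "j < length x" "y = take j x @ drop (Suc j) x"
    using keys_ordered_boundary[OF assms(2)] .
  have "length x = 3" using assms(1) x(1) by (auto simp: admissible_lift_def ordered_chains_def ordered_simplices_def)
  then obtain p q r where pqr: "x = [p, q, r]" using length3E by blast
  have hull: "convex hull (set y) \<subseteq> frontier A" using assms by (simp add: admissible_lift_def)
  consider "j = 0" | "j = 1" | "j = 2" using x(2) pqr by force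
  then show thesis
  proof cases
    case 1 then show thesis using that[of p q r] that[of q r p] x pqr hull by (simp add: segment_convex_hull)
  next
    case 2 then show thesis using that[of p r q] x pqr hull by (simp add: segment_convex_hull)
  next
    case 3 then show thesis using that[of p q r] x pqr hull by (simp add: segment_convex_hull)
  qed
qed

lemma cup_form_outer:
  assumes "admissible_lift T A s"
  shows "cup_form f g (outer_chain X s) = chain_eval (edge_fun (restrict_to (frontier (\<Union>X)) (wedge f g))) (ordered_boundary s)"
proof -
  let ?b = "ordered_boundary s" and ?E = "frontier (\<Union>X)"
  have "cup_form f g (outer_chain X s) =
    (\<Sum>y \<in> {y \<in> Poly_Mapping.keys ?b. convex hull (set y) \<subseteq> ?E}. Poly_Mapping.lookup ?b y * edge_fun (wedge f g) y)"
    by (simp add: cup_form_eq outer_chain_def Let_def chain_eval_sum)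
  also have "\<dots> = (\<Sum>y \<in> Poly_Mapping.keys ?b. Poly_Mapping.lookup ?b y * edge_fun (restrict_to ?E (wedge f g)) y)"
  proof (rule sum.mono_neutral_cong_left)
    show "\<forall>y \<in> Poly_Mapping.keys ?b - {y \<in> Poly_Mapping.keys ?b. convex hull (set y) \<subseteq> ?E}.
      Poly_Mapping.lookup ?b y * edge_fun (restrict_to ?E (wedge f g)) y = 0"
    proof
      fix y assume "y \<in> Poly_Mapping.keys ?b - {y \<in> Poly_Mapping.keys ?b. convex hull (set y) \<subseteq> ?E}"
      then have y: "y \<in> Poly_Mapping.keys ?b" "\<not> convex hull (set y) \<subseteq> ?E" by auto
      obtain a b where "y = [a, b]" using keys_boundary_lift[OF assms y(1)] by blast
      then show "Poly_Mapping.lookup ?b y * edge_fun (restrict_to ?E (wedge f g)) y = 0"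
        using y(2) by (simp add: edge_fun_def restrict_to_def segment_convex_hull)
    qed
  next
    fix y assume "y \<in> {y \<in> Poly_Mapping.keys ?b. convex hull (set y) \<subseteq> ?E}"
    then have y: "y \<in> Poly_Mapping.keys ?b" "convex hull (set y) \<subseteq> ?E" by auto
    obtain a b where "y = [a, b]" using keys_boundary_lift[OF assms y(1)] by blast
    then show "Poly_Mapping.lookup ?b y * edge_fun (wedge f g) y = Poly_Mapping.lookup ?b y * edge_fun (restrict_to ?E (wedge f g)) y"
      using y(2) by (simp add: edge_fun_def restrict_to_def segment_convex_hull)
  qed auto
  finally show ?thesis by (simp add: chain_eval_def)
qed

lemma cyclic_quasi_cocycle_eq:
  assumes "admissible_lift T A (s n)"
  shows "cyclic_quasi_cocycle X s f g n = chain_eval (edge_fun (wedge f g)) (ordered_boundary (s n))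
     - chain_eval (edge_fun (restrict_to (frontier (\<Union>X)) (wedge f g))) (ordered_boundary (s n))"
  unfolding cyclic_quasi_cocycle_def inner_chain_def
  using cup_form_outer[OF assms, of f g X] by (simp add: cup_form_eq chain_eval_diff)

section \<open>Similarities and iterated function systems\<close>

text \<open>D is the determinant of the linear part; its sign tells whether orientation is
  preserved.\<close>

definition similarity :: "real \<Rightarrow> (plane \<Rightarrow> plane) \<Rightarrow> real \<Rightarrow> bool" where
  "similarity r G D \<longleftrightarrow> r > 0 \<and> D \<noteq> 0 \<and> (\<forall>a b c. orient (G a) (G b) (G c) = D * orient a b c) \<and>
     (\<exists>L c. linear L \<and> (\<forall>x. norm (L x) = r * norm x) \<and> G = (\<lambda>x. c + L x))"

lemma similarityE:
  assumes "similarity r G D"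
  obtains L c where "linear L" "inj L" "\<And>x. norm (L x) = r * norm x" "G = (\<lambda>x. c + L x)" "r > 0"
proof -
  obtain L c where L: "linear L" "\<And>x. norm (L x) = r * norm x" "G = (\<lambda>x. c + L x)" "r > 0"
    using assms unfolding similarity_def by blast
  have "inj L"
  proof (rule injI)
    fix x y assume "L x = L y"
    then have "L (x - y) = 0" using L(1) by (simp add: linear_diff)
    then have "r * norm (x - y) = 0" using L(2)[of "x - y"] by simp
    then show "x = y" using L(4) by simp
  qed
  then show thesis using that L by blast
qed

lemma similarity_dist: "similarity r G D \<Longrightarrow> dist (G x) (G y) = r * dist x y"
  by (erule similarityE) (simp add: dist_norm linear_diff[symmetric])

lemma similarity_image:
  assumes "similarity r G D"
  obtains L c where "linear L" "inj L" "\<And>B. G ` B = (+) c ` L ` B"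
proof -
  obtain L c where L: "linear L" "inj L" "G = (\<lambda>x. c + L x)" using assms similarityE by metis
  have "G ` B = (+) c ` L ` B" for B unfolding L(3) image_image ..
  then show thesis using that L by blast
qed

lemma similarity_interior:
  assumes "similarity r G D"
  shows "interior (G ` B) = G ` interior B"
proof -
  obtain L c where L: "linear L" "inj L" "\<And>B. G ` B = (+) c ` L ` B" using similarity_image[OF assms] by metis
  show ?thesis unfolding L(3) interior_translation interior_injective_linear_image[OF L(1,2)] ..
qed

lemma similarity_hull:
  assumes "similarity r G D"
  shows "G ` (convex hull B) = convex hull (G ` B)"
proof -
  obtain L c where L: "linear L" "inj L" "\<And>B. G ` B = (+) c ` L ` B" using similarity_image[OF assms] by metis
  show ?thesis unfolding L(3) convex_hull_linear_image[OF L(1)] convex_hull_translation ..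
qed

lemma similarity_segment:
  assumes "similarity r G D"
  shows "G ` closed_segment a b = closed_segment (G a) (G b)"
  unfolding segment_convex_hull similarity_hull[OF assms] by simp

lemma similarity_ball:
  assumes "similarity r G D"
  shows "ball (G z) (r * a) \<subseteq> G ` ball z a"
proof
  fix y assume y: "y \<in> ball (G z) (r * a)"
  obtain L c where L: "linear L" "inj L" "\<And>x. norm (L x) = r * norm x" "G = (\<lambda>x. c + L x)" "r > 0"
    using similarityE[OF assms] by metis
  obtain x where x: "y - c = L x" using linear_injective_imp_surjective[OF L(1,2)] by (metis surjD)
  have "G x = y" unfolding L(4) x[symmetric] by simp
  moreover have "dist z x < a"
    using y L(5) similarity_dist[OF assms, of z x] by (simp add: \<open>G x = y\<close>)
  ultimately show "y \<in> G ` ball z a" by auto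
qed

lemma inner_eq_norms: "(v::plane) \<bullet> w = ((norm v)\<^sup>2 + (norm w)\<^sup>2 - (norm (v - w))\<^sup>2) / 2"
  by (simp add: power2_norm_eq_inner inner_diff inner_commute)

text \<open>F is known only on B. Because B contains a disc about z, the images of z and of one
  nearby point in each coordinate direction determine a linear map, and the remaining values of F
  are forced, since F scales all inner products of vectors based at z by r^2.\<close>

lemma similarity_extend:
  assumes "a > 0" "ball z a \<subseteq> B" "r > 0"
    and F: "\<And>x y. x \<in> B \<Longrightarrow> y \<in> B \<Longrightarrow> dist (F x) (F y) = r * dist x y"
  shows "\<exists>G D. similarity r G D \<and> (\<forall>x\<in>B. F x = G x)"
proof -
  define b where "b = a / 2"
  have b: "b > 0" "b < a" using assms(1) by (auto simp: b_def)
  have zB: "z \<in> B" using assms(1,2) by auto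
  define e where "e i = (axis i 1 :: plane)" for i
  have e: "norm (e i) = 1" "x \<bullet> e i = x $ i" for i x by (simp_all add: e_def norm_axis_1 inner_axis)
  define p where "p i = z + b *\<^sub>R e i" for i
  have pB: "p i \<in> B" for i using assms(2) b e by (auto simp: p_def dist_norm)
  \<comment> \<open>Polarisation: inner products are expressed through the three distances between
    x, y and z.\<close>
  have ip: "(F x - F z) \<bullet> (F y - F z) = r\<^sup>2 * ((x - z) \<bullet> (y - z))" if "x \<in> B" "y \<in> B" for x y
  proof -
    have n: "norm (F x - F z) = r * norm (x - z)" "norm (F y - F z) = r * norm (y - z)"
      "norm ((F x - F z) - (F y - F z)) = r * norm ((x - z) - (y - z))"
      using F[OF that(1) zB] F[OF that(2) zB] F[OF that] by (simp_all add: dist_norm)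
    show ?thesis unfolding inner_eq_norms[of "F x - F z"] inner_eq_norms[of "x - z"] n
      by (simp add: power_mult_distrib algebra_simps)
  qed
  define u where "u i = (1 / b) *\<^sub>R (F (p i) - F z)" for i
  have u: "u i \<bullet> u j = r\<^sup>2 * (e i \<bullet> e j)" for i j
    unfolding u_def using ip[OF pB pB, of i j] b(1) by (simp add: p_def)
  have uu: "u 1 \<bullet> u 1 = r\<^sup>2" "u 2 \<bullet> u 2 = r\<^sup>2" "u 1 \<bullet> u 2 = 0" "u 2 \<bullet> u 1 = 0"
    unfolding u by (simp_all add: e(2), simp_all add: e_def axis_def)
  define L where "L w = w $ 1 *\<^sub>R u 1 + w $ 2 *\<^sub>R u 2" for w :: plane
  have lin: "linear L" by (rule linearI) (simp_all add: L_def algebra_simps)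
  have LL: "L v \<bullet> L w = r\<^sup>2 * (v \<bullet> w)" for v w
    by (simp add: L_def inner_add uu inner_plane[of v w] algebra_simps)
  have norm: "norm (L w) = r * norm w" for w
  proof -
    have "(norm (L w))\<^sup>2 = (r * norm w)\<^sup>2" by (simp add: power2_norm_eq_inner LL power_mult_distrib)
    then show ?thesis using assms(3) by (simp add: power2_eq_iff_nonneg)
  qed
  have FL: "F x = F z + L (x - z)" if x: "x \<in> B" for x
  proof -
    let ?v = "F x - F z"
    have vu: "?v \<bullet> u i = r\<^sup>2 * ((x - z) $ i)" for i
      unfolding u_def using ip[OF x pB, of i] b(1) by (simp add: p_def e)
    have vL: "?v \<bullet> L (x - z) = r\<^sup>2 * ((x - z) \<bullet> (x - z))"
      unfolding L_def inner_add_right inner_scaleR_right vu inner_plane[of "x - z"] by (simp add: algebra_simps)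
    have "(?v - L (x - z)) \<bullet> (?v - L (x - z)) = ?v \<bullet> ?v - 2 * (?v \<bullet> L (x - z)) + L (x - z) \<bullet> L (x - z)"
      by (simp add: inner_diff inner_commute)
    also have "\<dots> = 0" unfolding vL LL ip[OF x x] by simp
    finally have "?v - L (x - z) = 0" by (simp only: inner_eq_zero_iff)
    then show ?thesis by (simp add: algebra_simps)
  qed
  define D where "D = u 1 $ 1 * u 2 $ 2 - u 1 $ 2 * u 2 $ 1"
  \<comment> \<open>The Gram determinant of the images of the basis vectors; it gives D^2 = r^4 and
    leaves the sign open.\<close>
  have "D\<^sup>2 = (u 1 \<bullet> u 1) * (u 2 \<bullet> u 2) - (u 1 \<bullet> u 2)\<^sup>2"
    by (simp add: D_def inner_plane power2_eq_square algebra_simps)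
  then have "D\<^sup>2 = r\<^sup>2 * r\<^sup>2" unfolding uu by simp
  then have "D \<noteq> 0" using assms(3) by auto
  define c where "c = F z - L z"
  define G where "G x = c + L x" for x
  have "orient (G x) (G y) (G w) = D * orient x y w" for x y w
    by (simp add: orient_def G_def L_def D_def algebra_simps)
  then have "similarity r G D"
    unfolding similarity_def using \<open>D \<noteq> 0\<close> assms(3) lin norm G_def by blast
  moreover have "F x = G x" if "x \<in> B" for x
    using FL[OF that] linear_diff[OF lin, of x z] by (simp add: G_def c_def)
  ultimately show ?thesis by blast
qed

lemma disjoint_balls_card:
  fixes z :: "'b \<Rightarrow> plane"
  assumes "finite I" "\<rho> > 0" "R > 0" "\<And>i. i \<in> I \<Longrightarrow> ball (z i) \<rho> \<subseteq> ball u R"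
    and "\<And>i j. i \<in> I \<Longrightarrow> j \<in> I \<Longrightarrow> i \<noteq> j \<Longrightarrow> ball (z i) \<rho> \<inter> ball (z j) \<rho> = {}"
  shows "real (card I) * \<rho>\<^sup>2 \<le> R\<^sup>2"
proof -
  define V where "V = measure lborel (ball (0::plane) 1)"
  have V: "V > 0" unfolding V_def by (rule content_ball_pos) simp
  have c: "measure lborel (ball (x::plane) s) = s\<^sup>2 * V" if "s > 0" for x s
    unfolding V_def using content_ball_conv_unit_ball[of s x] that by simp
  have fin: "emeasure lborel (ball (x::plane) s) \<noteq> \<infinity>" for x s
    using emeasure_lborel_ball_finite[of x s] by auto
  have "real (card I) * (\<rho>\<^sup>2 * V) = (\<Sum>i\<in>I. measure lborel (ball (z i) \<rho>))"
    using c[OF assms(2)] by simp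
  also have "\<dots> = measure lborel (\<Union>i\<in>I. ball (z i) \<rho>)"
    by (rule measure_finite_Union[symmetric])
      (use assms(1,5) fin in \<open>auto simp: disjoint_family_on_def\<close>)
  also have "\<dots> \<le> measure lborel (ball u R)"
  proof (rule measure_mono_fmeasurable)
    show "(\<Union>i\<in>I. ball (z i) \<rho>) \<subseteq> ball u R" using assms(4) by blast
    show "(\<Union>i\<in>I. ball (z i) \<rho>) \<in> sets lborel" by (auto intro!: borel_open open_UN)
    show "ball u R \<in> fmeasurable lborel"
      using emeasure_lborel_ball_finite[of u R] by (auto simp: fmeasurable_def)
  qed
  also have "\<dots> = R\<^sup>2 * V" using c[OF assms(3)] .
  finally show ?thesis using V by simp
qed

section \<open>Words, their maps and the pieces of |X|\<close>

lemma word_map_Nil [simp]: "word_map F [] = id"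
  by (simp add: word_map_def)

lemma word_map_Cons: "word_map F (j # w) x = F j (word_map F w x)"
  by (simp add: word_map_def)

lemma word_map_append: "word_map F (u @ v) x = word_map F u (word_map F v x)"
  by (induction u) (simp_all add: word_map_Cons)

lemma words_0 [simp]: "words S 0 = {[]}"
  by (auto simp: words_def)

lemma words_Suc: "words S (Suc n) = (\<lambda>(j, w). j # w) ` (S \<times> words S n)"
proof
  show "words S (Suc n) \<subseteq> (\<lambda>(j, w). j # w) ` (S \<times> words S n)"
  proof
    fix v assume v: "v \<in> words S (Suc n)"
    then obtain j w where "v = j # w" by (cases v) (auto simp: words_def)
    then have "v = (\<lambda>(j, w). j # w) (j, w)" "(j, w) \<in> S \<times> words S n" using v by (auto simp: words_def)
    then show "v \<in> (\<lambda>(j, w). j # w) ` (S \<times> words S n)" by (rule image_eqI)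
  qed
qed (auto simp: words_def)

lemma finite_words: "finite S \<Longrightarrow> finite (words S n)"
  by (induction n) (auto simp: words_Suc)

lemma sum_words_Suc:
  fixes f :: "'i list \<Rightarrow> real"
  shows "(\<Sum>w\<in>words S (Suc n). f w) = (\<Sum>j\<in>S. \<Sum>w\<in>words S n. f (j # w))"
proof -
  have "inj_on (\<lambda>(j, w). j # w) (S \<times> words S n)" by (auto simp: inj_on_def)
  then show ?thesis
    unfolding words_Suc by (simp add: sum.reindex sum.cartesian_product case_prod_unfold)
qed

locale cellular_ifs =
  fixes X :: "plane set set" and S :: "'i set" and F :: "'i \<Rightarrow> plane \<Rightarrow> plane" and K :: "plane set"
  assumes struct: "cellular_self_similar_structure X S F"
    and card_S: "card S \<ge> 2"
    and attractor: "cellular_self_similar_set X S F K"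
begin

definition A :: "plane set" where "A = \<Union>X"

definition rat :: "'i \<Rightarrow> real" where
  "rat j = (SOME r. 0 < r \<and> r \<le> 1 \<and> (\<forall>x\<in>A. \<forall>y\<in>A. dist (F j x) (F j y) = r * dist x y))"

definition wr :: "'i list \<Rightarrow> real" where
  "wr w = prod_list (map rat w)"

lemma finite_S: "finite S"
  using struct by (simp add: cellular_self_similar_structure_def)

lemma complex_X: "finite X" "c \<in> X \<Longrightarrow> polytope c" "c \<in> X \<Longrightarrow> c \<noteq> {}"
  using struct by (auto simp: cellular_self_similar_structure_def convex_cell_complex_def)

lemma compact_A: "compact A"
  unfolding A_def using complex_X by (intro compact_Union polytope_imp_compact) auto

lemma interior_A: "interior A \<noteq> {}"
proof -
  obtain c where c: "c \<in> X" "aff_dim c = 2"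
    using struct by (auto simp: cellular_self_similar_structure_def two_dimensional_def)
  have "interior c = rel_interior c" using c(2) by (simp add: interior_rel_interior_gen)
  moreover have "rel_interior c \<noteq> {}"
    using rel_interior_eq_empty[OF polytope_imp_convex[OF complex_X(2)[OF c(1)]]] complex_X(3)[OF c(1)] by simp
  moreover have "interior c \<subseteq> interior A" unfolding A_def using c(1) by (intro interior_mono) auto
  ultimately show ?thesis by auto
qed

lemma A_ball: obtains z a where "a > 0" "ball z a \<subseteq> A"
  using interior_A by (metis ex_in_conv mem_interior)

lemma rat:
  assumes "j \<in> S"
  shows "0 < rat j" "rat j \<le> 1" "x \<in> A \<Longrightarrow> y \<in> A \<Longrightarrow> dist (F j x) (F j y) = rat j * dist x y"
proof -
  have "\<exists>r. 0 < r \<and> r \<le> 1 \<and> (\<forall>x\<in>A. \<forall>y\<in>A. dist (F j x) (F j y) = r * dist x y)"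
    using struct assms by (simp add: cellular_self_similar_structure_def similitude_on_def A_def)
  from someI_ex[OF this] have "0 < rat j \<and> rat j \<le> 1 \<and> (\<forall>x\<in>A. \<forall>y\<in>A. dist (F j x) (F j y) = rat j * dist x y)"
    unfolding rat_def .
  then show "0 < rat j" "rat j \<le> 1" "x \<in> A \<Longrightarrow> y \<in> A \<Longrightarrow> dist (F j x) (F j y) = rat j * dist x y"
    by blast+
qed

lemma F_into: "j \<in> S \<Longrightarrow> F j ` A \<subseteq> A"
  using struct by (simp add: cellular_self_similar_structure_def similitude_on_def A_def)

lemma wr_simps [simp]: "wr [] = 1" "wr (j # w) = rat j * wr w"
  by (simp_all add: wr_def)

lemma wr_append: "wr (u @ v) = wr u * wr v"
  by (simp add: wr_def)

lemma wr_bounds: "set w \<subseteq> S \<Longrightarrow> 0 < wr w \<and> wr w \<le> 1"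
proof (induction w)
  case (Cons j w)
  then have "0 < rat j" "rat j \<le> 1" "0 < wr w" "wr w \<le> 1" using rat by auto
  then show ?case by (simp add: mult_le_one)
qed simp

lemma word_into: "set w \<subseteq> S \<Longrightarrow> word_map F w ` A \<subseteq> A"
proof (induction w)
  case (Cons j w)
  then have "F j ` word_map F w ` A \<subseteq> A" using F_into by (meson image_mono list.set_intros(1) set_subset_Cons subset_code(1) subset_trans)
  then show ?case by (simp add: word_map_Cons image_image)
qed simp

lemma word_dist:
  assumes "set w \<subseteq> S" "x \<in> A" "y \<in> A"
  shows "dist (word_map F w x) (word_map F w y) = wr w * dist x y"
  using assms(1)
proof (induction w)
  case (Cons j w)
  then have j: "j \<in> S" and w: "set w \<subseteq> S" by auto
  have "word_map F w x \<in> A" "word_map F w y \<in> A" using word_into[OF w] assms by auto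
  then show ?case using rat(3)[OF j] Cons.IH[OF w] by (simp add: word_map_Cons)
qed simp

lemma word_similarity:
  assumes "set w \<subseteq> S"
  obtains G D where "similarity (wr w) G D" "\<And>x. x \<in> A \<Longrightarrow> word_map F w x = G x"
proof -
  obtain z a where "a > 0" "ball z a \<subseteq> A" using A_ball .
  from similarity_extend[OF this, of "wr w" "word_map F w"] show thesis
    using that word_dist[OF assms] wr_bounds[OF assms] by blast
qed

lemma word_inj: "set w \<subseteq> S \<Longrightarrow> inj_on (word_map F w) A"
  by (rule inj_onI) (metis dist_eq_0_iff mult_eq_0_iff order_less_irrefl word_dist wr_bounds)

lemma word_interior:
  assumes "set w \<subseteq> S" "B \<subseteq> A"
  shows "interior (word_map F w ` B) = word_map F w ` interior B"
proof -
  obtain G D where G: "similarity (wr w) G D" "\<And>x. x \<in> A \<Longrightarrow> word_map F w x = G x"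
    using word_similarity[OF assms(1)] by blast
  have eq: "word_map F w ` C = G ` C" if "C \<subseteq> A" for C using G(2) that by (intro image_cong) auto
  have "interior B \<subseteq> A" using assms(2) interior_subset by blast
  then show ?thesis using eq[OF assms(2)] eq similarity_interior[OF G(1)] by metis
qed

text \<open>For words neither of which is a prefix of the other, the condition on interiors applies
  at the first letter where they differ. The common prefix acts injectively and commutes with taking
  interiors.\<close>

lemma word_disjoint:
  assumes "set w \<subseteq> S" "set v \<subseteq> S" "\<nexists>u. v = w @ u" "\<nexists>u. w = v @ u"
  shows "interior (word_map F w ` A) \<inter> interior (word_map F v ` A) = {}"
  using assms
proof (induction w arbitrary: v)
  case Nil then show ?case by simp
next
  case (Cons i w)
  obtain j v' where v: "v = j # v'" using Cons.prems(4) by (cases v) auto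
  have ij: "i \<in> S" "j \<in> S" "set w \<subseteq> S" "set v' \<subseteq> S" using Cons.prems v by auto
  have im: "word_map F (k # u) ` A = F k ` word_map F u ` A" for k u by (simp add: word_map_Cons image_image)
  have sub: "word_map F (k # u) ` A \<subseteq> F k ` A" if "set u \<subseteq> S" for k u
    unfolding im using word_into[OF that] by (rule image_mono)
  show ?case
  proof (cases "i = j")
    case False
    then have "interior (F i ` A) \<inter> interior (F j ` A) = {}"
      using struct ij by (simp add: cellular_self_similar_structure_def A_def)
    then show ?thesis unfolding v
      using interior_mono[OF sub[OF ij(3), of i]] interior_mono[OF sub[OF ij(4), of j]] by blast
  next
    case True
    have "interior (word_map F w ` A) \<inter> interior (word_map F v' ` A) = {}"
      using Cons.prems ij by (intro Cons.IH) (auto simp: v True)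
    moreover have i: "set [i] \<subseteq> S" using ij by simp
    have e: "word_map F [i] = F i" by (simp add: word_map_def)
    have "interior (F i ` word_map F u ` A) = F i ` interior (word_map F u ` A)" "interior (word_map F u ` A) \<subseteq> A" if "set u \<subseteq> S" for u
      using word_interior[OF i word_into[OF that]] word_into[OF that] interior_subset unfolding e by blast+
    ultimately show ?thesis
      unfolding v True[symmetric] im using word_inj[OF i] ij(3,4) unfolding e
      by (metis image_empty inj_on_image_Int)
  qed
qed

text \<open>Every piece contains a disc of radius \<open>t * a\<close> around the image of z. These
  discs are disjoint, as no word is a prefix of another, so comparing areas with the large disc
  bounds their number.\<close>

lemma word_card:
  assumes "finite I" "ball z a \<subseteq> A" "a > 0" "t > 0" "R > 0"
    and I: "\<And>w. w \<in> I \<Longrightarrow> set w \<subseteq> S \<and> t \<le> wr w \<and> word_map F w ` A \<subseteq> ball x R"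
    and inc: "\<And>v w. v \<in> I \<Longrightarrow> w \<in> I \<Longrightarrow> v \<noteq> w \<Longrightarrow> \<nexists>u. w = v @ u"
  shows "real (card I) * (t * a)\<^sup>2 \<le> R\<^sup>2"
proof (rule disjoint_balls_card[OF assms(1)])
  have sub: "ball (word_map F w z) (t * a) \<subseteq> interior (word_map F w ` A)" if w: "w \<in> I" for w
  proof -
    obtain G D where G: "similarity (wr w) G D" "\<And>x. x \<in> A \<Longrightarrow> word_map F w x = G x"
      using word_similarity I[OF w] by blast
    have zA: "z \<in> A" using assms(2,3) by auto
    have "ball (G z) (t * a) \<subseteq> ball (G z) (wr w * a)" using I[OF w] assms(3) by (intro subset_ball) simp
    also have "\<dots> \<subseteq> G ` ball z a" by (rule similarity_ball[OF G(1)])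
    also have "\<dots> = word_map F w ` ball z a" using G(2) assms(2) by (intro image_cong) auto
    also have "\<dots> \<subseteq> word_map F w ` A" using assms(2) by (rule image_mono)
    finally show ?thesis unfolding G(2)[OF zA] by (simp add: interior_maximal)
  qed
  show "ball (word_map F w z) (t * a) \<subseteq> ball x R" if "w \<in> I" for w
    using sub[OF that] I[OF that] interior_subset by blast
  show "ball (word_map F v z) (t * a) \<inter> ball (word_map F w z) (t * a) = {}" if "v \<in> I" "w \<in> I" "v \<noteq> w" for v w
    using sub that word_disjoint[of v w] I[of v] I[of w] inc[of v w] inc[of w v] by blast
qed (use assms in auto)

lemma A_bounded: obtains R x where "R > 0" "A \<subseteq> ball x R"
  using compact_A by (metis bounded_subset_ballD compact_imp_bounded)

lemma rat_less_1:
  assumes j: "j \<in> S"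
  shows "rat j < 1"
proof (rule ccontr)
  assume "\<not> rat j < 1"
  then have r1: "rat j = 1" using rat(2)[OF j] by simp
  have "S - {j} \<noteq> {}" using card_S finite_S by (metis Diff_eq_empty_iff card_mono card.empty card.insert finite.emptyI finite.insertI empty_iff not_less_eq_eq numeral_2_eq_2)
  then obtain i where i: "i \<in> S" "i \<noteq> j" by blast
  obtain z a where a: "a > 0" "ball z a \<subseteq> A" using A_ball .
  obtain R x where R: "R > 0" "A \<subseteq> ball x R" using A_bounded .
  define w where "w k = replicate k j @ [i]" for k
  have wS: "set (w k) \<subseteq> S" for k using i j by (auto simp: w_def)
  have wrw: "wr (w k) = rat i" for k by (induction k) (simp_all add: w_def r1)
  have inc: "k = l" if "w l = w k @ u" for k l u
  proof -
    have "k \<le> l" using arg_cong[OF that, of length] by (simp add: w_def)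
    moreover have "w l ! k = i" using that by (simp add: w_def nth_append)
    ultimately show ?thesis using i(2) by (auto simp: w_def nth_append split: if_splits)
  qed
  have inj: "inj w" by (rule injI) (metis append_Nil2 inc)
  have bound: "real N * (rat i * a)\<^sup>2 \<le> R\<^sup>2" for N
  proof -
    have "real (card (w ` {..<N})) * (rat i * a)\<^sup>2 \<le> R\<^sup>2"
    proof (rule word_card[OF _ a(2,1) _ R(1)])
      show "set v \<subseteq> S \<and> rat i \<le> wr v \<and> word_map F v ` A \<subseteq> ball x R" if v: "v \<in> w ` {..<N}" for v
      proof -
        obtain k where k: "v = w k" using v by blast
        show ?thesis
          using wS[of k] wrw[of k] subset_trans[OF word_into[OF wS, of k] R(2)] unfolding k by simp
      qed
      show "\<nexists>u. v' = v @ u" if "v \<in> w ` {..<N}" "v' \<in> w ` {..<N}" "v \<noteq> v'" for v v'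
        using that inc by (metis imageE)
    qed (use rat[OF i(1)] in auto)
    then show ?thesis using inj by (simp add: card_image inj_on_subset)
  qed
  have pos: "(rat i * a)\<^sup>2 > 0" using rat[OF i(1)] a by simp
  obtain N where "R\<^sup>2 / (rat i * a)\<^sup>2 < real N" using reals_Archimedean2 by blast
  then have "R\<^sup>2 < real N * (rat i * a)\<^sup>2" using pos by (simp add: pos_divide_less_eq)
  then show False using bound[of N] by simp
qed

end

section \<open>Moran's bound\<close>

text \<open>The sets of a cover need not be open and may have diameter 0. Each is replaced by an
  open ball whose radius to the power s exceeds the gauge by \<open>\<eta> i\<close>. These excesses
  sum to half of \<epsilon>, and compactness leaves finitely many balls.\<close>

lemma compact_cover_of_null:
  fixes K :: "plane set"
  assumes "compact K" "s > 0" "hausdorff_measure s K = 0" "\<epsilon> > 0"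
  obtains I :: "nat set" and u \<rho> where "finite I" "K \<subseteq> (\<Union>i\<in>I. ball (u i) (\<rho> i))"
    "\<And>i. \<rho> i > 0" "(\<Sum>i\<in>I. \<rho> i powr s) < \<epsilon>"
proof -
  have "hausdorff_premeasure 1 s K \<le> hausdorff_measure s K"
    unfolding hausdorff_measure_def by (rule SUP_upper) simp
  then have "hausdorff_premeasure 1 s K < ennreal (\<epsilon> / 2)" using assms(3,4) by (simp add: le_zero_eq)
  then obtain U where U: "K \<subseteq> (\<Union>i. U i)" "\<And>i::nat. bounded (U i)"
      and lt: "suminf (\<lambda>i. hausdorff_gauge s (U i)) < ennreal (\<epsilon> / 2)"
    unfolding hausdorff_premeasure_def INF_less_iff by blast
  define d where "d i = diameter (U i) powr s" for i
  define \<eta> where "\<eta> i = \<epsilon> / 2 * (1/2) ^ Suc i" for i :: nat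
  have \<eta>: "\<eta> i > 0" for i using assms(4) by (simp add: \<eta>_def)
  have \<eta>_sums: "\<eta> sums (\<epsilon> / 2)" unfolding \<eta>_def using sums_mult[OF power_half_series, of "\<epsilon> / 2"] by simp
  have d0: "d i \<ge> 0" for i by (simp add: d_def)
  have gauge: "hausdorff_gauge s (U i) = ennreal (d i)" for i
    using assms(2) by (auto simp: hausdorff_gauge_def d_def)
  define \<rho> where "\<rho> i = (d i + \<eta> i) powr (1 / s)" for i
  have dpos: "d i + \<eta> i > 0" for i using d0[of i] \<eta>[of i] by simp
  have \<rho>0: "\<rho> i > 0" for i using dpos[of i] by (simp add: \<rho>_def)
  have \<rho>s: "\<rho> i powr s = d i + \<eta> i" for i
    using assms(2) dpos[of i] by (simp add: \<rho>_def powr_powr)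
  have diam: "diameter (U i) < \<rho> i" for i
  proof (rule ccontr)
    assume "\<not> diameter (U i) < \<rho> i"
    then have "\<rho> i powr s \<le> d i" unfolding d_def using \<rho>0[of i] assms(2) by (intro powr_mono2) auto
    then show False using \<rho>s[of i] \<eta>[of i] by simp
  qed
  define u where "u i = (SOME x. x \<in> U i)" for i
  have sub: "U i \<subseteq> ball (u i) (\<rho> i)" for i
  proof
    fix x assume x: "x \<in> U i"
    then have "u i \<in> U i" unfolding u_def by (rule someI)
    then have "dist (u i) x \<le> diameter (U i)" using x U(2) diameter_bounded_bound by blast
    then show "x \<in> ball (u i) (\<rho> i)" using diam[of i] by simp
  qed
  have cov: "K \<subseteq> (\<Union>i\<in>UNIV. ball (u i) (\<rho> i))" using U(1) sub by blast
  obtain I where I: "finite I" "K \<subseteq> (\<Union>i\<in>I. ball (u i) (\<rho> i))"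
    using compactE_image[OF assms(1) _ cov] by auto
  have "ennreal (\<Sum>i\<in>I. d i) = (\<Sum>i\<in>I. hausdorff_gauge s (U i))"
    unfolding gauge using d0 by (simp add: sum_ennreal)
  also have "\<dots> \<le> suminf (\<lambda>i. hausdorff_gauge s (U i))" by (rule sum_le_suminf) (use I in auto)
  finally have "(\<Sum>i\<in>I. d i) < \<epsilon> / 2"
    using lt d0 by (metis ennreal_less_iff le_less_trans sum_nonneg)
  moreover have "(\<Sum>i\<in>I. \<eta> i) \<le> \<epsilon> / 2"
    using sum_le_suminf[OF sums_summable[OF \<eta>_sums] I(1)] \<eta> sums_unique[OF \<eta>_sums] by (simp add: less_imp_le)
  ultimately have "(\<Sum>i\<in>I. \<rho> i powr s) < \<epsilon>" unfolding \<rho>s by (simp add: sum.distrib)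
  then show thesis using that I \<rho>0 by blast
qed

text \<open>For exponent 0 each non-empty set costs 1, so a cover of total cost below 1 has only
  empty members. This settles the exponent that Moran's bound below leaves out.\<close>

lemma hausdorff_measure_0:
  assumes "hausdorff_measure 0 K = 0"
  shows "K = {}"
proof -
  have "hausdorff_premeasure 1 0 K \<le> hausdorff_measure 0 K"
    unfolding hausdorff_measure_def by (rule SUP_upper) simp
  then have "hausdorff_premeasure 1 0 K < 1" using assms by (simp add: le_zero_eq)
  then obtain U where U: "K \<subseteq> (\<Union>i. U i)" and lt: "suminf (\<lambda>i::nat. hausdorff_gauge 0 (U i)) < 1"
    unfolding hausdorff_premeasure_def INF_less_iff by blast
  have "U i = {}" for i
  proof (rule ccontr)
    assume "U i \<noteq> {}"
    then have "1 = (\<Sum>j\<in>{i}. hausdorff_gauge 0 (U j))" by (simp add: hausdorff_gauge_def)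
    also have "\<dots> \<le> suminf (\<lambda>j. hausdorff_gauge 0 (U j))" by (rule sum_le_suminf) auto
    finally show False using lt by simp
  qed
  then show ?thesis using U by simp
qed

lemma sum_UN_le:
  fixes p :: "'b \<Rightarrow> real"
  assumes "finite I" "\<And>i. i \<in> I \<Longrightarrow> finite (Q i)" "\<And>x. p x \<ge> 0"
  shows "sum p (\<Union>i\<in>I. Q i) \<le> (\<Sum>i\<in>I. sum p (Q i))"
  using assms(1,2)
proof (induction I rule: finite_induct)
  case (insert i I)
  have "sum p (Q i \<union> (\<Union>i\<in>I. Q i)) \<le> sum p (Q i) + sum p (\<Union>i\<in>I. Q i)"
    using sum_Un[of "Q i" "\<Union>i\<in>I. Q i" p] insert assms(3) by (simp add: sum_nonneg)
  moreover have "sum p (\<Union>i\<in>I. Q i) \<le> (\<Sum>i\<in>I. sum p (Q i))" using insert by simp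
  ultimately show ?case using insert.hyps by simp
qed simp

lemma sum_words_prod:
  fixes p :: "'i \<Rightarrow> real"
  shows "(\<Sum>w\<in>words S n. prod_list (map p w)) = (\<Sum>j\<in>S. p j) ^ n"
proof (induction n)
  case (Suc n)
  then show ?case unfolding sum_words_Suc by (simp add: sum_distrib_left[symmetric] sum_distrib_right)
qed simp

text \<open>A Kraft-type inequality: a finite set of words containing a prefix of every sufficiently long
  word has total weight at least 1.\<close>

lemma kraft_cover:
  fixes p :: "'i \<Rightarrow> real"
  assumes "finite S" "\<And>j. p j \<ge> 0" "(\<Sum>j\<in>S. p j) \<ge> 1" "finite Q"
    and "\<And>v. v \<in> words S n \<Longrightarrow> \<exists>u t. v = u @ t \<and> u \<in> Q"
  shows "(\<Sum>w\<in>Q. prod_list (map p w)) \<ge> 1"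
  using assms(4,5)
proof (induction n arbitrary: Q)
  case 0
  have nn: "prod_list (map p w) \<ge> 0" for w by (induction w) (simp_all add: assms(2))
  have "[] \<in> Q" using 0(2)[of "[]"] by simp
  then have "prod_list (map p []) \<le> (\<Sum>w\<in>Q. prod_list (map p w))"
    using 0(1) nn by (intro member_le_sum) auto
  then show ?case by simp
next
  case (Suc n)
  have nn: "prod_list (map p w) \<ge> 0" for w by (induction w) (simp_all add: assms(2))
  show ?case
  proof (cases "[] \<in> Q")
    case True
    then have "prod_list (map p []) \<le> (\<Sum>w\<in>Q. prod_list (map p w))"
      using Suc.prems(1) nn by (intro member_le_sum) auto
    then show ?thesis by simp
  next
    case False
    \<comment> \<open>The words of Q beginning with j, without that letter, form a covering set for
      words of length n. As [] is not in Q, the different j account for disjoint parts of Q.\<close>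
    define R where "R j = {u. j # u \<in> Q}" for j
    have finR: "finite (R j)" for j
    proof -
      have "(#) j ` R j \<subseteq> Q" by (auto simp: R_def)
      then show ?thesis using Suc.prems(1) by (metis finite_imageD finite_subset inj_on_Cons1)
    qed
    have IH: "(\<Sum>u\<in>R j. prod_list (map p u)) \<ge> 1" if j: "j \<in> S" for j
    proof (rule Suc.IH[OF finR])
      fix v assume v: "v \<in> words S n"
      then have "j # v \<in> words S (Suc n)" using j by (auto simp: words_def)
      then obtain u t where ut: "j # v = u @ t" "u \<in> Q" using Suc.prems(2) by blast
      then obtain u' where "u = j # u'" using False by (cases u) auto
      then show "\<exists>u t. v = u @ t \<and> u \<in> R j" using ut by (auto simp: R_def)
    qed
    have "1 \<le> (\<Sum>j\<in>S. p j)" by (rule assms(3))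
    also have "\<dots> \<le> (\<Sum>j\<in>S. p j * (\<Sum>u\<in>R j. prod_list (map p u)))"
    proof (rule sum_mono)
      fix j assume "j \<in> S"
      from mult_left_mono[OF IH[OF this] assms(2)[of j]]
      show "p j \<le> p j * (\<Sum>u\<in>R j. prod_list (map p u))" by simp
    qed
    also have "\<dots> = (\<Sum>x\<in>Sigma S R. prod_list (map p (fst x # snd x)))"
      using finR assms(1) by (simp add: sum_distrib_left sum.Sigma case_prod_unfold)
    also have "\<dots> = (\<Sum>w\<in>(\<lambda>x. fst x # snd x) ` Sigma S R. prod_list (map p w))"
      by (subst sum.reindex) (auto simp: inj_on_def)
    also have "\<dots> \<le> (\<Sum>w\<in>Q. prod_list (map p w))"
      using Suc.prems(1) nn by (intro sum_mono2) (auto simp: R_def)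
    finally show ?thesis .
  qed
qed

section \<open>Moran sums of the contraction ratios\<close>

context cellular_ifs
begin

lemma S_ne: "S \<noteq> {}"
  using card_S by auto

lemma rat_range: obtains c C where "0 < c" "C < 1" "0 < C" "\<And>j. j \<in> S \<Longrightarrow> c \<le> rat j \<and> rat j \<le> C"
proof -
  have fin: "finite (rat ` S)" "rat ` S \<noteq> {}" using finite_S S_ne by auto
  have "Min (rat ` S) \<in> rat ` S" "Max (rat ` S) \<in> rat ` S" using Min_in[OF fin] Max_in[OF fin] by blast+
  then have "0 < Min (rat ` S)" "Max (rat ` S) < 1" "0 < Max (rat ` S)" using rat rat_less_1 by force+
  moreover have "Min (rat ` S) \<le> rat j \<and> rat j \<le> Max (rat ` S)" if "j \<in> S" for j
    using fin that by simp
  ultimately show thesis using that by blast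
qed

lemma wr_le_power:
  assumes "0 < C" "\<And>j. j \<in> S \<Longrightarrow> rat j \<le> C" "set w \<subseteq> S"
  shows "wr w \<le> C ^ length w"
  using assms(3)
proof (induction w)
  case (Cons j w)
  then have "rat j * wr w \<le> C * C ^ length w"
    using assms(1,2) rat(1)[of j] wr_bounds[of w] by (intro mult_mono) auto
  then show ?case by simp
qed simp

lemma A_diameter: obtains D where "D > 0" "\<And>x y. x \<in> A \<Longrightarrow> y \<in> A \<Longrightarrow> dist x y \<le> D"
proof -
  obtain R x where R: "R > 0" "A \<subseteq> ball x R" using A_bounded .
  have "dist y z \<le> 2 * R" if "y \<in> A" "z \<in> A" for y z
  proof -
    have "dist x y < R" "dist x z < R" using that R by auto
    then show ?thesis using dist_triangle3[of y z x] by linarith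
  qed
  then show thesis using that[of "2 * R"] R(1) by simp
qed

lemma K_facts: "compact K" "K \<noteq> {}" "K \<subseteq> A"
  using attractor by (auto simp: cellular_self_similar_set_def A_def)

lemma word_K: "set w \<subseteq> S \<Longrightarrow> x \<in> K \<Longrightarrow> word_map F w x \<in> K"
proof (induction w)
  case (Cons j w)
  have eq: "K = (\<Union>j\<in>S. F j ` K)" using attractor by (simp add: cellular_self_similar_set_def)
  have "word_map F w x \<in> K" "j \<in> S" using Cons by auto
  then have "F j (word_map F w x) \<in> (\<Union>j\<in>S. F j ` K)" by blast
  then show ?case using eq by (simp add: word_map_Cons)
qed simp

lemma wr_powr: "set w \<subseteq> S \<Longrightarrow> wr w powr s = prod_list (map (\<lambda>j. rat j powr s) w)"
proof (induction w)
  case (Cons j w) then show ?case by (simp add: powr_mult)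
qed simp

lemma sum_wr_powr: "(\<Sum>w\<in>words S n. wr w powr s) = (\<Sum>j\<in>S. rat j powr s) ^ n"
  unfolding sum_words_prod[symmetric] by (rule sum.cong[OF refl]) (simp add: words_def wr_powr)

text \<open>The lower bound in Moran's formula. The words whose pieces have size comparable to a covering set and
  meet it are boundedly many, by the disjointness of the interiors.\<close>

lemma moran:
  assumes s: "s > 0" and null: "hausdorff_measure s K = 0"
  shows "(\<Sum>j\<in>S. rat j powr s) < 1"
proof (rule ccontr)
  assume "\<not> (\<Sum>j\<in>S. rat j powr s) < 1"
  then have ge1: "(\<Sum>j\<in>S. rat j powr s) \<ge> 1" by simp
  obtain z a where a: "a > 0" "ball z a \<subseteq> A" using A_ball .
  obtain D where D: "D > 0" "\<And>x y. x \<in> A \<Longrightarrow> y \<in> A \<Longrightarrow> dist x y \<le> D" using A_diameter by blast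
  obtain c C where cC: "0 < c" "C < 1" "0 < C" "\<And>j. j \<in> S \<Longrightarrow> c \<le> rat j \<and> rat j \<le> C" using rat_range by blast
  \<comment> \<open>The area bound for the number of stopping words of one ball: large discs have
    radius (2 + D) \<rho>, the disjoint small ones c \<rho> a.\<close>
  define M where "M = ((2 + D) / (c * a))\<^sup>2"
  have M: "M > 0" unfolding M_def using D(1) cC(1) a(1) by simp
  \<comment> \<open>\<epsilon> \<le> 1 forces all radii below 1, so that the empty word is never
    stopped; M \<epsilon> \<le> 1 produces the contradiction with the Kraft inequality.\<close>
  define \<epsilon> where "\<epsilon> = min 1 (1 / M)"
  have \<epsilon>: "\<epsilon> > 0" "\<epsilon> \<le> 1" "M * \<epsilon> \<le> 1" using M by (auto simp: \<epsilon>_def min_def field_simps)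
  obtain I :: "nat set" and u \<rho> where I: "finite I" "K \<subseteq> (\<Union>i\<in>I. ball (u i) (\<rho> i))"
    and \<rho>0: "\<And>i. \<rho> i > 0" and sum\<rho>: "(\<Sum>i\<in>I. \<rho> i powr s) < \<epsilon>"
    using compact_cover_of_null[OF K_facts(1) s null \<epsilon>(1)] by metis
  have \<rho>1: "\<rho> i < 1" if "i \<in> I" for i
  proof (rule ccontr)
    assume "\<not> \<rho> i < 1"
    then have "1 \<le> \<rho> i powr s" using s by (simp add: ge_one_powr_ge_zero)
    also have "\<dots> \<le> (\<Sum>i\<in>I. \<rho> i powr s)" using I(1) that by (intro member_le_sum) auto
    finally show False using sum\<rho> \<epsilon>(2) by simp
  qed
  have lim: "(\<lambda>n. C ^ n) \<longlonglongrightarrow> 0" using cC(2,3) by (intro LIMSEQ_realpow_zero) simp_all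
  have "\<forall>i\<in>I. \<forall>\<^sub>F n in sequentially. C ^ n < \<rho> i"
    using order_tendstoD(2)[OF lim \<rho>0] by blast
  then have "\<forall>\<^sub>F n in sequentially. \<forall>i\<in>I. C ^ n < \<rho> i"
    by (rule eventually_ball_finite[OF I(1)])
  then obtain N where N: "\<And>i. i \<in> I \<Longrightarrow> C ^ N < \<rho> i" unfolding eventually_sequentially by blast
  \<comment> \<open>Words stopped at the first prefix whose ratio is at most
    \<open>\<rho> i\<close>. Their ratios lie between \<open>c * \<rho> i\<close> and
    \<open>\<rho> i\<close>, so these pieces are comparable in size to the ball they meet.\<close>
  define Q where "Q i = {w. set w \<subseteq> S \<and> w \<noteq> [] \<and> wr w \<le> \<rho> i \<and> \<rho> i < wr (butlast w) \<and>
    word_map F w ` K \<inter> ball (u i) (\<rho> i) \<noteq> {}}" for i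
  have finQ: "finite (Q i)" if i: "i \<in> I" for i
  proof (rule finite_subset)
    show "Q i \<subseteq> (\<Union>n\<le>N. words S n)"
    proof
      fix w assume w: "w \<in> Q i"
      then have "set (butlast w) \<subseteq> S" by (auto simp: Q_def dest: in_set_butlastD)
      then have "wr (butlast w) \<le> C ^ (length w - 1)"
        using wr_le_power[OF cC(3), of "butlast w"] cC(4) by simp
      then have lt: "C ^ N < C ^ (length w - 1)" using N[OF i] w by (auto simp: Q_def)
      have "length w - 1 < N"
      proof (rule ccontr)
        assume "\<not> length w - 1 < N"
        then have "C ^ (length w - 1) \<le> C ^ N" using cC(2,3) by (intro power_decreasing) auto
        then show False using lt by simp
      qed
      then show "w \<in> (\<Union>n\<le>N. words S n)" using w by (auto simp: words_def Q_def)
    qed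
  qed (use finite_words[OF finite_S] in auto)
  have cardQ: "real (card (Q i)) \<le> M" if i: "i \<in> I" for i
  proof -
    \<comment> \<open>The piece has a point in the ball and diameter at most
      \<open>\<rho> i * D\<close>, hence lies in the concentric ball of radius
      \<open>\<rho> i * (2 + D)\<close>.\<close>
    have "real (card (Q i)) * ((c * \<rho> i) * a)\<^sup>2 \<le> (\<rho> i * (2 + D))\<^sup>2"
    proof (rule word_card[OF finQ[OF i] a(2,1)])
      show "0 < c * \<rho> i" "0 < \<rho> i * (2 + D)" using cC(1) \<rho>0[of i] D(1) by auto
      show "set w \<subseteq> S \<and> c * \<rho> i \<le> wr w \<and> word_map F w ` A \<subseteq> ball (u i) (\<rho> i * (2 + D))" if w: "w \<in> Q i" for w
      proof (intro conjI subsetI)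
        show "x \<in> S" if "x \<in> set w" for x using w that by (auto simp: Q_def)
        have ne: "w \<noteq> []" and wS: "set w \<subseteq> S" using w by (auto simp: Q_def)
        have "last w \<in> S" using ne wS by auto
        have "wr w = wr (butlast w) * rat (last w)"
          using wr_append[of "butlast w" "[last w]"] ne by simp
        moreover have "\<rho> i * c \<le> wr (butlast w) * rat (last w)"
          using w cC(1) cC(4)[OF \<open>last w \<in> S\<close>] \<rho>0[of i] by (intro mult_mono) (auto simp: Q_def)
        ultimately show "c * \<rho> i \<le> wr w" by (simp add: mult.commute)
        fix y assume "y \<in> word_map F w ` A"
        then obtain x where x: "x \<in> A" "y = word_map F w x" by blast
        obtain k where k: "k \<in> K" "dist (u i) (word_map F w k) < \<rho> i" using w by (auto simp: Q_def)
        have kA: "k \<in> A" using k(1) K_facts by blast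
        have "dist (word_map F w k) y = wr w * dist k x" unfolding x(2) by (rule word_dist[OF wS kA x(1)])
        also have "\<dots> \<le> \<rho> i * D" using w D(2)[OF kA x(1)] \<rho>0[of i] by (intro mult_mono) (auto simp: Q_def)
        finally have "dist (u i) y < \<rho> i + \<rho> i * D"
          using k(2) dist_triangle[of "u i" y "word_map F w k"] by linarith
        also have "\<dots> \<le> \<rho> i * (2 + D)" using \<rho>0[of i] by (simp add: algebra_simps)
        finally show "y \<in> ball (u i) (\<rho> i * (2 + D))" by simp
      qed
      show "\<nexists>t. w = v @ t" if vw: "v \<in> Q i" "w \<in> Q i" "v \<noteq> w" for v w
      proof
        assume "\<exists>t. w = v @ t"
        then obtain t where t: "w = v @ t" by blast
        then have "t \<noteq> []" using vw by auto
        \<comment> \<open>A proper prefix v of w is already a prefix of \<open>butlast w\<close>.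
          Its ratio is at most \<open>\<rho> i\<close>, so w would have been stopped
          earlier.\<close>
        then have b: "butlast w = v @ butlast t" unfolding t by (simp add: butlast_append)
        have "set (butlast t) \<subseteq> S" using vw(2) t by (auto simp: Q_def dest: in_set_butlastD)
        then have "wr (butlast t) \<le> 1" using wr_bounds by blast
        moreover have "wr v > 0" "wr v \<le> \<rho> i" using vw(1) wr_bounds[of v] by (auto simp: Q_def)
        ultimately have "wr (butlast w) \<le> \<rho> i"
          unfolding b wr_append using mult_left_mono[of "wr (butlast t)" 1 "wr v"] by linarith
        then show False using vw(2) by (simp add: Q_def)
      qed
    qed
    then have "real (card (Q i)) * ((c * a)\<^sup>2 * (\<rho> i)\<^sup>2) \<le> (2 + D)\<^sup>2 * (\<rho> i)\<^sup>2"
      by (simp add: power_mult_distrib mult_ac)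
    then have "real (card (Q i)) * (c * a)\<^sup>2 \<le> (2 + D)\<^sup>2"
      using \<rho>0[of i] by (simp add: mult.assoc[symmetric])
    moreover have "(c * a)\<^sup>2 > 0" using cC(1) a(1) by simp
    ultimately show ?thesis unfolding M_def power_divide by (simp add: pos_le_divide_eq)
  qed
  have "1 \<le> (\<Sum>w\<in>(\<Union>i\<in>I. Q i). prod_list (map (\<lambda>j. rat j powr s) w))"
  proof (rule kraft_cover[OF finite_S _ ge1])
    show "finite (\<Union>i\<in>I. Q i)" using I(1) finQ by blast
    fix v assume v: "v \<in> words S N"
    then have vS: "set v \<subseteq> S" "length v = N" by (auto simp: words_def)
    obtain k where k: "k \<in> K" using K_facts by blast
    obtain i where i: "i \<in> I" "word_map F v k \<in> ball (u i) (\<rho> i)" using I(2) word_K[OF vS(1) k] by blast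
    have "wr (take N v) \<le> \<rho> i" using wr_le_power[OF cC(3), of v] cC(4) vS N[OF i(1)] by simp
    then obtain n where n: "wr (take n v) \<le> \<rho> i" "\<And>m. m < n \<Longrightarrow> \<not> wr (take m v) \<le> \<rho> i"
      using exists_least_iff[of "\<lambda>n. wr (take n v) \<le> \<rho> i"] by blast
    \<comment> \<open>The empty word has ratio 1, which exceeds \<open>\<rho> i\<close>; so the
      stopping word is non-empty and \<open>butlast\<close> is its predecessor.\<close>
    have n0: "n > 0" using n(1) \<rho>1[OF i(1)] by (cases n) auto
    have nN: "n \<le> N" using n(2)[of N] \<open>wr (take N v) \<le> \<rho> i\<close> by fastforce
    have "butlast (take n v) = take (n - 1) v" using nN vS(2) by (simp add: butlast_take)
    moreover have "word_map F (take n v) (word_map F (drop n v) k) = word_map F v k"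
      using word_map_append[of F "take n v" "drop n v" k] by simp
    moreover have "word_map F (drop n v) k \<in> K" using word_K[OF _ k] vS(1) by (meson order_trans set_drop_subset)
    ultimately have "take n v \<in> Q i"
      unfolding Q_def using n(1) n(2)[of "n - 1"] n0 nN vS i(2) set_take_subset[of n v] by (auto simp: not_le)
    then show "\<exists>t t'. v = t @ t' \<and> t \<in> (\<Union>i\<in>I. Q i)" using i(1) append_take_drop_id[of n v] by (metis UN_I)
  qed simp
  also have "\<dots> \<le> (\<Sum>i\<in>I. \<Sum>w\<in>Q i. prod_list (map (\<lambda>j. rat j powr s) w))"
  proof (rule sum_UN_le[OF I(1) finQ])
    show "0 \<le> prod_list (map (\<lambda>j. rat j powr s) w)" for w by (induction w) auto
  qed
  also have "\<dots> \<le> (\<Sum>i\<in>I. M * \<rho> i powr s)"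
  proof (rule sum_mono)
    fix i assume i: "i \<in> I"
    have "(\<Sum>w\<in>Q i. prod_list (map (\<lambda>j. rat j powr s) w)) \<le> (\<Sum>w\<in>Q i. \<rho> i powr s)"
    proof (rule sum_mono)
      fix w assume w: "w \<in> Q i"
      then have "wr w powr s \<le> \<rho> i powr s" using s wr_bounds[of w] by (intro powr_mono2) (auto simp: Q_def)
      then show "prod_list (map (\<lambda>j. rat j powr s) w) \<le> \<rho> i powr s" using wr_powr[of w s] w by (auto simp: Q_def)
    qed
    also have "\<dots> \<le> M * \<rho> i powr s" using cardQ[OF i] by (simp add: mult_right_mono)
    finally show "(\<Sum>w\<in>Q i. prod_list (map (\<lambda>j. rat j powr s) w)) \<le> M * \<rho> i powr s" .
  qed
  also have "\<dots> = M * (\<Sum>i\<in>I. \<rho> i powr s)" by (simp add: sum_distrib_left)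
  also have "\<dots> < M * \<epsilon>" using sum\<rho> M by simp
  finally show False using \<epsilon>(3) by simp
qed

lemma sum_rat_less_1:
  assumes "hausdorff_dim K < ereal \<theta>"
  shows "(\<Sum>j\<in>S. rat j powr \<theta>) < 1"
proof -
  obtain s where s: "0 \<le> s" "hausdorff_measure s K = 0" "s < \<theta>"
    using assms unfolding hausdorff_dim_def INF_less_iff by auto
  have "s > 0" using s hausdorff_measure_0[of K] K_facts(2) by (cases "s = 0") auto
  have "rat j powr \<theta> \<le> rat j powr s" if "j \<in> S" for j
    using rat[OF that] s(3) by (intro powr_mono') auto
  then have "(\<Sum>j\<in>S. rat j powr \<theta>) \<le> (\<Sum>j\<in>S. rat j powr s)" by (rule sum_mono)
  then show ?thesis using moran[OF \<open>s > 0\<close> s(2)] by simp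
qed

end

section \<open>The spaces of level n\<close>

context cellular_ifs
begin

definition level :: "nat \<Rightarrow> plane set" where
  "level n = level_space X S F n"

lemma level_eq: "level n = (\<Union>w\<in>words S n. word_map F w ` A)"
  by (simp add: level_def level_space_def A_def)

lemma wordsD: "w \<in> words S n \<Longrightarrow> set w \<subseteq> S" "w \<in> words S n \<Longrightarrow> length w = n"
  by (simp_all add: words_def)

lemma level_0 [simp]: "level 0 = A"
  by (simp add: level_eq)

lemma level_subset: "level n \<subseteq> A"
  unfolding level_eq using word_into[OF wordsD(1)] by blast

lemma level_Suc: "level (Suc n) = (\<Union>j\<in>S. F j ` level n)"
proof -
  have "level (Suc n) = (\<Union>(j, w)\<in>S \<times> words S n. word_map F (j # w) ` A)"
    unfolding level_eq words_Suc by (simp add: case_prod_unfold)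
  also have "\<dots> = (\<Union>j\<in>S. \<Union>w\<in>words S n. F j ` word_map F w ` A)"
    by (auto simp: word_map_Cons)
  finally show ?thesis by (simp add: level_eq image_UN)
qed

lemma compact_word: "set w \<subseteq> S \<Longrightarrow> compact (word_map F w ` A)"
proof -
  assume w: "set w \<subseteq> S"
  obtain G D where G: "similarity (wr w) G D" "\<And>x. x \<in> A \<Longrightarrow> word_map F w x = G x"
    using word_similarity[OF w] by blast
  obtain L c where L: "linear L" "G = (\<lambda>x. c + L x)" using similarityE[OF G(1)] by metis
  have "continuous_on A G" unfolding L(2)
    using L(1) by (intro continuous_intros linear_continuous_on) (simp add: linear_conv_bounded_linear)
  then have "compact (G ` A)" using compact_A by (rule compact_continuous_image)
  moreover have "word_map F w ` A = G ` A" using G(2) by (intro image_cong) auto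
  ultimately show ?thesis by simp
qed

lemma compact_level: "compact (level n)"
  unfolding level_eq using finite_words[OF finite_S] compact_word wordsD by (intro compact_UN) auto

lemma closed_level: "closed (level n)"
  using compact_level compact_imp_closed by blast

lemma words_disjoint:
  assumes "w \<in> words S n" "v \<in> words S n" "w \<noteq> v"
  shows "interior (word_map F w ` A) \<inter> interior (word_map F v ` A) = {}"
proof (rule word_disjoint[OF wordsD(1)[OF assms(1)] wordsD(1)[OF assms(2)]])
  have len: "length w = n" "length v = n" using assms wordsD(2) by blast+
  show "\<nexists>u. v = w @ u"
  proof
    assume "\<exists>u. v = w @ u"
    then obtain u where u: "v = w @ u" ..
    then have "u = []" using arg_cong[OF u, of length] len by simp
    then show False using u assms(3) by simp
  qed
  show "\<nexists>u. w = v @ u"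
  proof
    assume "\<exists>u. w = v @ u"
    then obtain u where u: "w = v @ u" ..
    then have "u = []" using arg_cong[OF u, of length] len by simp
    then show False using u assms(3) by simp
  qed
qed

lemma word_single: "word_map F [j] = F j"
  by (simp add: word_map_def)

lemma frontier_A_cover:
  assumes "x \<in> frontier A"
  obtains j y where "j \<in> S" "y \<in> frontier A" "x = F j y"
proof -
  have "level 1 = (\<Union>j\<in>S. F j ` A)" using level_Suc[of 0] by simp
  then have "frontier A \<subseteq> frontier (level 1)"
    using struct by (simp add: cellular_self_similar_structure_def A_def)
  then have x: "x \<in> level 1" "x \<notin> interior (level 1)"
    using assms closed_level[of 1] frontier_subset_closed by (auto simp: frontier_def)
  then obtain j y where jy: "j \<in> S" "y \<in> A" "x = F j y" using \<open>level 1 = _\<close> by auto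
  have "y \<notin> interior A"
  proof
    assume "y \<in> interior A"
    then have "x \<in> F j ` interior A" using jy by blast
    also have "\<dots> = interior (F j ` A)" using word_interior[of "[j]" A] jy(1) by (simp add: word_single)
    also have "\<dots> \<subseteq> interior (level 1)" using jy(1) \<open>level 1 = _\<close> by (intro interior_mono) auto
    finally show False using x by blast
  qed
  then have "y \<in> frontier A" using jy(2) closure_subset by (auto simp: frontier_def)
  then show thesis using that jy by blast
qed

lemma frontier_A_level: "frontier A \<subseteq> level n"
proof (induction n)
  case 0 then show ?case using compact_A by (simp add: compact_imp_closed frontier_subset_closed)
next
  case (Suc n)
  show ?case
  proof
    fix x assume "x \<in> frontier A"
    then obtain j y where "j \<in> S" "y \<in> frontier A" "x = F j y" using frontier_A_cover by blast
    then show "x \<in> level (Suc n)" unfolding level_Suc using Suc by blast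
  qed
qed

lemma frontier_A_frontier_level: "frontier A \<subseteq> frontier (level n)"
proof
  fix x assume x: "x \<in> frontier A"
  then have "x \<notin> interior (level n)" using interior_mono[OF level_subset[of n]] by (auto simp: frontier_def)
  then show "x \<in> frontier (level n)"
    using frontier_A_level[of n] x closure_subset[of "level n"] by (auto simp: frontier_def)
qed

text \<open>A frontier point belongs to a piece of every level. That piece also contains a point of
  K, and its diameter tends to 0 with the level; K is closed.\<close>

lemma frontier_A_K: "frontier A \<subseteq> K"
proof
  fix x assume x: "x \<in> frontier A"
  obtain c C where cC: "0 < c" "C < 1" "0 < C" "\<And>j. j \<in> S \<Longrightarrow> c \<le> rat j \<and> rat j \<le> C" using rat_range by blast
  obtain D where D: "D > 0" "\<And>x y. x \<in> A \<Longrightarrow> y \<in> A \<Longrightarrow> dist x y \<le> D" using A_diameter by blast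
  obtain k where k: "k \<in> K" using K_facts by blast
  have inf: "infdist x K \<le> C ^ n * D" for n
  proof -
    obtain w y where w: "w \<in> words S n" "y \<in> A" "x = word_map F w y"
      using frontier_A_level[of n] x unfolding level_eq by blast
    have kA: "k \<in> A" using k K_facts by blast
    have "infdist x K \<le> dist x (word_map F w k)" by (rule infdist_le) (rule word_K[OF wordsD(1)[OF w(1)] k])
    also have "\<dots> = wr w * dist y k" unfolding w(3) by (rule word_dist[OF wordsD(1)[OF w(1)] w(2) kA])
    also have "\<dots> \<le> C ^ n * D"
      using wr_le_power[OF cC(3), of w] cC(4) wordsD[OF w(1)] D(2)[OF w(2) kA] cC(3) by (intro mult_mono) auto
    finally show ?thesis .
  qed
  have "(\<lambda>n. C ^ n * D) \<longlonglongrightarrow> 0"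
    by (rule tendsto_mult_left_zero[OF LIMSEQ_realpow_zero]) (use cC(2,3) in simp_all)
  then have "infdist x K \<le> 0" by (rule LIMSEQ_le_const) (use inf in blast)
  then have "infdist x K = 0" using infdist_nonneg[of x K] by simp
  then show "x \<in> K" using K_facts compact_imp_closed in_closed_iff_infdist_zero by blast
qed

text \<open>A point at maximal distance from the two-dimensional part would be the image, under a contraction
  mapping this part to itself, of a point at a larger distance.\<close>

lemma A_pure: "A = closure (interior A)"
proof (rule ccontr)
  let ?P = "closure (interior A)"
  assume ne: "A \<noteq> ?P"
  have PA: "?P \<subseteq> A" using compact_A by (simp add: closure_minimal compact_imp_closed interior_subset)
  have Pne: "?P \<noteq> {}" "closed ?P" using interior_A by auto
  have "continuous_on A (\<lambda>x. infdist x ?P)" by (intro continuous_intros)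
  moreover have "A \<noteq> {}" using interior_A by auto
  ultimately obtain x where x: "x \<in> A" "\<And>y. y \<in> A \<Longrightarrow> infdist y ?P \<le> infdist x ?P"
    using continuous_attains_sup[OF compact_A, of "\<lambda>x. infdist x ?P"] by blast
  obtain x0 where x0: "x0 \<in> A" "x0 \<notin> ?P" using ne PA by blast
  then have "infdist x0 ?P \<noteq> 0" using in_closed_iff_infdist_zero[OF Pne(2,1)] by blast
  then have "infdist x0 ?P > 0" using infdist_nonneg[of x0 ?P] by linarith
  then have pos: "infdist x ?P > 0" using x(2)[OF x0(1)] by simp
  have "x \<notin> ?P" using pos by auto
  then have "x \<notin> interior A" using closure_subset by blast
  then have "x \<in> frontier A" using x(1) closure_subset by (auto simp: frontier_def)
  then obtain j y where j: "j \<in> S" "y \<in> frontier A" "x = F j y" using frontier_A_cover by blast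
  have yA: "y \<in> A" using j(2) frontier_A_level[of 0] by auto
  obtain p where p: "p \<in> ?P" "infdist y ?P = dist y p" using infdist_attains_inf[OF Pne(2,1)] by blast
  have pA: "p \<in> A" using p(1) PA by blast
  \<comment> \<open>Interior points of A go to interior points of the image, which is contained in
    A; hence the closure of the interior is mapped into itself.\<close>
  have Fp: "F j p \<in> ?P"
  proof -
    obtain G D where G: "similarity (wr [j]) G D" "\<And>x. x \<in> A \<Longrightarrow> word_map F [j] x = G x"
      using word_similarity[of "[j]"] j(1) by auto
    obtain L c where L: "linear L" "G = (\<lambda>x. c + L x)" using similarityE[OF G(1)] by metis
    have cont: "continuous_on UNIV G" unfolding L(2)
      using L(1) by (intro continuous_intros linear_continuous_on) (simp add: linear_conv_bounded_linear)
    have "G ` ?P \<subseteq> closure (G ` interior A)"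
      by (rule image_closure_subset[OF continuous_on_subset[OF cont subset_UNIV] closed_closure closure_subset])
    also have "G ` interior A = interior (G ` A)" using similarity_interior[OF G(1)] by simp
    also have "G ` A = F j ` A" using G(2) by (intro image_cong) (auto simp: word_single)
    also have "closure (interior (F j ` A)) \<subseteq> ?P" by (intro closure_mono interior_mono F_into j(1))
    finally have "G p \<in> ?P" using p(1) by blast
    then show ?thesis using G(2)[OF pA] by (simp add: word_single)
  qed
  have "infdist x ?P \<le> dist x (F j p)" by (rule infdist_le[OF Fp])
  also have "\<dots> = rat j * infdist y ?P" unfolding j(3) p(2) by (rule rat(3)[OF j(1) yA pA])
  also have "\<dots> \<le> rat j * infdist x ?P" using x(2)[OF yA] rat(1)[OF j(1)] by simp
  also have "\<dots> < infdist x ?P" using pos rat_less_1[OF j(1)] by simp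
  finally show False by simp
qed

lemma word_pure: "set w \<subseteq> S \<Longrightarrow> word_map F w ` A \<subseteq> closure (interior (word_map F w ` A))"
proof -
  assume w: "set w \<subseteq> S"
  obtain G D where G: "similarity (wr w) G D" "\<And>x. x \<in> A \<Longrightarrow> word_map F w x = G x"
    using word_similarity[OF w] by blast
  obtain L c where L: "linear L" "G = (\<lambda>x. c + L x)" using similarityE[OF G(1)] by metis
  have cont: "continuous_on UNIV G" unfolding L(2)
    using L(1) by (intro continuous_intros linear_continuous_on) (simp add: linear_conv_bounded_linear)
  have "G ` closure (interior A) \<subseteq> closure (G ` interior A)"
    by (rule image_closure_subset[OF continuous_on_subset[OF cont subset_UNIV] closed_closure closure_subset])
  then have "G ` A \<subseteq> closure (interior (G ` A))"
    unfolding A_pure[symmetric] similarity_interior[OF G(1)] .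
  moreover have "word_map F w ` A = G ` A" using G(2) by (intro image_cong) auto
  ultimately show ?thesis by simp
qed

lemma level_pure: "level n \<subseteq> closure (interior (level n))"
proof
  fix x assume "x \<in> level n"
  then obtain w where w: "w \<in> words S n" "x \<in> word_map F w ` A" unfolding level_eq by blast
  then have "x \<in> closure (interior (word_map F w ` A))" using word_pure wordsD by blast
  moreover have "word_map F w ` A \<subseteq> level n" unfolding level_eq using w by blast
  ultimately show "x \<in> closure (interior (level n))" by (meson closure_mono interior_mono subsetD)
qed

text \<open>The line of points with first coordinate t meets A inside the disc and is unbounded, so
  it also leaves A. Being connected, it hits the frontier.\<close>

lemma frontier_A_projection:
  assumes "a > 0" "ball z a \<subseteq> A" "\<bar>t - z $ 1\<bar> < a"
  obtains x where "x \<in> frontier A" "x $ 1 = t"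
proof -
  let ?l = "{x :: plane. x $ 1 = t}"
  define e where "e i = (axis i 1 :: plane)" for i
  have e: "norm (e i) = 1" "e 1 $ 1 = 1" "e 2 $ 1 = 0" for i by (simp_all add: e_def norm_axis_1, simp_all add: axis_def)
  have "?l = {x. axis 1 1 \<bullet> x = t}" by (simp add: inner_axis')
  then have "convex ?l" using convex_hyperplane by simp
  then have con: "connected ?l" by (rule convex_connected)
  have i: "z + (t - z $ 1) *\<^sub>R e 1 \<in> ?l \<inter> A"
    using assms(2,3) e by (auto simp: dist_norm)
  have "?l - A \<noteq> {}"
  proof -
    obtain R x where R: "R > 0" "A \<subseteq> ball x R" using A_bounded .
    let ?y = "z + (t - z $ 1) *\<^sub>R e 1"
    let ?p = "?y + (R + norm (?y - x)) *\<^sub>R e 2"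
    define v where "v = (R + norm (?y - x)) *\<^sub>R e 2"
    have "norm v = R + norm (?y - x)" using R(1) e(1)[of 2] by (simp add: v_def)
    moreover have "norm v \<le> norm (?y + v - x) + norm (?y - x)"
      using norm_triangle_ineq4[of "?y + v - x" "?y - x"] by (simp add: algebra_simps)
    ultimately have "R \<le> dist x (?y + v)" by (simp add: dist_norm norm_minus_commute)
    then have "?y + v \<notin> ball x R" by simp
    then have "?p \<notin> A" using R(2) unfolding v_def by blast
    moreover have "?p \<in> ?l" using e by simp
    ultimately show ?thesis by blast
  qed
  then have "?l \<inter> frontier A \<noteq> {}" using connected_Int_frontier[OF con, of A] i by blast
  then show thesis using that by blast
qed

text \<open>Otherwise the total diameter of the pieces, and hence the length of the projection of the
  frontier, would tend to 0.\<close>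

lemma exponent_gt_1:
  assumes "(\<Sum>j\<in>S. rat j powr \<theta>) < 1"
  shows "\<theta> > 1"
proof (rule ccontr)
  assume "\<not> \<theta> > 1"
  then have \<theta>: "\<theta> \<le> 1" by simp
  define \<sigma> where "\<sigma> = (\<Sum>j\<in>S. rat j)"
  have "rat j \<le> rat j powr \<theta>" if "j \<in> S" for j
    using powr_mono'[OF \<theta>, of "rat j"] rat[OF that] by simp
  then have "\<sigma> \<le> (\<Sum>j\<in>S. rat j powr \<theta>)" unfolding \<sigma>_def by (rule sum_mono)
  then have \<sigma>: "\<sigma> < 1" "0 \<le> \<sigma>" using assms rat(1) by (simp, simp add: \<sigma>_def sum_nonneg less_imp_le)
  obtain z a where a: "a > 0" "ball z a \<subseteq> A" using A_ball .
  obtain D where D: "D > 0" "\<And>x y. x \<in> A \<Longrightarrow> y \<in> A \<Longrightarrow> dist x y \<le> D" using A_diameter by blast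
  have zA: "z \<in> A" using a by auto
  \<comment> \<open>An interval of length a / 2 in the projection of the frontier is covered by the
    projections of the pieces, put into intervals of length \<open>2 * D * wr w\<close>; these
    lengths sum to 2 D \<sigma>^n.\<close>
  have bound: "a \<le> 4 * D * \<sigma> ^ n" for n
  proof -
    define J where "J w = {word_map F w z $ 1 - wr w * D .. word_map F w z $ 1 + wr w * D}" for w
    have "{z $ 1 .. z $ 1 + a / 2} \<subseteq> (\<Union>w\<in>words S n. J w)"
    proof
      fix t assume "t \<in> {z $ 1 .. z $ 1 + a / 2}"
      then have "\<bar>t - z $ 1\<bar> < a" using a(1) by auto
      then obtain x where x: "x \<in> frontier A" "x $ 1 = t" using frontier_A_projection[OF a] by blast
      then obtain w y where w: "w \<in> words S n" "y \<in> A" "x = word_map F w y"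
        using frontier_A_level[of n] unfolding level_eq by blast
      have wS: "set w \<subseteq> S" using wordsD w by blast
      have "\<bar>x $ 1 - word_map F w z $ 1\<bar> \<le> norm (x - word_map F w z)"
        using component_le_norm_cart[of "x - word_map F w z" 1] by simp
      also have "\<dots> = wr w * dist y z" using word_dist[OF wS w(2) zA] by (simp add: w(3) dist_norm)
      also have "\<dots> \<le> wr w * D" using D(2)[OF w(2) zA] wr_bounds[OF wS] by simp
      finally have "t \<in> J w" unfolding J_def x(2)[symmetric] by (auto simp: abs_le_iff)
      then show "t \<in> (\<Union>w\<in>words S n. J w)" using w(1) by blast
    qed
    then have "measure lborel {z $ 1 .. z $ 1 + a / 2} \<le> measure lborel (\<Union>w\<in>words S n. J w)"
    proof (rule measure_mono_fmeasurable)
      show "(\<Union>w\<in>words S n. J w) \<in> fmeasurable lborel"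
        by (rule fmeasurable.finite_UN[OF finite_words[OF finite_S]]) (simp add: J_def fmeasurable_def emeasure_lborel_Icc_eq)
    qed simp
    also have "\<dots> \<le> (\<Sum>w\<in>words S n. measure lborel (J w))"
      by (rule measure_UNION_le[OF finite_words[OF finite_S]]) (simp add: J_def)
    also have "\<dots> = (\<Sum>w\<in>words S n. 2 * D * wr w)"
    proof (rule sum.cong[OF refl])
      fix w assume "w \<in> words S n"
      then have "wr w > 0" using wr_bounds wordsD by blast
      then have "- (wr w * D) \<le> wr w * D" using D(1) by simp
      then show "measure lborel (J w) = 2 * D * wr w" by (simp add: J_def)
    qed
    also have "\<dots> = 2 * D * \<sigma> ^ n"
      unfolding \<sigma>_def sum_words_prod[symmetric] by (simp add: wr_def sum_distrib_left)
    finally show ?thesis using a(1) by simp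
  qed
  have "(\<lambda>n. 4 * D * \<sigma> ^ n) \<longlonglongrightarrow> 0"
    by (rule tendsto_mult_right_zero[OF LIMSEQ_realpow_zero[OF \<sigma>(2,1)]])
  then have "a \<le> 0" by (rule LIMSEQ_le_const) (use bound in blast)
  then show False using a(1) by simp
qed

end

section \<open>Triangulations of plane sets\<close>

lemma orient_swap_right: "orient a c b = - orient a b c"
  by (simp add: orient_def algebra_simps)

lemma orient_inner: "orient u v z = rot (v - u) \<bullet> (z - u)"
  by (simp add: orient_def rot_def inner_plane vector_2 algebra_simps)

lemma orient_affine_hull:
  assumes "z \<in> affine hull {a, b}"
  shows "orient a b z = 0"
proof -
  obtain u v where "z = u *\<^sub>R a + v *\<^sub>R b" "u + v = 1" using assms by (auto simp: affine_hull_2)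
  moreover have "u = 1 - v" using calculation(2) by simp
  ultimately have "z = a + v *\<^sub>R (b - a)" by (simp add: algebra_simps)
  then show ?thesis by (simp add: orient_def)
qed

lemma orient_independent:
  assumes "orient a b c \<noteq> 0"
  shows "\<not> affine_dependent {a, b, c}"
proof
  assume "affine_dependent {a, b, c}"
  then obtain x where x: "x \<in> {a, b, c}" "x \<in> affine hull ({a, b, c} - {x})"
    unfolding affine_dependent_def by blast
  have "x \<in> affine hull {y, z}" if "{a, b, c} - {x} \<subseteq> {y, z}" for y z
    using x(2) hull_mono[OF that] by blast
  then have "x \<in> affine hull {b, c} \<and> x = a \<or> x \<in> affine hull {c, a} \<and> x = b \<or> x \<in> affine hull {a, b} \<and> x = c"
    using x(1) by blast
  then have "orient b c a = 0 \<or> orient c a b = 0 \<or> orient a b c = 0"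
    using orient_affine_hull by blast
  then show False using assms orient_rotate[of a b c] orient_rotate[of b c a] by simp
qed

lemma simplex2_orient:
  assumes "2 simplex \<sigma>"
  obtains a b c where "\<sigma> = convex hull {a, b, c}" "orient a b c > 0"
proof -
  obtain C where C: "\<not> affine_dependent C" "int (card C) = 2 + 1" "\<sigma> = convex hull C"
    using assms unfolding simplex_def by blast
  then have "card C = 3" by linarith
  then obtain a b c where abc: "C = {a, b, c}" "a \<noteq> b" "a \<noteq> c" "b \<noteq> c" unfolding card_3_iff by blast
  have "orient a b c \<noteq> 0"
  proof
    assume "orient a b c = 0"
    then obtain t where "c = a + t *\<^sub>R (b - a)" using orient_zero_param abc(2) by blast
    then have "c = (1 - t) *\<^sub>R a + t *\<^sub>R b" by (simp add: algebra_simps)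
    moreover have "(1 - t) *\<^sub>R a + t *\<^sub>R b \<in> affine hull {a, b}"
      unfolding affine_hull_2 by (intro CollectI exI[of _ "1 - t"] exI[of _ t]) simp
    moreover have "{a, b, c} - {c} = {a, b}" using abc by blast
    ultimately have "affine_dependent C" unfolding affine_dependent_def abc(1) by (metis insertCI)
    then show False using C(1) by blast
  qed
  then consider "orient a b c > 0" | "orient a c b > 0" using orient_swap_right[of a c b] by linarith
  then show thesis
  proof cases
    case 1 then show thesis using that C(3) abc(1) by blast
  next
    case 2
    have "{a, c, b} = C" using abc(1) by blast
    then show thesis using that[of a c b] 2 C(3) by simp
  qed
qed

lemma ccw_triple:
  assumes "2 simplex \<sigma>"
  obtains a b c where "ccw_triple \<sigma> = (a, b, c)" "\<sigma> = convex hull {a, b, c}" "orient a b c > 0"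
proof -
  obtain a b c where "\<sigma> = convex hull {a, b, c}" "orient a b c > 0" using simplex2_orient[OF assms] .
  then have "\<exists>x. \<exists>a b c. x = [a, b, c] \<and> \<sigma> = convex hull {a, b, c} \<and> counterclockwise a b c"
    unfolding counterclockwise_iff by blast
  from someI_ex[OF this] obtain a b c where
    "ccw_ordering \<sigma> = [a, b, c]" "\<sigma> = convex hull {a, b, c}" "orient a b c > 0"
    unfolding counterclockwise_iff ccw_ordering_def by blast
  then show thesis using that[of a b c] by (simp add: ccw_triple_def)
qed

lemma finite_triangles: "simplicial_complex T \<Longrightarrow> finite (triangles T)"
  by (simp add: simplicial_complex_def triangles_def)

lemma finite_vertices: "simplicial_complex T \<Longrightarrow> finite (vertices T)"
proof -
  assume "simplicial_complex T"
  then have "finite T" by (simp add: simplicial_complex_def)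
  moreover have "(\<lambda>v. {v}) ` vertices T \<subseteq> T" by (auto simp: vertices_def)
  ultimately show ?thesis by (metis finite_imageD finite_subset inj_on_def singleton_inject)
qed

lemma vertex_extreme:
  assumes "simplicial_complex T" "\<sigma> \<in> T" "v \<in> vertices T" "v \<in> \<sigma>"
  shows "v extreme_point_of \<sigma>"
proof -
  have "\<sigma> \<inter> {v} face_of \<sigma>" using assms unfolding simplicial_complex_def vertices_def by blast
  moreover have "\<sigma> \<inter> {v} = {v}" using assms(4) by blast
  ultimately show ?thesis by (simp only: face_of_singleton)
qed

text \<open>A vertex of the complex that lies in a triangle is a face, thus an extreme point, of it;
  conversely the complex is closed under faces. So no vertex sits inside a triangle or inside a
  side.\<close>

lemma triangle_vertices:
  assumes T: "simplicial_complex T" and \<sigma>: "\<sigma> \<in> triangles T"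
  obtains a b c where "ccw_triple \<sigma> = (a, b, c)" "\<sigma> = convex hull {a, b, c}" "orient a b c > 0"
    "vertices T \<inter> \<sigma> = {a, b, c}"
proof -
  have \<sigma>T: "\<sigma> \<in> T" "2 simplex \<sigma>" using \<sigma> by (auto simp: triangles_def)
  obtain a b c where abc: "ccw_triple \<sigma> = (a, b, c)" "\<sigma> = convex hull {a, b, c}" "orient a b c > 0"
    using ccw_triple[OF \<sigma>T(2)] .
  have "vertices T \<inter> \<sigma> \<subseteq> {a, b, c}"
    using vertex_extreme[OF T \<sigma>T(1)] extreme_point_of_convex_hull unfolding abc(2) by blast
  moreover have "x \<in> vertices T \<inter> \<sigma>" if "x \<in> {a, b, c}" for x
  proof -
    have "\<not> affine_dependent {a, b, c}" using abc(3) by (intro orient_independent) simp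
    then have "x extreme_point_of \<sigma>" unfolding abc(2)
      using extreme_point_of_convex_hull_affine_independent that by blast
    then have "{x} face_of \<sigma>" by (simp add: face_of_singleton)
    then have "{x} \<in> T" "x \<in> \<sigma>" using T \<sigma>T(1) face_of_imp_subset unfolding simplicial_complex_def by blast+
    then show ?thesis by (simp add: vertices_def)
  qed
  ultimately have "vertices T \<inter> \<sigma> = {a, b, c}" by (intro equalityI subsetI) blast+
  then show thesis by (rule that[OF abc])
qed

lemma triangle_ccw_triple: "2 simplex \<sigma> \<Longrightarrow> triangle (ccw_triple \<sigma>) = \<sigma>"
proof -
  assume "2 simplex \<sigma>"
  then obtain a b c where "ccw_triple \<sigma> = (a, b, c)" "\<sigma> = convex hull {a, b, c}" "orient a b c > 0"
    by (rule ccw_triple)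
  then show ?thesis unfolding triangle_def by (metis case_prod_conv)
qed

lemma ccw_in_triple:
  assumes "simplicial_complex T" "\<sigma> \<in> triangles T" "vertices T \<subseteq> V"
  shows "ccw_in V (ccw_triple \<sigma>)"
proof -
  obtain a b c where abc: "ccw_triple \<sigma> = (a, b, c)" "\<sigma> = convex hull {a, b, c}" "orient a b c > 0"
    "vertices T \<inter> \<sigma> = {a, b, c}"
    using triangle_vertices[OF assms(1,2)] .
  then have "{a, b, c} \<subseteq> V" using assms(3) by blast
  then show ?thesis using abc(3) by (simp add: abc(1) ccw_in_def)
qed

lemma orient_distinct_nz:
  assumes "orient a b c \<noteq> 0" "x \<in> {a, b, c}" "y \<in> {a, b, c}" "w \<in> {a, b, c}" "x \<noteq> y" "y \<noteq> w" "x \<noteq> w"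
  shows "orient x y w \<noteq> 0"
proof -
  have r: "orient b c a = orient a b c" "orient c a b = orient a b c" "orient a c b = - orient a b c"
    "orient c b a = - orient a b c" "orient b a c = - orient a b c"
    by (simp_all add: orient_def algebra_simps)
  have "x = a \<and> y = b \<and> w = c \<or> x = b \<and> y = c \<and> w = a \<or> x = c \<and> y = a \<and> w = b \<or>
    x = a \<and> y = c \<and> w = b \<or> x = c \<and> y = b \<and> w = a \<or> x = b \<and> y = a \<and> w = c"
    using assms(2-) by (elim insertE emptyE) simp_all
  then have "orient x y w = orient a b c \<or> orient x y w = - orient a b c"
    using r by metis
  then show ?thesis using assms(1) by auto
qed

lemma triangle_edge_gap:
  assumes T: "simplicial_complex T" and \<sigma>: "\<sigma> \<in> triangles T"
    and x: "x \<in> vertices T \<inter> \<sigma>" and y: "y \<in> vertices T \<inter> \<sigma>" and "x \<noteq> y"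
  shows "(x, y) \<in> gaps (vertices T)"
proof -
  obtain a b c where abc: "ccw_triple \<sigma> = (a, b, c)" "\<sigma> = convex hull {a, b, c}" "orient a b c > 0"
    "vertices T \<inter> \<sigma> = {a, b, c}"
    using triangle_vertices[OF T \<sigma>] .
  have "convex \<sigma>" unfolding abc(2) by (rule convex_convex_hull)
  then have seg: "closed_segment x y \<subseteq> \<sigma>" using x y by (intro closed_segment_subset) blast+
  have xy: "x \<in> {a, b, c}" "y \<in> {a, b, c}" using x y unfolding abc(4) by blast+
  have "orient a b c \<noteq> 0" using abc(3) by simp
  then have nz: "orient x y v \<noteq> 0" if "v \<in> {a, b, c}" "y \<noteq> v" "x \<noteq> v" for v
    by (rule orient_distinct_nz[OF _ xy that(1) \<open>x \<noteq> y\<close> that(2,3)])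
  have "v \<notin> vertices T" if v: "v \<in> open_segment x y" for v
  proof
    assume "v \<in> vertices T"
    then have "v \<in> {a, b, c}" using open_closed_segment[OF v] seg unfolding abc(4)[symmetric] by blast
    moreover have "y \<noteq> v" "x \<noteq> v" using v unfolding open_segment_def by blast+
    ultimately have "orient x y v \<noteq> 0" by (rule nz)
    then show False using orient_open_segment[OF v] by simp
  qed
  then show ?thesis using x y \<open>x \<noteq> y\<close> unfolding gaps_def by blast
qed

text \<open>The sides of a triangle of the complex are themselves gaps of its vertex set, so
  refining at these vertices changes nothing.\<close>

lemma bdry_triangle_refine:
  assumes "simplicial_complex T" "\<sigma> \<in> triangles T"
  shows "bdry (refine (vertices T) h) (ccw_triple \<sigma>) = bdry h (ccw_triple \<sigma>)"
proof -
  obtain a b c where abc: "ccw_triple \<sigma> = (a, b, c)" "\<sigma> = convex hull {a, b, c}" "orient a b c > 0"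
    "vertices T \<inter> \<sigma> = {a, b, c}"
    using triangle_vertices[OF assms] .
  have "a \<noteq> b" "b \<noteq> c" "c \<noteq> a" using abc(3) by auto
  then have "(a, b) \<in> gaps (vertices T)" "(b, c) \<in> gaps (vertices T)" "(c, a) \<in> gaps (vertices T)"
    using triangle_edge_gap[OF assms] abc(4) by blast+
  then show ?thesis unfolding abc(1) bdry_def by (simp add: refine_gap)
qed

lemma sum_indicator_disjoint:
  assumes "finite I" "\<And>i. i \<in> I \<Longrightarrow> z \<in> B i \<Longrightarrow> z \<in> interior (B i)"
    "\<And>i j. i \<in> I \<Longrightarrow> j \<in> I \<Longrightarrow> i \<noteq> j \<Longrightarrow> interior (B i) \<inter> interior (B j) = {}"
  shows "(\<Sum>i\<in>I. indicator (B i) z) = (indicator (\<Union>i\<in>I. B i) z :: real)"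
proof (cases "\<exists>i\<in>I. z \<in> B i")
  case True
  then obtain i where i: "i \<in> I" "z \<in> B i" by blast
  have "z \<notin> B j" if "j \<in> I - {i}" for j using assms(2,3) i that by blast
  then have "(\<Sum>j\<in>I. indicator (B j) z) = (indicator (B i) z :: real)"
    using i(1) assms(1) by (simp add: sum.remove)
  moreover have "z \<in> (\<Union>i\<in>I. B i)" using i by blast
  ultimately show ?thesis using i(2) by simp
qed auto

lemma off_lines_interior:
  assumes "ccw_in V t" "z \<in> triangle t" "\<And>u v. u \<in> V \<Longrightarrow> v \<in> V \<Longrightarrow> u \<noteq> v \<Longrightarrow> orient u v z \<noteq> 0"
  shows "z \<in> interior (triangle t)"
proof -
  obtain a b c where t: "t = (a, b, c)" by (cases t)
  have abc: "a \<in> V" "b \<in> V" "c \<in> V" "orient a b c > 0" using assms(1) by (auto simp: ccw_in_def t)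
  then have ne: "a \<noteq> b" "b \<noteq> c" "c \<noteq> a" by auto
  show ?thesis using triangle_interior[OF abc(4), of z] assms(2) assms(3)[OF abc(1,2) ne(1)]
      assms(3)[OF abc(2,3) ne(2)] assms(3)[OF abc(3,1) ne(3)] by (simp add: triangle_def t)
qed

lemma triangles_interior_disjoint:
  assumes "simplicial_complex T" "\<sigma> \<in> T" "\<tau> \<in> T" "\<sigma> \<noteq> \<tau>"
  shows "interior \<sigma> \<inter> interior \<tau> = {}"
proof (rule ccontr)
  assume "interior \<sigma> \<inter> interior \<tau> \<noteq> {}"
  then obtain z where z: "z \<in> interior \<sigma>" "z \<in> interior \<tau>" by blast
  have "\<sigma> \<inter> \<tau> face_of \<sigma>" "\<tau> \<inter> \<sigma> face_of \<tau>" using assms by (auto simp: simplicial_complex_def)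
  then have "\<sigma> \<inter> \<tau> = \<sigma>" "\<tau> \<inter> \<sigma> = \<tau>"
    using face_of_disjoint_interior z interior_subset by blast+
  then show False using assms(4) by blast
qed

text \<open>Off all lines spanned by V, a point lies on no side of a triangle. It is therefore
  interior to each triangle containing it, and there is at most one such triangle.\<close>

lemma sum_indicator_triangles:
  assumes T: "simplicial_complex T" and V: "vertices T \<subseteq> V"
    and z: "\<And>u v. u \<in> V \<Longrightarrow> v \<in> V \<Longrightarrow> u \<noteq> v \<Longrightarrow> orient u v z \<noteq> 0"
  shows "(\<Sum>\<sigma>\<in>triangles T. indicator (triangle (ccw_triple \<sigma>)) z) = (indicator (\<Union>(triangles T)) z :: real)"
proof -
  have eq: "triangle (ccw_triple \<sigma>) = \<sigma>" if "\<sigma> \<in> triangles T" for \<sigma>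
    using that triangle_ccw_triple by (simp add: triangles_def)
  have "(\<Sum>\<sigma>\<in>triangles T. indicator (triangle (ccw_triple \<sigma>)) z) = (\<Sum>\<sigma>\<in>triangles T. indicator \<sigma> z :: real)"
    by (intro sum.cong refl) (simp add: eq)
  also have "\<dots> = indicator (\<Union>\<sigma>\<in>triangles T. \<sigma>) z"
  proof (rule sum_indicator_disjoint[OF finite_triangles[OF T]])
    show "z \<in> interior \<sigma>" if "\<sigma> \<in> triangles T" "z \<in> \<sigma>" for \<sigma>
      using off_lines_interior[OF ccw_in_triple[OF T that(1) V] _ z] that(2) eq[OF that(1)] by simp
    show "interior \<sigma> \<inter> interior \<tau> = {}" if "\<sigma> \<in> triangles T" "\<tau> \<in> triangles T" "\<sigma> \<noteq> \<tau>" for \<sigma> \<tau>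
      using triangles_interior_disjoint[OF T] that by (simp add: triangles_def)
  qed
  finally show ?thesis by simp
qed

text \<open>Simplices of lower dimension form a null set, which contains no non-empty open set. So
  the closed union of the triangles contains the interior of the complex, and its closure.\<close>

lemma pure_union_triangles:
  assumes T: "simplicial_complex T" and pure: "\<Union>T \<subseteq> closure (interior (\<Union>T))"
  shows "\<Union>(triangles T) = \<Union>T"
proof
  show "\<Union>(triangles T) \<subseteq> \<Union>T" by (auto simp: triangles_def)
  have "compact \<sigma>" if "\<sigma> \<in> triangles T" for \<sigma>
    using that compact_simplex by (auto simp: triangles_def)
  then have cl: "closed (\<Union>(triangles T))"
    using finite_triangles[OF T] by (simp add: closed_Union compact_imp_closed)
  define U where "U = interior (\<Union>T) - \<Union>(triangles T)"
  have "negligible (\<Union>(T - triangles T))"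
  proof (rule negligible_Union)
    show "finite (T - triangles T)" using T by (simp add: simplicial_complex_def)
    fix \<sigma> assume \<sigma>: "\<sigma> \<in> T - triangles T"
    then obtain n where n: "n simplex \<sigma>" using T by (auto simp: simplicial_complex_def)
    then have "n \<noteq> 2" using \<sigma> by (auto simp: triangles_def)
    then have "aff_dim \<sigma> \<noteq> 2" using aff_dim_simplex[OF n] by simp
    then have "interior \<sigma> = {}" by (simp add: interior_rel_interior_gen)
    then show "negligible \<sigma>" using negligible_convex_interior[OF convex_simplex[OF n]] by simp
  qed
  moreover have "U \<subseteq> \<Union>(T - triangles T)" using interior_subset[of "\<Union>T"] by (auto simp: U_def)
  ultimately have "negligible U" by (rule negligible_subset)
  moreover have "open U" unfolding U_def by (intro open_Diff open_interior cl)
  ultimately have "U = {}" using open_not_negligible by blast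
  then have "interior (\<Union>T) \<subseteq> \<Union>(triangles T)" by (auto simp: U_def)
  then have "closure (interior (\<Union>T)) \<subseteq> \<Union>(triangles T)" using cl by (rule closure_minimal)
  then show "\<Union>T \<subseteq> \<Union>(triangles T)" using pure by blast
qed

text \<open>This uses that a lift has no degenerate simplices: three distinct vertices in one
  simplex are extreme points of it, and in the plane a simplex with at least three corners is a
  triangle.\<close>

lemma key_triangle:
  assumes T: "simplicial_complex T" and s: "admissible_lift T B s" and x: "x \<in> Poly_Mapping.keys s"
  obtains \<sigma> where "\<sigma> \<in> triangles T" "set x \<subseteq> vertices T \<inter> \<sigma>"
proof -
  have x': "length x = 3" "set x \<subseteq> vertices T" "distinct x" "\<exists>\<sigma>\<in>T. set x \<subseteq> \<sigma>"
    using s x by (auto simp: admissible_lift_def ordered_chains_def ordered_simplices_def)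
  obtain \<sigma> where \<sigma>: "\<sigma> \<in> T" "set x \<subseteq> \<sigma>" using x'(4) by blast
  obtain n where n: "n simplex \<sigma>" using T \<sigma> by (auto simp: simplicial_complex_def)
  obtain C where C: "\<not> affine_dependent C" "int (card C) = n + 1" "\<sigma> = convex hull C"
    using n unfolding simplex_def by blast
  have "set x \<subseteq> C"
    using vertex_extreme[OF T \<sigma>(1)] extreme_point_of_convex_hull x'(2) \<sigma>(2) unfolding C(3) by blast
  then have "card (set x) \<le> card C" using C(1) aff_independent_finite by (intro card_mono) auto
  moreover have "card (set x) = 3" using x' by (simp add: distinct_card)
  moreover have "n \<le> 2" using aff_dim_simplex[OF n] aff_dim_le_DIM[of \<sigma>] by simp
  ultimately have "n = 2" using C(2) by linarith
  then have "\<sigma> \<in> triangles T" using \<sigma> n by (simp add: triangles_def)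
  then show thesis using that x'(2) \<sigma>(2) by blast
qed

lemma boundary_edge:
  assumes T: "simplicial_complex T" and s: "admissible_lift T B s"
    and y: "y \<in> Poly_Mapping.keys (ordered_boundary s)"
  obtains u v \<sigma> where "y = [u, v]" "u \<noteq> v" "\<sigma> \<in> triangles T" "u \<in> vertices T \<inter> \<sigma>" "v \<in> vertices T \<inter> \<sigma>"
    "closed_segment u v \<subseteq> frontier B"
proof -
  obtain a b c where abc: "[a, b, c] \<in> Poly_Mapping.keys s \<or> [a, c, b] \<in> Poly_Mapping.keys s \<or> [c, a, b] \<in> Poly_Mapping.keys s"
    "y = [a, b]" "closed_segment a b \<subseteq> frontier B"
    using keys_boundary_lift[OF s y] .
  then obtain x where x: "x \<in> Poly_Mapping.keys s" "set x = {a, b, c}" "length x = 3" by fastforce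
  then have "distinct x" using s by (simp add: admissible_lift_def)
  then have "card {a, b, c} = 3" using x distinct_card by metis
  then have "a \<noteq> b" by (auto simp: card_insert_if split: if_splits)
  obtain \<sigma> where \<sigma>: "\<sigma> \<in> triangles T" "set x \<subseteq> vertices T \<inter> \<sigma>" using key_triangle[OF T s x(1)] .
  show thesis by (rule that[OF abc(2) \<open>a \<noteq> b\<close> \<sigma>(1) _ _ abc(3)]) (use \<sigma>(2) x(2) in simp_all)
qed

section \<open>Germs of the complex along an edge\<close>

lemma local_type_alt:
  "local_type A p q m \<rho> k \<longleftrightarrow>
     (k = 0 \<and> (\<forall>z\<in>ball m \<rho>. z \<notin> A)) \<or> (k = 0 \<and> (\<forall>z\<in>ball m \<rho>. z \<in> A))
     \<or> (k = 1 \<and> (\<forall>z\<in>ball m \<rho>. z \<in> A \<longleftrightarrow> orient p q z \<ge> 0))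
     \<or> (k = -1 \<and> (\<forall>z\<in>ball m \<rho>. z \<in> A \<longleftrightarrow> orient p q z \<le> 0))"
proof -
  have e: "(A \<inter> ball m \<rho> = {}) = (\<forall>z\<in>ball m \<rho>. z \<notin> A)" "(ball m \<rho> \<subseteq> A) = (\<forall>z\<in>ball m \<rho>. z \<in> A)"
    by (simp_all only: disjoint_iff subset_iff Ball_def) blast
  have e': "(A \<inter> ball m \<rho> = {z \<in> ball m \<rho>. P z}) = (\<forall>z\<in>ball m \<rho>. z \<in> A \<longleftrightarrow> P z)" for P
    unfolding set_eq_iff Int_iff mem_Collect_eq Ball_def by blast
  show ?thesis unfolding local_type_def e e' by argo
qed

lemma local_type_mono:
  assumes "local_type A p q m \<rho> k" "\<rho>' \<le> \<rho>"
  shows "local_type A p q m \<rho>' k"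
proof -
  have all: "\<forall>z\<in>ball m \<rho>'. P z" if "\<forall>z\<in>ball m \<rho>. P z" for P
    using that subset_ball[OF assms(2)] by blast
  from assms(1) consider
    "k = 0" "\<forall>z\<in>ball m \<rho>. z \<notin> A" | "k = 0" "\<forall>z\<in>ball m \<rho>. z \<in> A"
    | "k = 1" "\<forall>z\<in>ball m \<rho>. z \<in> A \<longleftrightarrow> orient p q z \<ge> 0"
    | "k = -1" "\<forall>z\<in>ball m \<rho>. z \<in> A \<longleftrightarrow> orient p q z \<le> 0"
    unfolding local_type_alt by blast
  then show ?thesis
  proof cases
    case 1 then show ?thesis unfolding local_type_alt using all[OF 1(2)] by blast
  next
    case 2 then show ?thesis unfolding local_type_alt using all[OF 2(2)] by blast
  next
    case 3 then show ?thesis unfolding local_type_alt using all[OF 3(2)] by blast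
  next
    case 4 then show ?thesis unfolding local_type_alt using all[OF 4(2)] by blast
  qed
qed

text \<open>Along an edge of the complex every inner point p behaves generically. If another
  triangle contains p, its intersection with the first one is a face containing p, hence contains u
  and v; so uv is a side of both, and a side line through p must be the line uv.\<close>

lemma triangle_edge_local:
  assumes T: "simplicial_complex T" and \<sigma>0: "\<sigma>\<^sub>0 \<in> triangles T" "u \<in> vertices T \<inter> \<sigma>\<^sub>0" "v \<in> vertices T \<inter> \<sigma>\<^sub>0" "u \<noteq> v"
    and p: "p \<in> open_segment u v" and \<sigma>: "\<sigma> \<in> triangles T"
  shows "\<exists>\<rho>>0. \<exists>k. local_type \<sigma> u v p \<rho> k"
proof -
  obtain a b c where abc: "ccw_triple \<sigma> = (a, b, c)" "\<sigma> = convex hull {a, b, c}" "orient a b c > 0"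
    "vertices T \<inter> \<sigma> = {a, b, c}"
    using triangle_vertices[OF T \<sigma>] .
  have nz: "orient a b c \<noteq> 0" using abc(3) by simp
  have "\<exists>\<rho>>0. local_type (convex hull {a, b, c}) u v p \<rho> (edge_sign u v p a b c)"
  proof (rule triangle_local[OF abc(3) \<sigma>0(4)])
    fix x y assume p\<sigma>: "p \<in> convex hull {a, b, c}" and x: "x \<in> {a, b, c}" and y: "y \<in> {a, b, c}" and xy: "x \<noteq> y" and o: "orient x y p = 0"
    obtain t where t: "p = u + t *\<^sub>R (v - u)" "0 < t" "t < 1"
      using p open_closed_segment[OF p] closed_segment_obtain segment_param01(2)[OF \<sigma>0(4)] by metis
    have "\<sigma>\<^sub>0 \<inter> \<sigma> face_of \<sigma>\<^sub>0" using T \<sigma>0(1) \<sigma> by (auto simp: simplicial_complex_def triangles_def)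
    moreover have "p \<in> \<sigma>\<^sub>0 \<inter> \<sigma>"
    proof -
      have "closed_segment u v \<subseteq> \<sigma>\<^sub>0"
        using \<sigma>0 convex_simplex by (intro closed_segment_subset) (auto simp: triangles_def)
      then show ?thesis using open_closed_segment[OF p] p\<sigma> abc(2) by blast
    qed
    ultimately have uv: "u \<in> \<sigma>" "v \<in> \<sigma>" using face_ofD[of "\<sigma>\<^sub>0 \<inter> \<sigma>" \<sigma>\<^sub>0 p u v] p \<sigma>0(2,3) by blast+
    then have uvabc: "u \<in> {a, b, c}" "v \<in> {a, b, c}" using \<sigma>0(2,3) abc(4) by blast+
    have o2: "(1 - t) * orient x y u + t * orient x y v = 0" using o unfolding t(1) orient_affine .
    have "orient x y u = 0"
    proof (rule ccontr)
      assume "orient x y u \<noteq> 0"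
      then have "u \<noteq> x" "u \<noteq> y" by auto
      then have "v = x \<or> v = y" using uvabc x y xy \<sigma>0(4) by auto
      then have "orient x y v = 0" by auto
      then show False using o2 t \<open>orient x y u \<noteq> 0\<close> by simp
    qed
    moreover have "orient x y v = 0" using o2 t calculation by simp
    ultimately show "orient x y u = 0 \<and> orient x y v = 0" by blast
  qed
  then show ?thesis unfolding abc(2) by blast
qed

lemma finite_common_radius:
  assumes "finite I" "\<And>i. i \<in> I \<Longrightarrow> \<exists>\<rho>>0. P i \<rho>" "\<And>i \<rho> \<rho>'. P i \<rho> \<Longrightarrow> \<rho>' \<le> \<rho> \<Longrightarrow> P i \<rho>'"
  obtains \<rho> :: real where "\<rho> > 0" "\<And>i. i \<in> I \<Longrightarrow> P i \<rho>"
proof -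
  obtain r where r: "\<And>i. i \<in> I \<Longrightarrow> r i > 0 \<and> P i (r i)" using assms(2) by metis
  define \<rho> where "\<rho> = Min (insert 1 (r ` I))"
  have fin: "finite (insert 1 (r ` I))" using assms(1) by simp
  have "\<rho> \<in> insert 1 (r ` I)" unfolding \<rho>_def using fin by (rule Min_in) simp
  then have "\<rho> > 0" using r by auto
  moreover have "\<rho> \<le> r i" if "i \<in> I" for i
    unfolding \<rho>_def using fin that by (intro Min_le) auto
  ultimately show thesis using that r assms(3) by metis
qed

lemma triangles_edge_local:
  assumes T: "simplicial_complex T" and \<sigma>0: "\<sigma>\<^sub>0 \<in> triangles T" "u \<in> vertices T \<inter> \<sigma>\<^sub>0" "v \<in> vertices T \<inter> \<sigma>\<^sub>0" "u \<noteq> v"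
    and p: "p \<in> open_segment u v"
  obtains \<rho> where "\<rho> > 0" "\<And>\<sigma>. \<sigma> \<in> triangles T \<Longrightarrow> \<exists>k. local_type \<sigma> u v p \<rho> k"
  using finite_triangles[OF T]
proof (rule finite_common_radius)
  show "\<exists>\<rho>>0. \<exists>k. local_type \<sigma> u v p \<rho> k" if "\<sigma> \<in> triangles T" for \<sigma>
    using triangle_edge_local[OF assms that] .
  show "\<exists>k. local_type \<sigma> u v p \<rho>' k" if "\<exists>k. local_type \<sigma> u v p \<rho> k" "\<rho>' \<le> \<rho>" for \<sigma> \<rho> \<rho>'
    using that local_type_mono by blast
qed blast

lemma ball_half_connected: "connected {z \<in> ball p \<rho>. orient u v z < 0}"
proof -
  have "{z \<in> ball p \<rho>. orient u v z < 0} = ball p \<rho> \<inter> {z. rot (v - u) \<bullet> z < rot (v - u) \<bullet> u}"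
    by (auto simp: orient_inner inner_diff_right)
  then have "convex {z \<in> ball p \<rho>. orient u v z < 0}"
    by (simp add: convex_Int convex_halfspace_lt)
  then show ?thesis by (rule convex_connected)
qed

text \<open>Near \<open>p\<close> the set \<open>B\<close> is a half disc. So the opposite half disc does not meet the frontier of \<open>A\<close>, and lies
  outside \<open>A\<close> when \<open>p\<close> is in this frontier.\<close>

lemma half_disc_frontier:
  assumes half: "\<And>z. z \<in> ball p \<rho> \<Longrightarrow> z \<in> B \<longleftrightarrow> orient u v z \<ge> 0" and "\<rho> > 0" "u \<noteq> v" "orient u v p = 0"
    and "B \<subseteq> A" "frontier A \<subseteq> B" "p \<in> frontier A" and z: "z \<in> ball p \<rho>" "orient u v z = 0"
  shows "z \<in> frontier A"
proof -
  let ?H = "{z \<in> ball p \<rho>. orient u v z < 0}"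
  have "?H \<inter> frontier A = {}" using half assms(6) by fastforce
  then have dich: "?H \<inter> A = {} \<or> ?H \<subseteq> A"
    using connected_Int_frontier[OF ball_half_connected, of p \<rho> u v A] by blast
  have "\<not> ?H \<subseteq> A"
  proof
    assume H: "?H \<subseteq> A"
    have "ball p \<rho> \<subseteq> A"
    proof
      fix x assume x: "x \<in> ball p \<rho>"
      show "x \<in> A"
      proof (cases "orient u v x \<ge> 0")
        case True then show ?thesis using half[OF x] assms(5) by blast
      next
        case False then show ?thesis using H x by auto
      qed
    qed
    then have "p \<in> interior A" using \<open>\<rho> > 0\<close> mem_interior by blast
    then show False using assms(7) by (simp add: frontier_def)
  qed
  then have H: "?H \<inter> A = {}" using dich by blast
  have "z \<in> A" using half[OF z(1)] z(2) assms(5) by auto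
  moreover have "z \<notin> interior A"
  proof
    assume "z \<in> interior A"
    moreover have "open (interior A \<inter> ball p \<rho>)" by auto
    ultimately obtain e where e: "e > 0" "ball z e \<subseteq> interior A \<inter> ball p \<rho>"
      using z(1) by (meson IntI open_contains_ball)
    define n where "n = rot (v - u)"
    have nn: "norm n > 0" using \<open>u \<noteq> v\<close> by (auto simp: n_def rot_def plane_eq_iff vector_2)
    define y where "y = z + (- (e / (2 * norm n))) *\<^sub>R n"
    have "y \<in> ball z e" using e(1) nn by (simp add: y_def dist_norm)
    then have y: "y \<in> A" "y \<in> ball p \<rho>" using e(2) interior_subset by blast+
    have "(v - u) \<bullet> (v - u) > 0" using \<open>u \<noteq> v\<close> by simp
    then have "orient u v y < 0" unfolding y_def n_def orient_normal z(2)
      using e(1) nn by (simp only: n_def add_0_left) (intro mult_neg_pos, simp_all add: n_def)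
    then show False using H y by blast
  qed
  ultimately show ?thesis using closure_subset by (auto simp: frontier_def)
qed

lemma orient_neg_swap: "orient v u z = - orient u v z"
  by (simp add: orient_def algebra_simps)

text \<open>The part of the frontier of A on the open edge is closed, and it is open by the half
  disc argument. The open edge is connected, so this part is empty or everything.\<close>

lemma edge_in_or_out:
  assumes T: "simplicial_complex T" and B: "\<Union>(triangles T) = B"
    and \<sigma>0: "\<sigma>\<^sub>0 \<in> triangles T" "u \<in> vertices T \<inter> \<sigma>\<^sub>0" "v \<in> vertices T \<inter> \<sigma>\<^sub>0" "u \<noteq> v"
    and fr: "closed_segment u v \<subseteq> frontier B" and BA: "B \<subseteq> A" and EB: "frontier A \<subseteq> B"
  shows "closed_segment u v \<subseteq> frontier A \<or> open_segment u v \<inter> frontier A = {}"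
proof -
  let ?S = "open_segment u v" and ?E = "frontier A"
  have op: "\<exists>\<rho>>0. ball p \<rho> \<inter> ?S \<subseteq> ?S \<inter> ?E" if p: "p \<in> ?S" "p \<in> ?E" for p
  proof -
    obtain \<rho> where \<rho>: "\<rho> > 0" and loc: "\<And>\<sigma>. \<sigma> \<in> triangles T \<Longrightarrow> \<exists>k. local_type \<sigma> u v p \<rho> k"
      using triangles_edge_local[OF T \<sigma>0 p(1)] by metis
    have pb: "p \<in> ball p \<rho>" using \<rho> by simp
    have op0: "orient u v p = 0" using p(1) by (rule orient_open_segment)
    have nofull: "\<not> ball p \<rho> \<subseteq> B"
    proof
      assume "ball p \<rho> \<subseteq> B"
      then have "p \<in> interior B" using \<rho> mem_interior by blast
      then show False using fr open_closed_segment[OF p(1)] by (auto simp: frontier_def)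
    qed
    define L where "L \<sigma> \<longleftrightarrow> (\<forall>z\<in>ball p \<rho>. z \<in> \<sigma> \<longleftrightarrow> orient u v z \<ge> 0)" for \<sigma>
    define R where "R \<sigma> \<longleftrightarrow> (\<forall>z\<in>ball p \<rho>. z \<in> \<sigma> \<longleftrightarrow> orient u v z \<le> 0)" for \<sigma>
    have sB: "\<sigma> \<subseteq> B" if "\<sigma> \<in> triangles T" for \<sigma> using that B by blast
    have cases: "(\<forall>z\<in>ball p \<rho>. z \<notin> \<sigma>) \<or> L \<sigma> \<or> R \<sigma>" if \<sigma>: "\<sigma> \<in> triangles T" for \<sigma>
    proof -
      have "\<not> (\<forall>z\<in>ball p \<rho>. z \<in> \<sigma>)" using nofull sB[OF \<sigma>] by blast
      then show ?thesis using loc[OF \<sigma>] unfolding local_type_alt L_def R_def by blast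
    qed
    \<comment> \<open>Half discs on opposite sides would fill the disc and make p interior to B.
      Hence all triangles at p lie on the same side, and B itself is a half disc near p.\<close>
    have notboth: "\<not> (L \<sigma> \<and> R \<tau>)" if "\<sigma> \<in> triangles T" "\<tau> \<in> triangles T" for \<sigma> \<tau>
    proof
      assume "L \<sigma> \<and> R \<tau>"
      then have "z \<in> \<sigma> \<or> z \<in> \<tau>" if "z \<in> ball p \<rho>" for z
        using that unfolding L_def R_def by (meson linear)
      then have "ball p \<rho> \<subseteq> B" using sB[OF that(1)] sB[OF that(2)] by blast
      then show False using nofull by blast
    qed
    have pB: "p \<in> B" using p(2) EB by blast
    then obtain \<tau> where \<tau>: "\<tau> \<in> triangles T" "p \<in> \<tau>" using B by blast
    then consider "L \<tau>" | "R \<tau>" using cases pb by blast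
    then show ?thesis
    proof cases
      case 1
      have half: "z \<in> B \<longleftrightarrow> orient u v z \<ge> 0" if z: "z \<in> ball p \<rho>" for z
      proof
        assume "z \<in> B"
        then obtain \<sigma> where \<sigma>: "\<sigma> \<in> triangles T" "z \<in> \<sigma>" using B by blast
        then have "L \<sigma>" using cases[OF \<sigma>(1)] notboth[OF \<tau>(1) \<sigma>(1)] 1 z by blast
        then show "orient u v z \<ge> 0" using \<sigma> z unfolding L_def by blast
      next
        assume "orient u v z \<ge> 0"
        then show "z \<in> B" using 1 z sB[OF \<tau>(1)] unfolding L_def by blast
      qed
      have "z \<in> ?E" if "z \<in> ball p \<rho>" "z \<in> ?S" for z
        by (rule half_disc_frontier[OF half \<rho> \<sigma>0(4) op0 BA EB p(2) that(1) orient_open_segment[OF that(2)]])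
      then show ?thesis using \<rho> by blast
    next
      case 2
      have half: "z \<in> B \<longleftrightarrow> orient v u z \<ge> 0" if z: "z \<in> ball p \<rho>" for z
      proof
        assume "z \<in> B"
        then obtain \<sigma> where \<sigma>: "\<sigma> \<in> triangles T" "z \<in> \<sigma>" using B by blast
        then have "R \<sigma>" using cases[OF \<sigma>(1)] notboth[OF \<sigma>(1) \<tau>(1)] 2 z by blast
        then have "orient u v z \<le> 0" using \<sigma> z unfolding R_def by blast
        then show "orient v u z \<ge> 0" unfolding orient_neg_swap[of v u z] by simp
      next
        assume "orient v u z \<ge> 0"
        then have "orient u v z \<le> 0" unfolding orient_neg_swap[of v u z] by simp
        then show "z \<in> B" using 2 z sB[OF \<tau>(1)] unfolding R_def by blast
      qed
      have o: "orient v u z = 0" if "z \<in> ?S" for z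
        using orient_open_segment[OF that] unfolding orient_neg_swap[of v u z] by simp
      have "z \<in> ?E" if "z \<in> ball p \<rho>" "z \<in> ?S" for z
        by (rule half_disc_frontier[OF half \<rho> \<sigma>0(4)[symmetric] o[OF p(1)] BA EB p(2) that(1) o[OF that(2)]])
      then show ?thesis using \<rho> by blast
    qed
  qed
  have "openin (top_of_set ?S) (?S \<inter> ?E)"
    unfolding openin_contains_ball using op by blast
  moreover have "closedin (top_of_set ?S) (?S \<inter> ?E)"
    by (intro closedin_closed_Int) simp
  moreover have "connected ?S" by (rule convex_connected) simp
  ultimately have "?S \<inter> ?E = {} \<or> ?S \<inter> ?E = ?S" unfolding connected_clopen by blast
  then show ?thesis
  proof
    assume "?S \<inter> ?E = ?S"
    then have "?S \<subseteq> ?E" by blast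
    then have "closure ?S \<subseteq> ?E" by (rule closure_minimal) simp
    then show ?thesis using \<sigma>0(4) by (simp add: closure_open_segment)
  qed blast
qed

section \<open>The full boundary\<close>

lemma chain_eval_cong: "(\<And>y. y \<in> Poly_Mapping.keys c \<Longrightarrow> u y = v y) \<Longrightarrow> chain_eval u c = chain_eval v c"
  by (simp add: chain_eval_def)

lemma chain_eval_fun_diff: "chain_eval u c - chain_eval v c = chain_eval (\<lambda>y. u y - v y) c"
  by (simp add: chain_eval_def sum_subtractf right_diff_distrib)

definition chain_norm :: "chain \<Rightarrow> real" where
  "chain_norm c = (\<Sum>y \<in> Poly_Mapping.keys c. norm (Poly_Mapping.lookup c y))"

lemma chain_eval_bound:
  assumes "\<And>y. y \<in> Poly_Mapping.keys c \<Longrightarrow> norm (u y) \<le> B"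
  shows "norm (chain_eval u c) \<le> chain_norm c * B"
proof -
  have "norm (chain_eval u c) \<le> (\<Sum>y \<in> Poly_Mapping.keys c. norm (Poly_Mapping.lookup c y) * B)"
    unfolding chain_eval_def
    by (rule sum_norm_le) (use assms in \<open>simp add: norm_mult mult_left_mono\<close>)
  then show ?thesis by (simp add: chain_norm_def sum_distrib_right)
qed

locale cellular_cocycle = cellular_ifs X S F K
  for X :: "plane set set" and S :: "'i set" and F :: "'i \<Rightarrow> plane \<Rightarrow> plane" and K :: "plane set" +
  fixes \<alpha> :: real and f g :: "plane \<Rightarrow> complex" and T :: "nat \<Rightarrow> plane set set" and s :: "nat \<Rightarrow> chain"
  assumes subdivision: "\<And>n. simplicial_subdivision X S F n (T n)"
    and lift: "\<And>n. admissible_lift (T n) (level_space X S F n) (s n)"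
    and \<alpha>_pos: "\<alpha> > 0"
    and dim: "hausdorff_dim K < ereal (2 * \<alpha>)"
    and f_holder: "f \<in> holder_functions \<alpha> K"
    and g_holder: "g \<in> holder_functions \<alpha> K"
begin

abbreviation V :: "nat \<Rightarrow> plane set" where "V n \<equiv> vertices (T n)"
abbreviation \<theta> :: real where "\<theta> \<equiv> 2 * \<alpha>"
abbreviation \<omega> :: "plane \<Rightarrow> plane \<Rightarrow> complex" where "\<omega> \<equiv> wedge f g"
abbreviation E :: "plane set" where "E \<equiv> frontier A"
abbreviation b :: "nat \<Rightarrow> chain" where "b n \<equiv> ordered_boundary (s n)"

lemma T_complex: "simplicial_complex (T n)"
  using subdivision by (simp add: simplicial_subdivision_def)

lemma T_union: "\<Union>(T n) = level n"
  using subdivision by (simp add: simplicial_subdivision_def level_def)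

lemma T_triangles: "\<Union>(triangles (T n)) = level n"
  using pure_union_triangles[OF T_complex, of n] level_pure[of n] T_union[of n] by simp

lemma vertices_eq: "V n = (\<Union>w\<in>words S n. word_map F w ` V 0)"
proof -
  have v: "V n = level_skeleton X S F n 0" for n
    using subdivision by (simp add: simplicial_subdivision_def)
  have "V 0 = skeleton X 0" unfolding v by (simp add: level_skeleton_def)
  then show ?thesis unfolding v[of n] by (simp add: level_skeleton_def)
qed

lemma word_vertex: "w \<in> words S n \<Longrightarrow> x \<in> V 0 \<Longrightarrow> word_map F w x \<in> V n"
  unfolding vertices_eq[of n] by blast

lemma finite_V: "finite (V n)"
  using finite_vertices T_complex by blast

lemma T_lift: "admissible_lift (T n) (level n) (s n)"
  using lift by (simp add: level_def)

lemma triangle_subset: "\<sigma> \<in> triangles (T n) \<Longrightarrow> \<sigma> \<subseteq> level n"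
  using T_triangles by blast

lemma \<theta>_sum: "(\<Sum>j\<in>S. rat j powr \<theta>) < 1"
  using sum_rat_less_1[OF dim] .

lemma \<theta>_gt_1: "\<theta> > 1"
  using exponent_gt_1[OF \<theta>_sum] .

lemma V0_A: "\<sigma> \<in> triangles (T 0) \<Longrightarrow> \<sigma> \<subseteq> A"
  using triangle_subset[of \<sigma> 0] by simp

text \<open>A word map may reverse orientation; exchanging the last two corners makes the image
  triple counterclockwise again.\<close>

definition word_triple :: "'i list \<Rightarrow> plane set \<Rightarrow> plane \<times> plane \<times> plane" where
  "word_triple w \<tau> = (case ccw_triple \<tau> of (x, y, z) \<Rightarrow>
     let x' = word_map F w x; y' = word_map F w y; z' = word_map F w z
     in if orient x' y' z' > 0 then (x', y', z') else (x', z', y'))"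

lemma word_triple:
  assumes w: "w \<in> words S n" and \<tau>: "\<tau> \<in> triangles (T 0)"
  shows "triangle (word_triple w \<tau>) = word_map F w ` \<tau>" "ccw_in (V n) (word_triple w \<tau>)"
proof -
  obtain x y z where t: "ccw_triple \<tau> = (x, y, z)" "\<tau> = convex hull {x, y, z}" "orient x y z > 0"
    "V 0 \<inter> \<tau> = {x, y, z}"
    using triangle_vertices[OF T_complex \<tau>] .
  obtain G D where G: "similarity (wr w) G D" "\<And>x. x \<in> A \<Longrightarrow> word_map F w x = G x"
    using word_similarity[OF wordsD(1)[OF w]] by blast
  have V0: "{x, y, z} \<subseteq> V 0" "{x, y, z} \<subseteq> A" using t(4) V0_A[OF \<tau>] by blast+
  then have eq: "word_map F w x = G x" "word_map F w y = G y" "word_map F w z = G z" using G(2) by blast+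
  have "word_map F w ` \<tau> = G ` \<tau>" using G(2) V0_A[OF \<tau>] by (intro image_cong) auto
  then have im: "word_map F w ` \<tau> = convex hull {G x, G y, G z}"
    using similarity_hull[OF G(1), of "{x, y, z}"] t(2) by simp
  have D: "D \<noteq> 0" "orient (G x) (G y) (G z) = D * orient x y z" using G(1) by (auto simp: similarity_def)
  have perm: "{G x, G z, G y} = {G x, G y, G z}" by blast
  show "triangle (word_triple w \<tau>) = word_map F w ` \<tau>"
    unfolding im word_triple_def t(1) by (simp add: Let_def eq triangle_def perm)
  have "G x \<in> V n" "G y \<in> V n" "G z \<in> V n" using word_vertex[OF w] V0(1) eq by (metis insert_subset)+
  moreover have "orient (G x) (G y) (G z) \<noteq> 0" using D t(3) by simp
  moreover have "orient (G x) (G z) (G y) = - orient (G x) (G y) (G z)" by (rule orient_swap_right)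
  ultimately show "ccw_in (V n) (word_triple w \<tau>)"
    unfolding word_triple_def t(1) by (simp add: Let_def eq ccw_in_def)
qed

text \<open>Off the lines, image triangles could overlap only in interior points. For different
  words of equal length this contradicts the disjointness of the pieces, for the same word the
  injectivity of its map.\<close>

lemma sum_indicator_words:
  assumes z: "\<And>u v. u \<in> V n \<Longrightarrow> v \<in> V n \<Longrightarrow> u \<noteq> v \<Longrightarrow> orient u v z \<noteq> 0"
  shows "(\<Sum>i\<in>words S n \<times> triangles (T 0). indicator (triangle (case i of (w, \<tau>) \<Rightarrow> word_triple w \<tau>)) z)
    = (indicator (level n) z :: real)"
proof -
  let ?I = "words S n \<times> triangles (T 0)" and ?t = "\<lambda>i. case i of (w, \<tau>) \<Rightarrow> word_triple w \<tau>"
  have fin: "finite ?I" using finite_words[OF finite_S] finite_triangles[OF T_complex] by blast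
  have tri: "triangle (?t (w, \<tau>)) = word_map F w ` \<tau>" if "w \<in> words S n" "\<tau> \<in> triangles (T 0)" for w \<tau>
    using word_triple(1)[OF that] by simp
  have "(\<Sum>i\<in>?I. indicator (triangle (?t i)) z) = (indicator (\<Union>i\<in>?I. triangle (?t i)) z :: real)"
  proof (rule sum_indicator_disjoint[OF fin])
    fix i assume i: "i \<in> ?I" "z \<in> triangle (?t i)"
    then have "ccw_in (V n) (?t i)" using word_triple(2) by auto
    then show "z \<in> interior (triangle (?t i))" using off_lines_interior[OF _ i(2) z] by blast
  next
    fix i j assume ij: "i \<in> ?I" "j \<in> ?I" "i \<noteq> j"
    then obtain w \<tau> w' \<tau>' where eq: "i = (w, \<tau>)" "j = (w', \<tau>')" by (metis surj_pair)
    have w: "w \<in> words S n" "w' \<in> words S n" "\<tau> \<in> triangles (T 0)" "\<tau>' \<in> triangles (T 0)" using ij eq by auto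
    have sub: "word_map F w ` \<tau> \<subseteq> word_map F w ` A" "word_map F w' ` \<tau>' \<subseteq> word_map F w' ` A"
      using V0_A w by (simp_all add: image_mono)
    have "interior (word_map F w ` \<tau>) \<inter> interior (word_map F w' ` \<tau>') = {}"
    proof (cases "w = w'")
      case False
      then show ?thesis
        using words_disjoint[OF w(1,2)] interior_mono[OF sub(1)] interior_mono[OF sub(2)] by blast
    next
      case True
      then have "\<tau> \<noteq> \<tau>'" using ij(3) eq by blast
      then have "interior \<tau> \<inter> interior \<tau>' = {}"
        using triangles_interior_disjoint[OF T_complex, of \<tau> 0 \<tau>'] w by (simp add: triangles_def)
      moreover have "interior \<tau> \<subseteq> A" "interior \<tau>' \<subseteq> A" using V0_A w interior_subset by blast+
      ultimately have "word_map F w ` interior \<tau> \<inter> word_map F w ` interior \<tau>' = {}"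
        using inj_on_image_Int[OF word_inj[OF wordsD(1)[OF w(1)]], of "interior \<tau>" "interior \<tau>'"] by simp
      then show ?thesis
        using word_interior[OF wordsD(1)[OF w(1)] V0_A] w True by simp
    qed
    then show "interior (triangle (?t i)) \<inter> interior (triangle (?t j)) = {}"
      unfolding eq tri[OF w(1,3)] tri[OF w(2,4)] .
  qed
  also have "(\<Union>i\<in>?I. triangle (?t i)) = (\<Union>i\<in>?I. word_map F (fst i) ` snd i)"
    by (intro SUP_cong refl) (auto simp: word_triple(1))
  also have "\<dots> = (\<Union>w\<in>words S n. word_map F w ` \<Union>(triangles (T 0)))"
  proof (intro equalityI subsetI)
    fix x assume "x \<in> (\<Union>i\<in>?I. word_map F (fst i) ` snd i)"
    then obtain w \<tau> where w: "w \<in> words S n" "\<tau> \<in> triangles (T 0)" "x \<in> word_map F w ` \<tau>" by auto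
    then have "x \<in> word_map F w ` \<Union>(triangles (T 0))" by blast
    then show "x \<in> (\<Union>w\<in>words S n. word_map F w ` \<Union>(triangles (T 0)))" using w(1) by blast
  qed force
  also have "\<dots> = level n" unfolding T_triangles level_eq by simp
  finally show ?thesis .
qed

text \<open>The triangles of \<open>T n\<close> and the images of those of \<open>T 0\<close> form
  unrelated triangulations, yet each family covers \<open>level n\<close> exactly once off finitely
  many lines. By the jump criterion their refined boundaries agree.\<close>

lemma bdry_words:
  assumes "antisymmetric h"
  shows "(\<Sum>\<sigma>\<in>triangles (T n). bdry (refine (V n) h) (ccw_triple \<sigma>))
    = (\<Sum>i\<in>words S n \<times> triangles (T 0). bdry (refine (V n) h) (case i of (w, \<tau>) \<Rightarrow> word_triple w \<tau>))"
proof (rule bdry_sum_refine_eq[OF finite_V finite_triangles[OF T_complex] _ assms])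
  show "finite (words S n \<times> triangles (T 0))"
    using finite_words[OF finite_S] finite_triangles[OF T_complex] by blast
  show "ccw_in (V n) (ccw_triple \<sigma>)" if "\<sigma> \<in> triangles (T n)" for \<sigma>
    using ccw_in_triple[OF T_complex that] by simp
  show "ccw_in (V n) (case i of (w, \<tau>) \<Rightarrow> word_triple w \<tau>)" if "i \<in> words S n \<times> triangles (T 0)" for i
    using that word_triple(2) by auto
  fix p q m assume pq: "(p, q) \<in> gaps (V n)" and m: "generic_on (V n) p q m"
  have "p \<noteq> q" using pq by (simp add: gaps_def)
  have eq: "(\<Sum>\<sigma>\<in>triangles (T n). indicator (triangle (ccw_triple \<sigma>)) z :: real) =
     (\<Sum>i\<in>words S n \<times> triangles (T 0). indicator (triangle (case i of (w, \<tau>) \<Rightarrow> word_triple w \<tau>)) z)"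
    if "\<And>u v. u \<in> V n \<Longrightarrow> v \<in> V n \<Longrightarrow> u \<noteq> v \<Longrightarrow> orient u v z \<noteq> 0" for z
    using sum_indicator_triangles[OF T_complex order_refl that] sum_indicator_words[OF that] T_triangles by simp
  from generic_on_off_lines[OF finite_V m \<open>p \<noteq> q\<close>]
  show "\<forall>\<^sub>F e in at_right 0. (\<Sum>\<sigma>\<in>triangles (T n). indicator (triangle (ccw_triple \<sigma>)) (m + e *\<^sub>R rot (q - p)) :: real) =
          (\<Sum>i\<in>words S n \<times> triangles (T 0). indicator (triangle (case i of (w, \<tau>) \<Rightarrow> word_triple w \<tau>)) (m + e *\<^sub>R rot (q - p))) \<and>
          (\<Sum>\<sigma>\<in>triangles (T n). indicator (triangle (ccw_triple \<sigma>)) (m + (- e) *\<^sub>R rot (q - p)) :: real) =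
          (\<Sum>i\<in>words S n \<times> triangles (T 0). indicator (triangle (case i of (w, \<tau>) \<Rightarrow> word_triple w \<tau>)) (m + (- e) *\<^sub>R rot (q - p)))"
    by (rule eventually_mono) (intro conjI eq; blast)
qed

text \<open>Pulling h back along the word turns the boundary of a piece into that of |X|. The sign
  of the determinant is common to all triangles of the piece and disappears in the norm.\<close>

lemma bdry_word_triple:
  assumes "antisymmetric h" and w: "w \<in> words S n"
  shows "norm (\<Sum>\<tau>\<in>triangles (T 0). bdry h (word_triple w \<tau>)) =
    norm (chain_eval (edge_fun (\<lambda>x y. h (word_map F w x) (word_map F w y))) (b 0))"
proof -
  obtain G D where G: "similarity (wr w) G D" "\<And>x. x \<in> A \<Longrightarrow> word_map F w x = G x"
    using word_similarity[OF wordsD(1)[OF w]] by blast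
  define h' where "h' x y = h (word_map F w x) (word_map F w y)" for x y
  define \<epsilon> :: complex where "\<epsilon> = (if D > 0 then 1 else -1)"
  have anti: "antisymmetric h'" unfolding antisymmetric_def h'_def using antisymmetricD[OF assms(1)] by blast
  have "bdry h (word_triple w \<tau>) = \<epsilon> * bdry h' (ccw_triple \<tau>)" if \<tau>: "\<tau> \<in> triangles (T 0)" for \<tau>
  proof -
    obtain x y z where t: "ccw_triple \<tau> = (x, y, z)" "\<tau> = convex hull {x, y, z}" "orient x y z > 0"
      "V 0 \<inter> \<tau> = {x, y, z}"
      using triangle_vertices[OF T_complex \<tau>] .
    have "{x, y, z} \<subseteq> A" using t(4) V0_A[OF \<tau>] by blast
    then have eq: "word_map F w x = G x" "word_map F w y = G y" "word_map F w z = G z" using G(2) by blast+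
    have "orient (G x) (G y) (G z) = D * orient x y z" using G(1) by (auto simp: similarity_def)
    then have iff: "orient (G x) (G y) (G z) > 0 \<longleftrightarrow> D > 0" using t(3) by (simp add: zero_less_mult_iff)
    show ?thesis
    proof (cases "D > 0")
      case True
      then have "word_triple w \<tau> = (G x, G y, G z)" unfolding word_triple_def t(1) by (simp add: Let_def eq iff)
      then show ?thesis using True by (simp add: bdry_def \<epsilon>_def t(1) h'_def eq)
    next
      case False
      then have "word_triple w \<tau> = (G x, G z, G y)" unfolding word_triple_def t(1) by (simp add: Let_def eq iff)
      then have "bdry h (word_triple w \<tau>) = h (G x) (G z) + h (G z) (G y) + h (G y) (G x)" by (simp add: bdry_def)
      also have "\<dots> = - (h (G x) (G y) + h (G y) (G z) + h (G z) (G x))"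
        using antisymmetricD[OF assms(1), of "G x" "G z"] antisymmetricD[OF assms(1), of "G z" "G y"]
          antisymmetricD[OF assms(1), of "G y" "G x"] by (simp only: minus_add_distrib minus_minus add_ac)
      finally show ?thesis using False by (simp add: bdry_def \<epsilon>_def t(1) h'_def eq)
    qed
  qed
  then have "(\<Sum>\<tau>\<in>triangles (T 0). bdry h (word_triple w \<tau>)) = \<epsilon> * (\<Sum>\<tau>\<in>triangles (T 0). bdry h' (ccw_triple \<tau>))"
    by (simp add: sum_distrib_left)
  also have "(\<Sum>\<tau>\<in>triangles (T 0). bdry h' (ccw_triple \<tau>)) = chain_eval (edge_fun h') (b 0)"
    using chain_eval_lift[OF anti T_lift[of 0]] by simp
  finally have "norm (\<Sum>\<tau>\<in>triangles (T 0). bdry h (word_triple w \<tau>)) = norm \<epsilon> * norm (chain_eval (edge_fun h') (b 0))"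
    by (simp add: norm_mult)
  then show ?thesis unfolding h'_def[abs_def] by (simp add: \<epsilon>_def)
qed

text \<open>Bundles the sewing estimate, its mesh version and the defect bound under a single
  constant, so that later estimates need only its existence. The first two require the segment to
  lie in K, where the Hoelder bounds hold.\<close>

definition young :: "real \<Rightarrow> bool" where
  "young Y \<longleftrightarrow> Y \<ge> 0 \<and>
    (\<forall>W x y. finite W \<longrightarrow> x \<in> W \<longrightarrow> y \<in> W \<longrightarrow> closed_segment x y \<subseteq> K \<longrightarrow>
       norm (refine W \<omega> x y - \<omega> x y) \<le> Y * dist x y powr \<theta>) \<and>
    (\<forall>W W' x y \<delta>. finite W' \<longrightarrow> W \<subseteq> W' \<longrightarrow> x \<in> W \<longrightarrow> y \<in> W \<longrightarrow> closed_segment x y \<subseteq> K \<longrightarrow>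
       (\<forall>p q. (p, q) \<in> gaps W \<longrightarrow> p \<in> closed_segment x y \<longrightarrow> q \<in> closed_segment x y \<longrightarrow> dist p q \<le> \<delta>) \<longrightarrow>
       norm (refine W' \<omega> x y - refine W \<omega> x y) \<le> Y * \<delta> powr (\<theta> - 1) * dist x y) \<and>
    (\<forall>x y z r. x \<in> K \<longrightarrow> y \<in> K \<longrightarrow> z \<in> K \<longrightarrow> dist x y \<le> r \<longrightarrow> dist y z \<le> r \<longrightarrow>
       norm (\<omega> x z - \<omega> x y - \<omega> y z) \<le> Y * r powr \<theta>)"

lemma youngD:
  assumes "young Y"
  shows "Y \<ge> 0"
    "\<lbrakk>finite W; x \<in> W; y \<in> W; closed_segment x y \<subseteq> K\<rbrakk> \<Longrightarrow> norm (refine W \<omega> x y - \<omega> x y) \<le> Y * dist x y powr \<theta>"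
    "\<lbrakk>finite W'; W \<subseteq> W'; x \<in> W; y \<in> W; closed_segment x y \<subseteq> K;
      \<And>p q. (p, q) \<in> gaps W \<Longrightarrow> p \<in> closed_segment x y \<Longrightarrow> q \<in> closed_segment x y \<Longrightarrow> dist p q \<le> \<delta>\<rbrakk>
      \<Longrightarrow> norm (refine W' \<omega> x y - refine W \<omega> x y) \<le> Y * \<delta> powr (\<theta> - 1) * dist x y"
    "\<lbrakk>x \<in> K; y \<in> K; z \<in> K; dist x y \<le> r; dist y z \<le> r\<rbrakk>
       \<Longrightarrow> norm (\<omega> x z - \<omega> x y - \<omega> y z) \<le> Y * r powr \<theta>"
  using assms unfolding young_def by simp_all

lemma young_ex:
  obtains Y where "young Y"
proof -
  obtain C where C: "C \<ge> 0" "\<And>x y z r. \<lbrakk>x \<in> K; y \<in> K; z \<in> K; dist x y \<le> r; dist y z \<le> r\<rbrakk>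
       \<Longrightarrow> norm (\<omega> x z - \<omega> x y - \<omega> y z) \<le> C * r powr \<theta>"
    using wedge_defect_bound[OF f_holder g_holder \<alpha>_pos] by blast
  define Y where "Y = max C (young_const C \<theta>)"
  have Y: "Y \<ge> 0" "C \<le> Y" "young_const C \<theta> \<le> Y" using C(1) by (auto simp: Y_def)
  have w0: "\<omega> x x = 0" for x by (rule antisymmetric_self[OF antisymmetric_wedge])
  have seg: "norm (\<omega> u w - \<omega> u v - \<omega> v w) \<le> C * dist u w powr \<theta>"
    if "closed_segment x y \<subseteq> K" "u \<in> closed_segment x y" "w \<in> closed_segment x y" "v \<in> closed_segment u w" for x y u v w
  proof (rule C(2))
    have "closed_segment u w \<subseteq> closed_segment x y" using that by (simp add: subset_closed_segment)
    then show "u \<in> K" "v \<in> K" "w \<in> K" using that by blast+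
    show "dist u v \<le> dist u w" "dist v w \<le> dist u w"
      using that(4) by (simp_all add: between_mem_segment[symmetric] between)
  qed
  have "young Y" unfolding young_def
  proof (intro conjI allI impI)
    show "Y \<ge> 0" by (rule Y(1))
  next
    fix W x y assume a: "finite W" "x \<in> W" "y \<in> W" "closed_segment x y \<subseteq> K"
    have "norm (refine W \<omega> x y - \<omega> x y) \<le> young_const C \<theta> * dist x y powr \<theta>"
      by (rule refine_young[OF a(1-3) C(1) \<theta>_gt_1 w0 seg[OF a(4)]])
    also have "\<dots> \<le> Y * dist x y powr \<theta>" using Y(3) by (rule mult_right_mono) simp
    finally show "norm (refine W \<omega> x y - \<omega> x y) \<le> Y * dist x y powr \<theta>" .
  next
    fix W W' x y \<delta> assume a: "finite W'" "W \<subseteq> W'" "x \<in> W" "y \<in> W" "closed_segment x y \<subseteq> K"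
      "\<forall>p q. (p, q) \<in> gaps W \<longrightarrow> p \<in> closed_segment x y \<longrightarrow> q \<in> closed_segment x y \<longrightarrow> dist p q \<le> \<delta>"
    have "norm (refine W' \<omega> x y - refine W \<omega> x y) \<le> young_const C \<theta> * \<delta> powr (\<theta> - 1) * dist x y"
      by (rule refine_mesh[OF a(1-4) C(1) \<theta>_gt_1 w0 seg[OF a(5)]]) (use a(6) in blast)+
    also have "\<dots> \<le> Y * \<delta> powr (\<theta> - 1) * dist x y" using Y(3) by (intro mult_right_mono) simp_all
    finally show "norm (refine W' \<omega> x y - refine W \<omega> x y) \<le> Y * \<delta> powr (\<theta> - 1) * dist x y" .
  next
    fix x y z r assume a: "x \<in> K" "y \<in> K" "z \<in> K" "dist x y \<le> r" "dist y z \<le> r"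
    have "norm (\<omega> x z - \<omega> x y - \<omega> y z) \<le> C * r powr \<theta>" by (rule C(2)[OF a])
    also have "\<dots> \<le> Y * r powr \<theta>" using Y(2) by (rule mult_right_mono) simp
    finally show "norm (\<omega> x z - \<omega> x y - \<omega> y z) \<le> Y * r powr \<theta>" .
  qed
  then show thesis by (rule that)
qed

lemma b_key:
  assumes "y \<in> Poly_Mapping.keys (b n)"
  obtains u v \<sigma> where "y = [u, v]" "u \<noteq> v" "\<sigma> \<in> triangles (T n)" "u \<in> V n \<inter> \<sigma>" "v \<in> V n \<inter> \<sigma>"
    "closed_segment u v \<subseteq> frontier (level n)"
  using boundary_edge[OF T_complex T_lift assms] .

text \<open>The boundary of each piece is a cycle, on which \<open>\<omega>\<close> is of second order in the diameter.\<close>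

lemma chain_eval_word:
  assumes young: "young Y" and D: "D > 0" "\<And>x y. x \<in> A \<Longrightarrow> y \<in> A \<Longrightarrow> dist x y \<le> D" and w: "w \<in> words S n"
  shows "norm (chain_eval (edge_fun (\<lambda>x y. refine (V n) \<omega> (word_map F w x) (word_map F w y))) (b 0))
    \<le> chain_norm (b 0) * (2 * Y * D powr \<theta>) * wr w powr \<theta>"
proof -
  have wS: "set w \<subseteq> S" using wordsD w by blast
  have wp: "wr w > 0" using wr_bounds[OF wS] by simp
  obtain z where z: "z \<in> K" using K_facts by blast
  let ?F = "word_map F w"
  \<comment> \<open>With the image of z as base point, \<open>u y - u x\<close> is an exact edge
    function and vanishes on cycles. It differs from \<omega> on an edge only by the defect of the
    triangle spanned with the base point, which is of order 2 \<alpha> in the diameter of the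
    piece.\<close>
  define u where "u y = \<omega> (?F z) (?F y)" for y
  define \<delta> where "\<delta> x y = u y - u x" for x y
  have "antisymmetric \<delta>" unfolding antisymmetric_def by (simp add: \<delta>_def)
  then have "chain_eval (edge_fun \<delta>) (b 0) = (\<Sum>\<sigma>\<in>triangles (T 0). bdry \<delta> (ccw_triple \<sigma>))"
    by (rule chain_eval_lift[OF _ T_lift])
  also have "\<dots> = 0" by (rule sum.neutral) (simp add: bdry_def \<delta>_def case_prod_unfold)
  finally have zero: "chain_eval (edge_fun \<delta>) (b 0) = 0" .
  let ?h = "\<lambda>x y. refine (V n) \<omega> (?F x) (?F y)"
  have "norm (chain_eval (\<lambda>y. edge_fun ?h y - edge_fun \<delta> y) (b 0)) \<le> chain_norm (b 0) * (2 * Y * (wr w * D) powr \<theta>)"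
  proof (rule chain_eval_bound)
    fix y assume "y \<in> Poly_Mapping.keys (b 0)"
    then obtain p q \<sigma> where pq: "y = [p, q]" "p \<noteq> q" "\<sigma> \<in> triangles (T 0)" "p \<in> V 0 \<inter> \<sigma>" "q \<in> V 0 \<inter> \<sigma>"
      "closed_segment p q \<subseteq> frontier (level 0)" using b_key by metis
    have segE: "closed_segment p q \<subseteq> E" using pq(6) by simp
    have EA: "E \<subseteq> A" using frontier_A_level[of 0] by simp
    have pqA: "p \<in> A" "q \<in> A" "z \<in> A" using segE EA z K_facts by auto
    obtain G D' where G: "similarity (wr w) G D'" "\<And>x. x \<in> A \<Longrightarrow> ?F x = G x" using word_similarity[OF wS] by blast
    have "?F ` closed_segment p q = G ` closed_segment p q" using G(2) segE EA by (intro image_cong) auto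
    then have seg: "?F ` closed_segment p q = closed_segment (?F p) (?F q)"
      using similarity_segment[OF G(1)] G(2) pqA by simp
    have FK: "?F x \<in> K" if "x \<in> E" for x using word_K[OF wS] frontier_A_K that by blast
    have segK: "closed_segment (?F p) (?F q) \<subseteq> K" unfolding seg[symmetric] using FK segE by blast
    have d: "dist (?F x) (?F y) \<le> wr w * D" if "x \<in> A" "y \<in> A" for x y
      using word_dist[OF wS that] D(2)[OF that] wp by simp
    have "norm (refine (V n) \<omega> (?F p) (?F q) - \<omega> (?F p) (?F q)) \<le> Y * dist (?F p) (?F q) powr \<theta>"
      using word_vertex[OF w] pq by (intro youngD(2)[OF young finite_V _ _ segK]) auto
    also have "\<dots> \<le> Y * (wr w * D) powr \<theta>"
      using d[OF pqA(1,2)] youngD(1)[OF young] \<alpha>_pos by (intro mult_left_mono powr_mono2) auto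
    finally have 1: "norm (refine (V n) \<omega> (?F p) (?F q) - \<omega> (?F p) (?F q)) \<le> Y * (wr w * D) powr \<theta>" .
    have 2: "norm (\<omega> (?F z) (?F q) - \<omega> (?F z) (?F p) - \<omega> (?F p) (?F q)) \<le> Y * (wr w * D) powr \<theta>"
      using segE by (intro youngD(4)[OF young] word_K[OF wS z] FK d pqA) auto
    have e: "edge_fun ?h y - edge_fun \<delta> y = (refine (V n) \<omega> (?F p) (?F q) - \<omega> (?F p) (?F q))
       - (\<omega> (?F z) (?F q) - \<omega> (?F z) (?F p) - \<omega> (?F p) (?F q))"
      by (simp add: pq(1) edge_fun_def \<delta>_def u_def)
    have "norm (edge_fun ?h y - edge_fun \<delta> y) \<le> Y * (wr w * D) powr \<theta> + Y * (wr w * D) powr \<theta>"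
      unfolding e by (rule order_trans[OF norm_triangle_ineq4 add_mono[OF 1 2]])
    then show "norm (edge_fun ?h y - edge_fun \<delta> y) \<le> 2 * Y * (wr w * D) powr \<theta>" by simp
  qed
  also have "chain_eval (\<lambda>y. edge_fun ?h y - edge_fun \<delta> y) (b 0) = chain_eval (edge_fun ?h) (b 0)"
    unfolding chain_eval_fun_diff[symmetric] zero by simp
  also have "(wr w * D) powr \<theta> = wr w powr \<theta> * D powr \<theta>" by (rule powr_mult)
  finally show ?thesis by (simp add: mult_ac)
qed

lemma full_boundary_tendsto_0: "(\<lambda>n. chain_eval (edge_fun \<omega>) (b n)) \<longlonglongrightarrow> 0"
proof -
  obtain Y where Y: "young Y" by (rule young_ex)
  obtain D where D: "D > 0" "\<And>x y. x \<in> A \<Longrightarrow> y \<in> A \<Longrightarrow> dist x y \<le> D" using A_diameter by blast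
  define M where "M = chain_norm (b 0) * (2 * Y * D powr \<theta>)"
  define \<sigma> where "\<sigma> = (\<Sum>j\<in>S. rat j powr \<theta>)"
  have \<sigma>: "0 \<le> \<sigma>" "\<sigma> < 1" using \<theta>_sum by (auto simp: \<sigma>_def sum_nonneg)
  have anti: "antisymmetric (refine (V n) \<omega>)" for n by (intro antisymmetric_refine antisymmetric_wedge)
  have bound: "norm (chain_eval (edge_fun \<omega>) (b n)) \<le> M * \<sigma> ^ n" for n
  proof -
    have "chain_eval (edge_fun \<omega>) (b n) = (\<Sum>\<sigma>\<in>triangles (T n). bdry \<omega> (ccw_triple \<sigma>))"
      by (rule chain_eval_lift[OF antisymmetric_wedge T_lift])
    also have "\<dots> = (\<Sum>\<sigma>\<in>triangles (T n). bdry (refine (V n) \<omega>) (ccw_triple \<sigma>))"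
      by (intro sum.cong refl) (simp add: bdry_triangle_refine[OF T_complex])
    also have "\<dots> = (\<Sum>i\<in>words S n \<times> triangles (T 0). bdry (refine (V n) \<omega>) (case i of (w, \<tau>) \<Rightarrow> word_triple w \<tau>))"
      by (rule bdry_words[OF antisymmetric_wedge])
    also have "\<dots> = (\<Sum>w\<in>words S n. \<Sum>\<tau>\<in>triangles (T 0). bdry (refine (V n) \<omega>) (word_triple w \<tau>))"
      by (simp add: sum.cartesian_product case_prod_unfold)
    finally have "norm (chain_eval (edge_fun \<omega>) (b n)) \<le>
       (\<Sum>w\<in>words S n. norm (\<Sum>\<tau>\<in>triangles (T 0). bdry (refine (V n) \<omega>) (word_triple w \<tau>)))"
      by (simp only: norm_sum)
    also have "\<dots> \<le> (\<Sum>w\<in>words S n. M * wr w powr \<theta>)"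
    proof (rule sum_mono)
      fix w assume w: "w \<in> words S n"
      show "norm (\<Sum>\<tau>\<in>triangles (T 0). bdry (refine (V n) \<omega>) (word_triple w \<tau>)) \<le> M * wr w powr \<theta>"
        unfolding bdry_word_triple[OF anti w] M_def by (rule chain_eval_word[OF Y D w])
    qed
    also have "\<dots> = M * \<sigma> ^ n" unfolding \<sigma>_def sum_wr_powr[symmetric] by (simp add: sum_distrib_left)
    finally show ?thesis .
  qed
  have "(\<lambda>n. M * \<sigma> ^ n) \<longlonglongrightarrow> 0" by (rule tendsto_mult_right_zero[OF LIMSEQ_realpow_zero[OF \<sigma>]])
  then show ?thesis by (rule Lim_null_comparison[rotated]) (simp add: bound)
qed

end

section \<open>The outer boundary\<close>

text \<open>Both germs refer to the same line pq, so two half discs either coincide or fill the disc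
  together.\<close>

lemma local_types_compare:
  assumes "local_type A p q m \<rho> k" "local_type B p q m \<rho> k'"
  shows "(\<forall>z\<in>ball m \<rho>. z \<in> B \<longrightarrow> z \<in> A) \<or> (\<forall>z\<in>ball m \<rho>. z \<in> A \<or> z \<in> B) \<or> (\<forall>z\<in>ball m \<rho>. z \<notin> A)"
proof -
  from assms(1) consider
    "\<forall>z\<in>ball m \<rho>. z \<notin> A" | "\<forall>z\<in>ball m \<rho>. z \<in> A"
    | "\<forall>z\<in>ball m \<rho>. z \<in> A \<longleftrightarrow> orient p q z \<ge> 0" | "\<forall>z\<in>ball m \<rho>. z \<in> A \<longleftrightarrow> orient p q z \<le> 0"
    unfolding local_type_alt by blast
  note A = this
  from assms(2) consider
    "\<forall>z\<in>ball m \<rho>. z \<notin> B" | "\<forall>z\<in>ball m \<rho>. z \<in> B"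
    | "\<forall>z\<in>ball m \<rho>. z \<in> B \<longleftrightarrow> orient p q z \<ge> 0" | "\<forall>z\<in>ball m \<rho>. z \<in> B \<longleftrightarrow> orient p q z \<le> 0"
    unfolding local_type_alt by blast
  then show ?thesis
  proof cases
    case 1 then show ?thesis by blast
  next
    case 2 then show ?thesis by blast
  next
    case B: 3
    from A show ?thesis
    proof cases
      case 3 then show ?thesis using B by blast
    next
      case 4
      have "z \<in> A \<or> z \<in> B" if "z \<in> ball m \<rho>" for z
        using 4 B that linear[of "orient p q z" 0] by blast
      then show ?thesis by blast
    qed blast+
  next
    case B: 4
    from A show ?thesis
    proof cases
      case 4 then show ?thesis using B by blast
    next
      case 3
      have "z \<in> A \<or> z \<in> B" if "z \<in> ball m \<rho>" for z
        using 3 B that linear[of "orient p q z" 0] by blast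
      then show ?thesis by blast
    qed blast+
  qed
qed

lemma refine_restrict:
  assumes "closed_segment a b \<subseteq> E"
  shows "refine V (restrict_to E h) a b = refine V h a b"
  unfolding refine_def
proof (rule sum.cong[OF refl])
  fix x assume "x \<in> {(p, q) \<in> gaps V. p \<in> closed_segment a b \<and> q \<in> closed_segment a b \<and> 0 < (b - a) \<bullet> (q - p)}"
  then obtain p q where x: "x = (p, q)" "p \<in> closed_segment a b" "q \<in> closed_segment a b" by blast
  then have "closed_segment p q \<subseteq> closed_segment a b" by (simp add: subset_closed_segment)
  then have "closed_segment p q \<subseteq> E" using assms by blast
  then show "(case x of (p, q) \<Rightarrow> restrict_to E h p q) = (case x of (p, q) \<Rightarrow> h p q)"
    by (simp add: x(1) restrict_to_def)
qed

lemma refine_restrict_out: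
  assumes "open_segment a b \<inter> E = {}"
  shows "refine V (restrict_to E h) a b = 0"
  unfolding refine_def
proof (rule sum.neutral, rule ballI)
  fix x assume "x \<in> {(p, q) \<in> gaps V. p \<in> closed_segment a b \<and> q \<in> closed_segment a b \<and> 0 < (b - a) \<bullet> (q - p)}"
  then obtain p q where x: "x = (p, q)" "p \<in> closed_segment a b" "q \<in> closed_segment a b" "0 < (b - a) \<bullet> (q - p)" by blast
  then have "p \<noteq> q" "a \<noteq> b" by auto
  have "open_segment p q \<subseteq> open_segment a b"
    using x(2,3) by (simp add: subset_open_segment)
  moreover have "open_segment p q \<noteq> {}" using \<open>p \<noteq> q\<close> by simp
  ultimately have "\<not> closed_segment p q \<subseteq> E"
    using assms segment_open_subset_closed[of p q] by blast
  then show "(case x of (p, q) \<Rightarrow> restrict_to E h p q) = 0" by (simp add: x(1) restrict_to_def)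
qed

lemma triangle_side_point:
  assumes "orient a b c > 0" "m \<in> convex hull {a, b, c}" "orient a b m = 0"
  shows "m \<in> closed_segment a b"
proof -
  obtain u v w where z: "0 \<le> u" "0 \<le> v" "0 \<le> w" "u + v + w = 1" "m = u *\<^sub>R a + v *\<^sub>R b + w *\<^sub>R c"
    using assms(2) unfolding convex_hull_3 by auto
  have u: "u = 1 - v - w" using z(4) by simp
  have "orient a b m = w * orient a b c" unfolding z(5) u by (simp add: orient_def algebra_simps)
  then have "w = 0" using assms by simp
  then have "m = (1 - v) *\<^sub>R a + v *\<^sub>R b" "v \<le> 1" using z u by auto
  then show ?thesis using z(2) unfolding in_segment by blast
qed

lemma triangle_boundary_point:
  assumes "ccw_in V t" "m \<in> triangle t" "m \<notin> interior (triangle t)"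
  obtains x y where "x \<in> V" "y \<in> V" "x \<noteq> y" "m \<in> closed_segment x y" "closed_segment x y \<subseteq> triangle t"
proof -
  obtain a b c where t: "t = (a, b, c)" by (cases t)
  have abc: "a \<in> V" "b \<in> V" "c \<in> V" "orient a b c > 0" using assms(1) by (auto simp: ccw_in_def t)
  have ne: "a \<noteq> b" "b \<noteq> c" "c \<noteq> a" using abc(4) by auto
  have m: "m \<in> convex hull {a, b, c}" "m \<notin> interior (convex hull {a, b, c})"
    using assms(2,3) by (simp_all add: triangle_def t)
  have p: "{b, c, a} = {a, b, c}" "{c, a, b} = {a, b, c}" by blast+
  have o: "orient b c a > 0" "orient c a b > 0" using abc(4) orient_rotate[of a b c] orient_rotate[of b c a] by simp_all
  have sub: "closed_segment x y \<subseteq> triangle t" if "x \<in> {a, b, c}" "y \<in> {a, b, c}" for x y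
    unfolding triangle_def t using that by (simp add: closed_segment_subset hull_inc)
  consider "orient a b m = 0" | "orient b c m = 0" | "orient c a m = 0"
    using triangle_interior[OF abc(4) m(1)] m(2) by blast
  then show thesis
  proof cases
    case 1 then show thesis
      using that[OF abc(1,2) ne(1) triangle_side_point[OF abc(4) m(1)] sub] by simp
  next
    case 2 then show thesis
      using that[OF abc(2,3) ne(2) triangle_side_point[OF o(1)] sub] m(1) p by simp
  next
    case 3 then show thesis
      using that[OF abc(3,1) ne(3) triangle_side_point[OF o(2)] sub] m(1) p by simp
  qed
qed

lemma jump_le_1:
  assumes "jump p q m F k" "\<forall>\<^sub>F e in at_right 0. F (m + e *\<^sub>R rot (q - p)) \<in> {0..1} \<and> F (m + (- e) *\<^sub>R rot (q - p)) \<in> {0..1}"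
  shows "\<bar>k\<bar> \<le> 1"
proof -
  have "\<forall>\<^sub>F e in at_right (0::real). \<bar>k\<bar> \<le> 1"
    using assms(1)[unfolded jump_def] assms(2) by eventually_elim auto
  then show ?thesis by (simp add: trivial_limit_at_right_real)
qed

lemma sign_of_nonzero:
  assumes "ccw_in V t" "sign_of p q m t \<noteq> 0" "(p, q) \<in> gaps V" "generic_on V p q m"
  shows "p \<in> triangle t" "q \<in> triangle t"
proof -
  obtain a b c where t: "t = (a, b, c)" by (cases t)
  have abc: "a \<in> V" "b \<in> V" "c \<in> V" using assms(1) by (auto simp: ccw_in_def t)
  have sub: "closed_segment x y \<subseteq> triangle t" if "x \<in> {a, b, c}" "y \<in> {a, b, c}" for x y
    unfolding triangle_def t using that by (simp add: closed_segment_subset hull_inc)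
  have "\<exists>x\<in>{a, b, c}. \<exists>y\<in>{a, b, c}. edge_ind p q m x y \<noteq> 0"
  proof (rule ccontr)
    assume "\<not> ?thesis"
    then have "edge_ind p q m x y = 0" if "x \<in> {a, b, c}" "y \<in> {a, b, c}" for x y using that by blast
    then show False using assms(2) by (simp add: sign_of_def edge_sign_def t)
  qed
  then obtain x y where xy: "x \<in> {a, b, c}" "y \<in> {a, b, c}" "edge_ind p q m x y \<noteq> 0" by blast
  have "x \<in> V" "y \<in> V" using xy(1,2) abc by blast+
  then have "p \<in> closed_segment x y" "q \<in> closed_segment x y"
    using edge_ind_gap[OF assms(3,4), of x y] xy(3) by (auto split: if_splits)
  then show "p \<in> triangle t" "q \<in> triangle t" using sub[OF xy(1,2)] by blast+
qed

text \<open>The triangles meet in a face of the second one that contains v, a point inside its edge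
  from p' to q'; so p' and q' are corners of the first triangle too. Two sides of one triangle with
  a common inner point are equal.\<close>

lemma vertex_edge_unique:
  assumes T: "simplicial_complex T" and \<sigma>: "\<sigma> \<in> triangles T" "p \<in> vertices T \<inter> \<sigma>" "q \<in> vertices T \<inter> \<sigma>" "p \<noteq> q"
    and \<tau>: "\<tau> \<in> triangles T" "p' \<in> vertices T \<inter> \<tau>" "q' \<in> vertices T \<inter> \<tau>" "p' \<noteq> q'"
    and v: "v \<in> open_segment p q" "v \<in> open_segment p' q'"
  shows "(p', q') \<in> {(p, q), (q, p)}"
proof -
  have "convex \<sigma>" "convex \<tau>" using \<sigma>(1) \<tau>(1) convex_simplex unfolding triangles_def by blast+
  then have seg: "closed_segment p q \<subseteq> \<sigma>" "closed_segment p' q' \<subseteq> \<tau>"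
    using \<sigma>(2,3) \<tau>(2,3) closed_segment_subset by blast+
  have vin: "v \<in> \<sigma>" "v \<in> \<tau>" using v open_closed_segment seg by blast+
  have "\<tau> \<inter> \<sigma> face_of \<tau>" using T \<sigma>(1) \<tau>(1) unfolding simplicial_complex_def triangles_def by blast
  then have "p' \<in> \<sigma>" "q' \<in> \<sigma>"
    using face_ofD[of "\<tau> \<inter> \<sigma>" \<tau> v p' q'] v(2) vin \<tau>(2,3) by blast+
  then have \<sigma>': "p' \<in> vertices T \<inter> \<sigma>" "q' \<in> vertices T \<inter> \<sigma>" using \<tau>(2,3) by blast+
  obtain a b c where abc: "ccw_triple \<sigma> = (a, b, c)" "\<sigma> = convex hull {a, b, c}" "orient a b c > 0"
    "vertices T \<inter> \<sigma> = {a, b, c}"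
    using triangle_vertices[OF T \<sigma>(1)] .
  have mem: "p \<in> {a, b, c}" "q \<in> {a, b, c}" "p' \<in> {a, b, c}" "q' \<in> {a, b, c}"
    using \<sigma>(2,3) \<sigma>' unfolding abc(4) .
  have nz: "orient a b c \<noteq> 0" using abc(3) by simp
  obtain t where t: "v = p + t *\<^sub>R (q - p)" "0 < t" "t < 1"
    using v(1) open_closed_segment[OF v(1)] closed_segment_obtain segment_param01(2)[OF \<sigma>(4)] by metis
  have o: "(1 - t) * orient p' q' p + t * orient p' q' q = 0"
    using orient_open_segment[OF v(2)] unfolding t(1) orient_affine .
  have third: "orient p' q' x = 0 \<longleftrightarrow> x = p' \<or> x = q'" if "x \<in> {a, b, c}" for x
    using orient_distinct_nz[OF nz mem(3,4) that \<tau>(4)] by auto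
  have "p = p' \<or> p = q'"
  proof (rule ccontr)
    assume n: "\<not> (p = p' \<or> p = q')"
    then have "orient p' q' p \<noteq> 0" using third[OF mem(1)] by blast
    moreover have "q = p' \<or> q = q'" using n mem \<sigma>(4) \<tau>(4) by auto
    then have "orient p' q' q = 0" using third[OF mem(2)] by blast
    ultimately show False using o t by simp
  qed
  moreover have "q = p' \<or> q = q'"
  proof (rule ccontr)
    assume n: "\<not> (q = p' \<or> q = q')"
    then have "orient p' q' q \<noteq> 0" using third[OF mem(2)] by blast
    moreover have "orient p' q' p = 0" using third[OF mem(1)] calculation \<open>p = p' \<or> p = q'\<close> by blast
    ultimately show False using o t by simp
  qed
  ultimately show ?thesis using \<sigma>(4) by blast
qed

section \<open>Transfer of the outer boundary between level n and level 0\<close>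

context cellular_cocycle
begin

text \<open>Some triangle of \<open>T n\<close> contains m and is not the full disc near m, as m is
  on the frontier of A. A triangle of \<open>T 0\<close> near m must be contained in it there, since
  otherwise the two would fill a disc inside A.\<close>

lemma frontier_E_local:
  assumes "V 0 \<subseteq> W" "V n \<subseteq> W" "p \<noteq> q" and m: "generic_on W p q m" "m \<in> E"
  obtains \<rho> where "\<rho> > 0" "\<And>z. z \<in> ball m \<rho> \<Longrightarrow> z \<in> level n \<longleftrightarrow> z \<in> A"
proof -
  let ?I = "triangles (T 0) \<union> triangles (T n)"
  have loc: "\<exists>\<rho>>0. \<exists>k. local_type \<sigma> p q m \<rho> k" if \<sigma>: "\<sigma> \<in> ?I" for \<sigma>
  proof -
    obtain k where k: "\<sigma> \<in> triangles (T k)" "V k \<subseteq> W" using \<sigma> assms(1,2) by blast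
    obtain a b c where abc: "ccw_triple \<sigma> = (a, b, c)" "\<sigma> = convex hull {a, b, c}" "orient a b c > 0"
      "V k \<inter> \<sigma> = {a, b, c}"
      using triangle_vertices[OF T_complex k(1)] .
    have sub: "{a, b, c} \<subseteq> W" using abc(4) k(2) by blast
    have "\<exists>\<rho>>0. local_type (convex hull {a, b, c}) p q m \<rho> (edge_sign p q m a b c)"
    proof (rule triangle_local[OF abc(3) assms(3)])
      fix u v assume "u \<in> {a, b, c}" "v \<in> {a, b, c}" "u \<noteq> v" "orient u v m = 0"
      then show "orient u v p = 0 \<and> orient u v q = 0" using m(1) sub unfolding generic_on_def by blast
    qed
    then show ?thesis unfolding abc(2) by blast
  qed
  have "finite ?I" using finite_triangles T_complex by blast
  then obtain \<rho> where \<rho>: "\<rho> > 0" "\<And>\<sigma>. \<sigma> \<in> ?I \<Longrightarrow> \<exists>k. local_type \<sigma> p q m \<rho> k"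
  proof (rule finite_common_radius)
    show "\<exists>\<rho>>0. \<exists>k. local_type \<sigma> p q m \<rho> k" if "\<sigma> \<in> ?I" for \<sigma> using loc[OF that] .
    show "\<exists>k. local_type \<sigma> p q m \<rho>' k" if "\<exists>k. local_type \<sigma> p q m \<rho> k" "\<rho>' \<le> \<rho>" for \<sigma> \<rho> \<rho>'
      using that local_type_mono by blast
  qed blast
  have mb: "m \<in> ball m \<rho>" using \<rho>(1) by simp
  have nofull: "\<not> ball m \<rho> \<subseteq> A"
  proof
    assume "ball m \<rho> \<subseteq> A"
    then have "m \<in> interior A" using \<rho>(1) mem_interior by blast
    then show False using m(2) by (simp add: frontier_def)
  qed
  obtain \<sigma> where \<sigma>: "\<sigma> \<in> triangles (T n)" "m \<in> \<sigma>" using frontier_A_level[of n] m(2) T_triangles[of n] by blast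
  obtain k where k: "local_type \<sigma> p q m \<rho> k" using \<rho>(2) \<sigma>(1) by blast
  have sub: "\<sigma> \<subseteq> level n" using triangle_subset \<sigma>(1) by blast
  have "z \<in> level n" if z: "z \<in> ball m \<rho>" "z \<in> A" for z
  proof -
    obtain \<tau> where \<tau>: "\<tau> \<in> triangles (T 0)" "z \<in> \<tau>" using z(2) T_triangles[of 0] by auto
    obtain k' where k': "local_type \<tau> p q m \<rho> k'" using \<rho>(2) \<tau>(1) by blast
    have "\<not> (\<forall>z\<in>ball m \<rho>. z \<in> \<sigma> \<or> z \<in> \<tau>)"
      using nofull sub level_subset[of n] V0_A[OF \<tau>(1)] by blast
    then have "\<forall>z\<in>ball m \<rho>. z \<in> \<tau> \<longrightarrow> z \<in> \<sigma>"
      using local_types_compare[OF k k'] mb \<sigma>(2) by blast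
    then show ?thesis using z(1) \<tau>(2) sub by blast
  qed
  then show thesis using that[OF \<rho>(1)] level_subset[of n] by blast
qed

text \<open>Near a generic point of a gap contained in the frontier of A, the spaces of level n and
  level 0 coincide, so the jumps agree. Gaps elsewhere do not count because the restricted function
  vanishes on them.\<close>

lemma bdry_E:
  assumes W: "finite W" "V 0 \<subseteq> W" "V n \<subseteq> W" and h: "antisymmetric h"
  shows "(\<Sum>\<sigma>\<in>triangles (T n). bdry (refine W (restrict_to E h)) (ccw_triple \<sigma>))
    = (\<Sum>\<sigma>\<in>triangles (T 0). bdry (refine W (restrict_to E h)) (ccw_triple \<sigma>))"
proof (rule bdry_sum_refine_eq[OF W(1) finite_triangles[OF T_complex] finite_triangles[OF T_complex] antisymmetric_restrict[OF h]])
  show "ccw_in W (ccw_triple \<sigma>)" if "\<sigma> \<in> triangles (T n)" for \<sigma>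
    using ccw_in_triple[OF T_complex that W(3)] .
  show "ccw_in W (ccw_triple \<sigma>)" if "\<sigma> \<in> triangles (T 0)" for \<sigma>
    using ccw_in_triple[OF T_complex that W(2)] .
  fix p q m assume pq: "(p, q) \<in> gaps W" "restrict_to E h p q \<noteq> 0" and m: "generic_on W p q m"
  have ne: "p \<noteq> q" using pq by (simp add: gaps_def)
  have "closed_segment p q \<subseteq> E" using pq(2) unfolding restrict_to_def by presburger
  then have mE: "m \<in> E" using m open_closed_segment unfolding generic_on_def by blast
  obtain \<rho> where \<rho>: "\<rho> > 0" "\<And>z. z \<in> ball m \<rho> \<Longrightarrow> z \<in> level n \<longleftrightarrow> z \<in> A"
    using frontier_E_local[OF W(2,3) ne m mE] by metis
  define N where "N = rot (q - p)"
  have "((\<lambda>e. e * norm N) \<longlongrightarrow> 0) (at_right 0)" by (rule tendsto_mult_left_zero) (rule tendsto_ident_at)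
  then have small: "\<forall>\<^sub>F e in at_right 0. e * norm N < \<rho>" using \<rho>(1) by (rule order_tendstoD)
  have pos: "\<forall>\<^sub>F e in at_right (0::real). e > 0" by (rule eventually_at_right_less)
  have sum: "(\<Sum>\<sigma>\<in>triangles (T n). indicator (triangle (ccw_triple \<sigma>)) z :: real) =
      (\<Sum>\<sigma>\<in>triangles (T 0). indicator (triangle (ccw_triple \<sigma>)) z)"
    if "z \<in> ball m \<rho>" and o: "\<And>u v. u \<in> W \<Longrightarrow> v \<in> W \<Longrightarrow> u \<noteq> v \<Longrightarrow> orient u v z \<noteq> 0" for z
    using sum_indicator_triangles[OF T_complex W(3) o] sum_indicator_triangles[OF T_complex W(2) o] \<rho>(2)[OF that(1)]
    unfolding T_triangles by (simp add: indicator_def)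
  show "\<forall>\<^sub>F e in at_right 0. (\<Sum>\<sigma>\<in>triangles (T n). indicator (triangle (ccw_triple \<sigma>)) (m + e *\<^sub>R rot (q - p)) :: real) =
          (\<Sum>\<sigma>\<in>triangles (T 0). indicator (triangle (ccw_triple \<sigma>)) (m + e *\<^sub>R rot (q - p))) \<and>
          (\<Sum>\<sigma>\<in>triangles (T n). indicator (triangle (ccw_triple \<sigma>)) (m + (- e) *\<^sub>R rot (q - p)) :: real) =
          (\<Sum>\<sigma>\<in>triangles (T 0). indicator (triangle (ccw_triple \<sigma>)) (m + (- e) *\<^sub>R rot (q - p)))"
    using generic_on_off_lines[OF W(1) m ne] small pos
  proof eventually_elim
    case (elim e)
    have "m + e *\<^sub>R N \<in> ball m \<rho>" "m + (- e) *\<^sub>R N \<in> ball m \<rho>"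
      using elim(2,3) by (simp_all add: dist_norm)
    then show ?case unfolding N_def using elim(1) by (intro conjI sum) blast+
  qed
qed

text \<open>A generic point m of pq is a boundary point of level n, hence lies on a side of some
  image triangle. The ends of this side are in \<open>V n\<close> and so not inside pq; therefore pq
  is part of the side and of a single piece of level n. The points p and q need not be in
  \<open>V n\<close>, because segments cut at \<open>V 0\<close> are treated as well.\<close>

lemma mesh:
  assumes D: "D > 0" "\<And>x y. x \<in> A \<Longrightarrow> y \<in> A \<Longrightarrow> dist x y \<le> D" and C: "0 < C" "\<And>j. j \<in> S \<Longrightarrow> rat j \<le> C"
    and pq: "p \<noteq> q" "open_segment p q \<inter> V n = {}" "closed_segment p q \<subseteq> E"
  shows "dist p q \<le> C ^ n * D"
proof -
  obtain m where m: "generic_on (V n) p q m" using generic_on_exists[OF finite_V pq(1)] by blast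
  have mo: "m \<in> open_segment p q" using m by (simp add: generic_on_def)
  have mE: "m \<in> E" using open_closed_segment[OF mo] pq(3) by blast
  have "m \<in> level n" "m \<notin> interior (level n)"
    using mE frontier_A_level[of n] frontier_A_frontier_level[of n] by (auto simp: frontier_def)
  then obtain w where w: "w \<in> words S n" "m \<in> word_map F w ` A" unfolding level_eq by blast
  then obtain \<tau> where \<tau>: "\<tau> \<in> triangles (T 0)" "m \<in> word_map F w ` \<tau>" using T_triangles[of 0] by auto
  have tri: "triangle (word_triple w \<tau>) = word_map F w ` \<tau>" using word_triple(1)[OF w(1) \<tau>(1)] .
  have sub: "triangle (word_triple w \<tau>) \<subseteq> word_map F w ` A" unfolding tri using V0_A[OF \<tau>(1)] by (rule image_mono)
  also have "\<dots> \<subseteq> level n" unfolding level_eq using w(1) by blast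
  finally have "m \<notin> interior (triangle (word_triple w \<tau>))" using interior_mono \<open>m \<notin> interior (level n)\<close> by blast
  then obtain x y where xy: "x \<in> V n" "y \<in> V n" "x \<noteq> y" "m \<in> closed_segment x y" "closed_segment x y \<subseteq> triangle (word_triple w \<tau>)"
    using triangle_boundary_point[OF word_triple(2)[OF w(1) \<tau>(1)], of m] \<tau>(2) tri by metis
  have o: "orient x y p = 0" "orient x y q = 0"
    using m xy(1-3) orient_closed_segment[OF xy(4)] by (auto simp: generic_on_def)
  have "x \<notin> open_segment p q" "y \<notin> open_segment p q" using xy(1,2) pq(2) by blast+
  then have "p \<in> closed_segment x y \<and> q \<in> closed_segment x y"
    by (rule gap_in_segment[OF mo xy(4,3) o])
  then have "p \<in> word_map F w ` A" "q \<in> word_map F w ` A" using xy(5) sub by blast+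
  then obtain p' q' where p': "p' \<in> A" "p = word_map F w p'" and q': "q' \<in> A" "q = word_map F w q'" by blast
  have wS: "set w \<subseteq> S" using wordsD w(1) by blast
  have "dist p q = wr w * dist p' q'" unfolding p'(2) q'(2) by (rule word_dist[OF wS p'(1) q'(1)])
  also have "\<dots> \<le> C ^ n * D"
    using wr_le_power[OF C wS] wordsD(2)[OF w(1)] D(2)[OF p'(1) q'(1)] C(1) by (intro mult_mono) auto
  finally show ?thesis .
qed

text \<open>A Riemann sum over the fixed boundary of |X| for the Young integral of f dg - g df.
  Including \<open>V 0\<close> ensures that all edges of \<open>b 0\<close> have their ends among
  the subdivision points.\<close>

definition outer_refined :: "nat \<Rightarrow> complex" where
  "outer_refined n = chain_eval (edge_fun (refine (V n \<union> V 0) \<omega>)) (b 0)"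

lemma E_subset_A: "E \<subseteq> A"
  using frontier_A_level[of 0] by simp

lemma key_E:
  assumes "y \<in> Poly_Mapping.keys (b 0)"
  obtains u v where "y = [u, v]" "u \<in> V 0" "v \<in> V 0" "closed_segment u v \<subseteq> E"
  using b_key[OF assms] by (metis IntD1 level_0)

text \<open>The subdivisions of levels n and m are not assumed nested, so each is compared with
  their common refinement. The error is governed by the mesh to the power \<theta> - 1 > 0.\<close>

lemma outer_refined_Cauchy: "Cauchy outer_refined"
proof -
  obtain Y where Y: "young Y" by (rule young_ex)
  obtain D where D: "D > 0" "\<And>x y. x \<in> A \<Longrightarrow> y \<in> A \<Longrightarrow> dist x y \<le> D" using A_diameter by blast
  obtain c C where cC: "0 < c" "C < 1" "0 < C" "\<And>j. j \<in> S \<Longrightarrow> c \<le> rat j \<and> rat j \<le> C" using rat_range by blast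
  define \<delta> where "\<delta> n = Y * (C ^ n * D) powr (\<theta> - 1) * D" for n
  have key: "norm (refine (V n \<union> V 0) \<omega> u v - refine (V n \<union> V 0 \<union> W) \<omega> u v) \<le> \<delta> n"
    if "u \<in> V 0" "v \<in> V 0" "closed_segment u v \<subseteq> E" "finite W" for u v n W
  proof -
    have fin: "finite (V n \<union> V 0 \<union> W)" using finite_V that(4) by blast
    have "norm (refine (V n \<union> V 0 \<union> W) \<omega> u v - refine (V n \<union> V 0) \<omega> u v) \<le> Y * (C ^ n * D) powr (\<theta> - 1) * dist u v"
    proof (rule youngD(3)[OF Y fin])
      show "closed_segment u v \<subseteq> K" using that(3) frontier_A_K by blast
      fix p q assume pq: "(p, q) \<in> gaps (V n \<union> V 0)" "p \<in> closed_segment u v" "q \<in> closed_segment u v"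
      have "closed_segment p q \<subseteq> E" using pq(2,3) that(3) by (meson subset_closed_segment subset_trans)
      moreover have "p \<noteq> q" "open_segment p q \<inter> V n = {}" using pq(1) unfolding gaps_def by blast+
      ultimately show "dist p q \<le> C ^ n * D" using cC(4) by (intro mesh[OF D cC(3)]) auto
    qed (use that in auto)
    also have "\<dots> \<le> \<delta> n" unfolding \<delta>_def
      using that(3) E_subset_A youngD(1)[OF Y] by (intro mult_left_mono D(2)) auto
    finally show ?thesis by (simp add: norm_minus_commute)
  qed
  have diff: "dist (outer_refined n) (outer_refined m) \<le> chain_norm (b 0) * (\<delta> n + \<delta> m)" for n m
  proof -
    have "outer_refined n - outer_refined m = chain_eval (\<lambda>y. edge_fun (refine (V n \<union> V 0) \<omega>) y - edge_fun (refine (V m \<union> V 0) \<omega>) y) (b 0)"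
      unfolding outer_refined_def by (rule chain_eval_fun_diff)
    also have "norm \<dots> \<le> chain_norm (b 0) * (\<delta> n + \<delta> m)"
    proof (rule chain_eval_bound)
      fix y assume "y \<in> Poly_Mapping.keys (b 0)"
      then obtain u v where y: "y = [u, v]" "u \<in> V 0" "v \<in> V 0" "closed_segment u v \<subseteq> E" by (rule key_E)
      have eq: "V n \<union> V 0 \<union> (V m \<union> V 0) = V m \<union> V 0 \<union> (V n \<union> V 0)" by blast
      have f: "finite (V k \<union> V 0)" for k using finite_V by blast
      have 1: "norm (refine (V n \<union> V 0) \<omega> u v - refine (V n \<union> V 0 \<union> (V m \<union> V 0)) \<omega> u v) \<le> \<delta> n"
        by (rule key[OF y(2-4) f])
      have 2: "norm (refine (V m \<union> V 0) \<omega> u v - refine (V n \<union> V 0 \<union> (V m \<union> V 0)) \<omega> u v) \<le> \<delta> m"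
        unfolding eq by (rule key[OF y(2-4) f])
      have "norm (refine (V n \<union> V 0) \<omega> u v - refine (V m \<union> V 0) \<omega> u v) \<le> \<delta> n + \<delta> m"
        using order_trans[OF norm_triangle_ineq4 add_mono[OF 1 2]] by simp
      then show "norm (edge_fun (refine (V n \<union> V 0) \<omega>) y - edge_fun (refine (V m \<union> V 0) \<omega>) y) \<le> \<delta> n + \<delta> m"
        by (simp add: y(1) edge_fun_def)
    qed
    finally show ?thesis by (simp add: dist_norm)
  qed
  have "(\<lambda>n. C ^ n * D) \<longlonglongrightarrow> 0"
    by (rule tendsto_mult_left_zero[OF LIMSEQ_realpow_zero]) (use cC(2,3) in simp_all)
  then have "(\<lambda>n. (C ^ n * D) powr (\<theta> - 1)) \<longlonglongrightarrow> 0"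
    using \<theta>_gt_1 cC(3) D(1) by (intro tendsto_zero_powrI[where b = "\<theta> - 1"]) auto
  then have "(\<lambda>n. Y * (C ^ n * D) powr (\<theta> - 1) * D) \<longlonglongrightarrow> 0"
    by (intro tendsto_mult_left_zero tendsto_mult_right_zero)
  then have "(\<lambda>n. chain_norm (b 0) * \<delta> n) \<longlonglongrightarrow> 0"
    unfolding \<delta>_def[abs_def] by (intro tendsto_mult_right_zero)
  then have lim: "(\<lambda>n. chain_norm (b 0) * \<delta> n) \<longlonglongrightarrow> 0" .
  show ?thesis
  proof (rule metric_CauchyI)
    fix e :: real assume "e > 0"
    then have "\<forall>\<^sub>F n in sequentially. chain_norm (b 0) * \<delta> n < e / 2" using lim by (intro order_tendstoD(2)) auto
    then obtain M where M: "\<And>n. n \<ge> M \<Longrightarrow> chain_norm (b 0) * \<delta> n < e / 2" unfolding eventually_sequentially by blast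
    have "dist (outer_refined m) (outer_refined n) < e" if "m \<ge> M" "n \<ge> M" for m n
      using diff[of m n] M[OF that(1)] M[OF that(2)] by (simp add: distrib_left)
    then show "\<exists>M. \<forall>m\<ge>M. \<forall>n\<ge>M. dist (outer_refined m) (outer_refined n) < e" by blast
  qed
qed

text \<open>All edges of \<open>b 0\<close> lie in the frontier of A, so at level 0 the restriction
  to it is harmless; the restricted refined boundary is then the same at level n.\<close>

lemma outer_refined_eq:
  "outer_refined n = chain_eval (edge_fun (refine (V n \<union> V 0) (restrict_to E \<omega>))) (b n)"
proof -
  let ?W = "V n \<union> V 0"
  have fin: "finite ?W" using finite_V by blast
  have anti: "antisymmetric (refine ?W (restrict_to E \<omega>))"
    by (intro antisymmetric_refine antisymmetric_restrict antisymmetric_wedge)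
  have "chain_eval (edge_fun (refine ?W (restrict_to E \<omega>))) (b n) = (\<Sum>\<sigma>\<in>triangles (T n). bdry (refine ?W (restrict_to E \<omega>)) (ccw_triple \<sigma>))"
    by (rule chain_eval_lift[OF anti T_lift])
  also have "\<dots> = (\<Sum>\<sigma>\<in>triangles (T 0). bdry (refine ?W (restrict_to E \<omega>)) (ccw_triple \<sigma>))"
    by (rule bdry_E[OF fin _ _ antisymmetric_wedge]) blast+
  also have "\<dots> = chain_eval (edge_fun (refine ?W (restrict_to E \<omega>))) (b 0)"
    by (rule chain_eval_lift[OF anti T_lift, symmetric])
  also have "\<dots> = outer_refined n" unfolding outer_refined_def
  proof (rule chain_eval_cong)
    fix y assume "y \<in> Poly_Mapping.keys (b 0)"
    then obtain u v where "y = [u, v]" "u \<in> V 0" "v \<in> V 0" "closed_segment u v \<subseteq> E" by (rule key_E)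
    then show "edge_fun (refine ?W (restrict_to E \<omega>)) y = edge_fun (refine ?W \<omega>) y"
      using refine_restrict by (simp add: edge_fun_def)
  qed
  finally show ?thesis by simp
qed

definition outer_error :: "nat \<Rightarrow> plane \<Rightarrow> plane \<Rightarrow> complex" where
  "outer_error n = restrict_to E (\<lambda>x y. refine (V n \<union> V 0) \<omega> x y - \<omega> x y)"

lemma antisymmetric_outer_error: "antisymmetric (outer_error n)"
  unfolding outer_error_def
  by (intro antisymmetric_restrict antisymmetric_diff antisymmetric_refine antisymmetric_wedge)

text \<open>Restricting and refining commute on the edges of \<open>b n\<close> thanks to the
  dichotomy for these edges. An edge only partly in the frontier could have a counted piece after
  refinement, while the edge itself would not count.\<close>

lemma outer_error_eq:
  "outer_refined n - chain_eval (edge_fun (restrict_to E \<omega>)) (b n) = chain_eval (edge_fun (outer_error n)) (b n)"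
  unfolding outer_refined_eq chain_eval_fun_diff
proof (rule chain_eval_cong)
  fix y assume "y \<in> Poly_Mapping.keys (b n)"
  then obtain u v \<sigma> where uv: "y = [u, v]" "u \<noteq> v" "\<sigma> \<in> triangles (T n)" "u \<in> V n \<inter> \<sigma>" "v \<in> V n \<inter> \<sigma>"
    "closed_segment u v \<subseteq> frontier (level n)" by (rule b_key)
  have "closed_segment u v \<subseteq> E \<or> open_segment u v \<inter> E = {}"
    by (rule edge_in_or_out[OF T_complex T_triangles uv(3-5,2,6) level_subset frontier_A_level])
  then have "refine (V n \<union> V 0) (restrict_to E \<omega>) u v - restrict_to E \<omega> u v = outer_error n u v"
  proof
    assume a: "closed_segment u v \<subseteq> E"
    then show ?thesis unfolding refine_restrict[OF a] outer_error_def restrict_to_def by simp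
  next
    assume a: "open_segment u v \<inter> E = {}"
    have "\<not> closed_segment u v \<subseteq> E"
      using a uv(2) segment_open_subset_closed[of u v] open_segment_eq_empty[of u v] by blast
    then show ?thesis unfolding refine_restrict_out[OF a] outer_error_def restrict_to_def by simp
  qed
  then show "edge_fun (refine (V n \<union> V 0) (restrict_to E \<omega>)) y - edge_fun (restrict_to E \<omega>) y = edge_fun (outer_error n) y"
    by (simp add: edge_fun_def uv(1))
qed

text \<open>Only the edges of level \<open>n\<close> with a vertex of level 0 in their relative interior contribute to the error,
  and each such vertex lies on at most one edge.\<close>

lemma outer_error_bound:
  assumes Y: "young Y" and D: "D > 0" "\<And>x y. x \<in> A \<Longrightarrow> y \<in> A \<Longrightarrow> dist x y \<le> D"
    and C: "0 < C" "\<And>j. j \<in> S \<Longrightarrow> rat j \<le> C"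
  shows "norm (chain_eval (edge_fun (outer_error n)) (b n)) \<le> real (card (V 0)) * (Y * (C ^ n * D) powr \<theta>)"
proof -
  let ?h = "outer_error n" and ?W = "V n \<union> V 0" and ?B = "Y * (C ^ n * D) powr \<theta>"
  have B0: "?B \<ge> 0" using youngD(1)[OF Y] by simp
  have "\<forall>p q. \<exists>m. (p, q) \<in> gaps (V n) \<longrightarrow> generic_on (V n) p q m"
    using generic_on_exists[OF finite_V] by (auto simp: gaps_def)
  then obtain m where m: "\<And>p q. (p, q) \<in> gaps (V n) \<Longrightarrow> generic_on (V n) p q (m p q)" by metis
  have ccw: "ccw_in (V n) (ccw_triple \<sigma>)" if "\<sigma> \<in> triangles (T n)" for \<sigma>
    using ccw_in_triple[OF T_complex that order_refl] .
  have fin: "finite (triangles (T n))" using finite_triangles[OF T_complex] .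
  define J where "J p q = (\<Sum>\<sigma>\<in>triangles (T n). sign_of p q (m p q) (ccw_triple \<sigma>))" for p q
  define Bd where "Bd = {(p, q) \<in> gaps (V n). J p q \<noteq> 0 \<and> ?h p q \<noteq> 0}"
  \<comment> \<open>The coefficients of a lift carry no a priori bound. The net coefficient
    \<open>J p q\<close>, however, is the jump of a function with values 0 and 1.\<close>
  have J1: "\<bar>J p q\<bar> \<le> 1" if pq: "(p, q) \<in> gaps (V n)" for p q
  proof (rule jump_le_1)
    have ne: "p \<noteq> q" using pq by (simp add: gaps_def)
    show "jump p q (m p q) (\<lambda>z. \<Sum>\<sigma>\<in>triangles (T n). indicator (triangle (ccw_triple \<sigma>)) z) (J p q)"
      unfolding J_def by (rule jump_sum[OF fin triangle_jump[OF ccw ne m[OF pq]]])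
    have ind: "(\<Sum>\<sigma>\<in>triangles (T n). indicator (triangle (ccw_triple \<sigma>)) z :: real) \<in> {0..1}"
      if "\<And>u v. u \<in> V n \<Longrightarrow> v \<in> V n \<Longrightarrow> u \<noteq> v \<Longrightarrow> orient u v z \<noteq> 0" for z
      using sum_indicator_triangles[OF T_complex order_refl that] by (simp add: indicator_def)
    from generic_on_off_lines[OF finite_V m[OF pq] ne]
    show "\<forall>\<^sub>F e in at_right 0. (\<Sum>\<sigma>\<in>triangles (T n). indicator (triangle (ccw_triple \<sigma>)) (m p q + e *\<^sub>R rot (q - p)) :: real) \<in> {0..1}
       \<and> (\<Sum>\<sigma>\<in>triangles (T n). indicator (triangle (ccw_triple \<sigma>)) (m p q + (- e) *\<^sub>R rot (q - p)) :: real) \<in> {0..1}"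
      by (rule eventually_mono) (intro conjI ind; blast)
  qed
  have edge: "\<exists>\<sigma>\<in>triangles (T n). p \<in> V n \<inter> \<sigma> \<and> q \<in> V n \<inter> \<sigma>" if "(p, q) \<in> Bd" for p q
  proof -
    have pq: "(p, q) \<in> gaps (V n)" "J p q \<noteq> 0" using that by (auto simp: Bd_def)
    obtain \<sigma> where \<sigma>: "\<sigma> \<in> triangles (T n)" "sign_of p q (m p q) (ccw_triple \<sigma>) \<noteq> 0"
      using pq(2) unfolding J_def by (meson sum.neutral)
    have "triangle (ccw_triple \<sigma>) = \<sigma>" using \<sigma>(1) by (intro triangle_ccw_triple) (simp add: triangles_def)
    then have "p \<in> \<sigma>" "q \<in> \<sigma>" using sign_of_nonzero[OF ccw[OF \<sigma>(1)] \<sigma>(2) pq(1) m[OF pq(1)]] by simp_all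
    then show ?thesis using \<sigma>(1) pq(1) unfolding gaps_def by blast
  qed
  \<comment> \<open>Without a vertex of level 0 inside, the gap is also a gap of the larger set and
    refining leaves it alone, so the error is 0.\<close>
  have vert: "\<exists>v\<in>V 0. v \<in> open_segment p q" if "(p, q) \<in> Bd" for p q
  proof (rule ccontr)
    assume no: "\<not> ?thesis"
    have pq: "(p, q) \<in> gaps (V n)" "?h p q \<noteq> 0" using that by (auto simp: Bd_def)
    have "(p, q) \<in> gaps ?W" using no pq(1) by (auto simp: gaps_def)
    then have "refine ?W \<omega> p q = \<omega> p q" by (rule refine_gap)
    then show False using pq(2) by (simp add: outer_error_def restrict_to_def split: if_splits)
  qed
  have hB: "norm (?h p q) \<le> ?B" if "(p, q) \<in> gaps (V n)" for p q
  proof (cases "closed_segment p q \<subseteq> E")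
    case True
    have pq: "p \<in> V n" "q \<in> V n" "p \<noteq> q" "open_segment p q \<inter> V n = {}" using that by (auto simp: gaps_def)
    have finW: "finite ?W" using finite_V by blast
    have "norm (refine ?W \<omega> p q - \<omega> p q) \<le> Y * dist p q powr \<theta>"
      using pq True frontier_A_K by (intro youngD(2)[OF Y finW]) auto
    also have "\<dots> \<le> ?B"
      using mesh[OF D C pq(3,4) True] youngD(1)[OF Y] \<alpha>_pos by (intro mult_left_mono powr_mono2) auto
    finally show ?thesis using True by (simp add: outer_error_def restrict_to_def)
  next
    case False
    then show ?thesis using B0 by (simp add: outer_error_def restrict_to_def)
  qed
  have finBd: "finite Bd" unfolding Bd_def using finite_gaps[OF finite_V[of n]] by (rule finite_subset[rotated]) auto
  \<comment> \<open>Each vertex of level 0 lies inside at most one edge, which occurs in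
    \<open>Bd\<close> in at most two orders. This 2 cancels against the one in
    \<open>bdry_sum_refine\<close>.\<close>
  have card: "card Bd \<le> 2 * card (V 0)"
  proof -
    have "Bd \<subseteq> (\<Union>v\<in>V 0. {e \<in> Bd. v \<in> open_segment (fst e) (snd e)})"
    proof
      fix e assume e: "e \<in> Bd"
      then have "(fst e, snd e) \<in> Bd" by simp
      then obtain v where "v \<in> V 0" "v \<in> open_segment (fst e) (snd e)" using vert by blast
      then show "e \<in> (\<Union>v\<in>V 0. {e \<in> Bd. v \<in> open_segment (fst e) (snd e)})" using e by blast
    qed
    then have "card Bd \<le> card (\<Union>v\<in>V 0. {e \<in> Bd. v \<in> open_segment (fst e) (snd e)})"
      using finBd finite_V[of 0] by (intro card_mono) auto
    also have "\<dots> \<le> (\<Sum>v\<in>V 0. card {e \<in> Bd. v \<in> open_segment (fst e) (snd e)})"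
      by (rule card_UN_le[OF finite_V])
    also have "\<dots> \<le> (\<Sum>v\<in>V 0. 2)"
    proof (rule sum_mono)
      fix v assume "v \<in> V 0"
      show "card {e \<in> Bd. v \<in> open_segment (fst e) (snd e)} \<le> 2"
      proof (cases "{e \<in> Bd. v \<in> open_segment (fst e) (snd e)} = {}")
        case True
        show ?thesis unfolding True by simp
      next
        case False
        then obtain e where "e \<in> Bd" "v \<in> open_segment (fst e) (snd e)" by blast
        then have "(fst e, snd e) \<in> Bd" "v \<in> open_segment (fst e) (snd e)" by simp_all
        then obtain p q where pq: "(p, q) \<in> Bd" "v \<in> open_segment p q" by blast
        obtain \<sigma> where \<sigma>: "\<sigma> \<in> triangles (T n)" "p \<in> V n \<inter> \<sigma>" "q \<in> V n \<inter> \<sigma>" using edge[OF pq(1)] by blast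
        have "p \<noteq> q" using pq(2) by auto
        have "{e \<in> Bd. v \<in> open_segment (fst e) (snd e)} \<subseteq> {(p, q), (q, p)}"
        proof
          fix e assume e: "e \<in> {e \<in> Bd. v \<in> open_segment (fst e) (snd e)}"
          obtain p' q' where e': "e = (p', q')" by (cases e)
          then have v: "(p', q') \<in> Bd" "v \<in> open_segment p' q'" using e by simp_all
          obtain \<tau> where \<tau>: "\<tau> \<in> triangles (T n)" "p' \<in> V n \<inter> \<tau>" "q' \<in> V n \<inter> \<tau>" using edge[OF v(1)] by blast
          have "p' \<noteq> q'" using v(2) by auto
          show "e \<in> {(p, q), (q, p)}" unfolding e'
            by (rule vertex_edge_unique[OF T_complex \<sigma> \<open>p \<noteq> q\<close> \<tau> \<open>p' \<noteq> q'\<close> pq(2) v(2)])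
        qed
        then have "card {e \<in> Bd. v \<in> open_segment (fst e) (snd e)} \<le> card {(p, q), (q, p)}"
          by (rule card_mono[rotated]) simp
        also have "\<dots> = 2" using \<open>p \<noteq> q\<close> by simp
        finally show ?thesis .
      qed
    qed
    finally show ?thesis by simp
  qed
  have "chain_eval (edge_fun ?h) (b n) = (\<Sum>\<sigma>\<in>triangles (T n). bdry ?h (ccw_triple \<sigma>))"
    by (rule chain_eval_lift[OF antisymmetric_outer_error T_lift])
  also have "\<dots> = (\<Sum>\<sigma>\<in>triangles (T n). bdry (refine (V n) ?h) (ccw_triple \<sigma>))"
    by (intro sum.cong refl) (simp add: bdry_triangle_refine[OF T_complex])
  finally have "2 * chain_eval (edge_fun ?h) (b n) = (\<Sum>(p, q) \<in> gaps (V n). of_real (J p q) * ?h p q)"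
    using bdry_sum_refine[OF finite_V fin antisymmetric_outer_error ccw m, of "\<lambda>\<sigma>. \<sigma>"] unfolding J_def by simp
  also have "\<dots> = (\<Sum>(p, q) \<in> Bd. of_real (J p q) * ?h p q)"
    by (rule sum.mono_neutral_right[OF finite_gaps[OF finite_V]]) (auto simp: Bd_def)
  finally have "norm (2 * chain_eval (edge_fun ?h) (b n)) = norm (\<Sum>(p, q) \<in> Bd. of_real (J p q) * ?h p q)" by simp
  also have "\<dots> \<le> (\<Sum>e \<in> Bd. ?B)"
  proof (rule sum_norm_le)
    fix e assume e: "e \<in> Bd"
    obtain p q where pq: "e = (p, q)" by (cases e)
    have g: "(p, q) \<in> gaps (V n)" using e unfolding Bd_def pq by blast
    have "\<bar>J p q\<bar> * norm (?h p q) \<le> 1 * ?B" by (rule mult_mono[OF J1[OF g] hB[OF g]]) simp_all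
    then show "norm (case e of (p, q) \<Rightarrow> of_real (J p q) * ?h p q) \<le> ?B" by (simp add: pq norm_mult)
  qed
  also have "\<dots> = real (card Bd) * ?B" by simp
  also have "\<dots> \<le> real (2 * card (V 0)) * ?B" using card B0 by (intro mult_right_mono of_nat_mono)
  finally show ?thesis by (simp add: norm_mult)
qed

lemma outer_error_tendsto_0: "(\<lambda>n. chain_eval (edge_fun (outer_error n)) (b n)) \<longlonglongrightarrow> 0"
proof -
  obtain Y where Y: "young Y" by (rule young_ex)
  obtain D where D: "D > 0" "\<And>x y. x \<in> A \<Longrightarrow> y \<in> A \<Longrightarrow> dist x y \<le> D" using A_diameter by blast
  obtain c C where cC: "0 < c" "C < 1" "0 < C" "\<And>j. j \<in> S \<Longrightarrow> c \<le> rat j \<and> rat j \<le> C" using rat_range by blast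
  have C: "\<And>j. j \<in> S \<Longrightarrow> rat j \<le> C" using cC(4) by blast
  have "(\<lambda>n. C ^ n * D) \<longlonglongrightarrow> 0"
    by (rule tendsto_mult_left_zero[OF LIMSEQ_realpow_zero]) (use cC(2,3) in simp_all)
  then have "(\<lambda>n. (C ^ n * D) powr \<theta>) \<longlonglongrightarrow> 0"
    using \<alpha>_pos cC(3) D(1) by (intro tendsto_zero_powrI[where b = \<theta>]) auto
  then have "(\<lambda>n. real (card (V 0)) * (Y * (C ^ n * D) powr \<theta>)) \<longlonglongrightarrow> 0"
    by (intro tendsto_mult_right_zero)
  then show ?thesis
    by (rule Lim_null_comparison[rotated]) (simp add: outer_error_bound[OF Y D cC(3) C])
qed

lemma cocycle_Cauchy: "Cauchy (cyclic_quasi_cocycle X s f g)"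
proof -
  \<comment> \<open>The outer part is the refined sum minus the error. The sequence thus converges,
    to minus the limit of the refined sums.\<close>
  have "cyclic_quasi_cocycle X s f g n = chain_eval (edge_fun \<omega>) (b n)
      + chain_eval (edge_fun (outer_error n)) (b n) - outer_refined n" for n
    unfolding cyclic_quasi_cocycle_eq[OF T_lift] outer_error_eq[symmetric] by (simp add: A_def)
  moreover have "convergent outer_refined" using outer_refined_Cauchy by (simp add: Cauchy_convergent_iff)
  then obtain l where "outer_refined \<longlonglongrightarrow> l" unfolding convergent_def by blast
  then have "(\<lambda>n. chain_eval (edge_fun \<omega>) (b n) + chain_eval (edge_fun (outer_error n)) (b n) - outer_refined n)
      \<longlonglongrightarrow> 0 + 0 - l"
    by (intro tendsto_diff tendsto_add full_boundary_tendsto_0 outer_error_tendsto_0)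
  ultimately have "cyclic_quasi_cocycle X s f g \<longlonglongrightarrow> 0 + 0 - l" by presburger
  then show ?thesis by (rule LIMSEQ_imp_Cauchy)
qed

end

theorem theorem1p2:
  fixes X :: "plane set set" and S :: "'i set" and F :: "'i \<Rightarrow> plane \<Rightarrow> plane"
    and K :: "plane set" and \<alpha> :: real and f g :: "plane \<Rightarrow> complex"
    and T :: "nat \<Rightarrow> plane set set" and s :: "nat \<Rightarrow> chain"
  assumes "cellular_self_similar_structure X S F"
    and "card S \<ge> 2"
    and "cellular_self_similar_set X S F K"
    and "\<And>n. simplicial_subdivision X S F n (T n)"
    and "\<And>n. admissible_lift (T n) (level_space X S F n) (s n)"
    and "\<alpha> > 0"
    and "hausdorff_dim K < ereal (2 * \<alpha>)"
    and "f \<in> holder_functions \<alpha> K"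
    and "g \<in> holder_functions \<alpha> K"
  shows "Cauchy (cyclic_quasi_cocycle X s f g)"
proof -
  interpret cellular_cocycle X S F K \<alpha> f g T s
    by unfold_locales (fact assms)+
  show ?thesis by (rule cocycle_Cauchy)
qed

end
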